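(* Let $d\ge 2$. The classification algorithm described in the context is correct: given as input a finite list of representatives of all lattice isomorphism classes of reflexive $(d-1)$-polytopes, it outputs a finite list of Fano $d$-polytopes such that every Fano $d$-polytope is lattice isomorphic to at least one polytope in the list.
   Context: Polytopes. A reflexive $n$-polytope is an $n$-dimensional lattice polytope $Q\subseteq\mathbb{R}^n$ (vertices in $\mathbb{Z}^n$) with the origin in its interior whose dual $Q^*=\{y\in(\mathbb{R}^n)^*:\langle y,x\rangle\ge -1\ \forall x\in Q\}$ is a lattice polytope with respect to $(\mathbb{Z}^n)^*$. A Fano $d$-polytope is a $d$-dimensional lattice polytope in $\mathbb{R}^d$ with the origin in its interior such that the vertices of each facet form a lattice basis of $\mathbb{Z}^d$. Lattice isomorphism means equivalence under $GL_n(\mathbb{Z})$. $e_1,\dots,e_n$ is the standard basis of $\mathbb{Z}^n$. Facet types. Let $P'$ be a reflexive $(d-1)$-polytope and $G'$ a facet of $P'$. $G'$ is unimodular if it is a $(d-2)$-simplex whose vertices form an affine lattice basis (of the lattice points in its affine hull). $G'$ is called a circuit facet if it contains exactly $d$ lattice points $v'_1,\dots,v'_d$ and there is a circuit relation of type $(\star)$: $$\sum_{i\in I}v'_i=\sum_{j\in J}k_jv'_j\quad\text{with}\quad\sum_{j\in J}k_j=|I|=\mathrm{Vol}(G'),\qquad(\star)$$ where $I,J$ are non-empty disjoint subsets of $\{1,\dots,d\}$, the $k_j$ are positive integers, and $\mathrm{Vol}$ is normalized lattice volume (unimodular simplices have volume $1$). (There are at most two such relations: if all $k_j=1$, interchanging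 $I$ and $J$ gives another one.) Algorithm. Input: a finite list of all isomorphism classes of reflexive $(d-1)$-polytopes. (1) Output the Fano simplex associated to $\mathbb{P}^d$, i.e. $\mathrm{conv}(e_1,\dots,e_d,-e_1-\cdots-e_d)$. If $d$ is even, also output the Fano polytope associated to the $d/2$-fold product of $\mathbb{P}^2$ blown up in three torus-invariant points, i.e. the convex hull of the union of $d/2$ copies of the hexagon $\mathrm{conv}(\pm(1,0),\pm(0,1),\pm(1,1))$ placed in the summands of $\mathbb{R}^d=(\mathbb{R}^2)^{d/2}$. (2) Determine all $P'$ from the input list with at most $3d-1$ lattice points such that every facet of $P'$ is either unimodular or a circuit facet. (3) For each such $P'$ run through all facets $G'$ of $P'$. If $G'$ is unimodular, put $C'=G'$. If $G'=\mathrm{conv}(v'_1,\dots,v'_d)$ is a circuit facet, then for each circuit relation of type $(\star)$ and each $i\in I$ put $C'=\mathrm{conv}(\{v'_1,\dots,v'_d\}\setminus\{v'_i\})$. (4) For each such $C'$ apply a lattice transformation of $\mathbb{Z}^{d-1}$ (to $P'$) mapping the vertices of $C'$ onto $e_1,\dots,e_{d-1}$. (5) Put $k(0)=k(e_1)=\cdots=k(e_{d-1})=-1$. Run through all choices of $k(w')\in\{0,\dots,d-1\}$ for the lattice points $w'$ of $P'$ with $w'\notin\{0,e_1,\dots,e_{d-1}\}$ satisfying $\sum_{w'\in(P'\cap\mathbb{Z}^{d-1})\setminus\{0,e_1,\dots,e_{d-1}\}}k(w')\le d$ and such that $k(w')=0$ for at most $d$ lattice points $w'$. (6) For each such choice define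 a list $V$ of points of $\mathbb{Z}^d$ by assigning to each lattice point $w'=(w_1,\dots,w_{d-1})$ of $P'$ the point $w=(w_1,\dots,w_{d-1},w_d)\in V$ with $w_d=-w_1-\cdots-w_{d-1}-k(w')$ (so $0\in P'$ gives $e_d\in V$). (7) Run through all ways of choosing, among the lattice points of $P'$, at most three so-called double points subject to: the number of lattice points of $P'$ plus the number of double points is at most $3d-1$; no non-zero double point lies in a circuit facet of $P'$; every unimodular facet of $P'$ contains at most one double point; the origin may be chosen as a double point only if for every circuit facet of $P'$ all coefficients in a circuit relation of type $(\star)$ equal $1$; at most two non-zero double points are chosen, and two non-zero double points $w',u'$ may be chosen only if $u'=-w'$ and the associated points $w,u\in V$ satisfy $w+u=e_d$. (8) For each chosen non-zero double point $w'$ add $w-e_d$ to $V$. If the origin is chosen as a double point, add $-e_d$ to $V$. (9) Check whether $\mathrm{conv}(V)$ is a Fano polytope; if yes, output $\mathrm{conv}(V)$. *)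

theory Defs
  imports "HOL-Analysis.Analysis"
begin

section \<open>Lattice polytopes\<close>

definition lattice :: "(real ^ 'm) set" where
  "lattice = {x. \<forall>i. x $ i \<in> \<int>}"

definition lattice_points :: "(real ^ 'm) set \<Rightarrow> (real ^ 'm) set" where
  "lattice_points S = S \<inter> lattice"

definition vertices :: "(real ^ 'm) set \<Rightarrow> (real ^ 'm) set" where
  "vertices P = {v. v extreme_point_of P}"

definition lattice_polytope :: "(real ^ 'm) set \<Rightarrow> bool" where
  "lattice_polytope P \<longleftrightarrow> polytope P \<and> vertices P \<subseteq> lattice"

text \<open>The dual space is identified with the space itself through the standard inner product,
  which identifies the dual lattice with the lattice of integral vectors.\<close>

definition dual_polytope :: "(real ^ 'm) set \<Rightarrow> (real ^ 'm) set" where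
  "dual_polytope Q = {y. \<forall>x\<in>Q. y \<bullet> x \<ge> -1}"

definition reflexive_polytope :: "(real ^ 'm) set \<Rightarrow> bool" where
  "reflexive_polytope Q \<longleftrightarrow>
     lattice_polytope Q \<and> aff_dim Q = int CARD('m) \<and> 0 \<in> interior Q \<and>
     lattice_polytope (dual_polytope Q)"

definition lattice_basis :: "(real ^ 'm) set \<Rightarrow> bool" where
  "lattice_basis B \<longleftrightarrow>
     B \<subseteq> lattice \<and> independent B \<and>
     (\<forall>x\<in>lattice. \<exists>c :: real ^ 'm \<Rightarrow> int. x = (\<Sum>b\<in>B. of_int (c b) *\<^sub>R b))"

definition fano_polytope :: "(real ^ 'm) set \<Rightarrow> bool" where
  "fano_polytope P \<longleftrightarrow>
     lattice_polytope P \<and> aff_dim P = int CARD('m) \<and> 0 \<in> interior P \<and>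
     (\<forall>F. F facet_of P \<longrightarrow> lattice_basis (vertices F))"

text \<open>\<^const>\<open>invertible\<close> is used over the ring of integers, so these are exactly the maps
  given by matrices in \<open>GL\<^sub>m(\<int>)\<close>.\<close>

definition lattice_transformations :: "(real ^ 'm \<Rightarrow> real ^ 'm) set" where
  "lattice_transformations =
     {\<lambda>x. map_matrix of_int A *v x | A :: int ^ 'm ^ 'm. invertible A}"

definition lattice_isomorphic :: "(real ^ 'm) set \<Rightarrow> (real ^ 'm) set \<Rightarrow> bool" where
  "lattice_isomorphic P Q \<longleftrightarrow> (\<exists>f\<in>lattice_transformations. f ` P = Q)"

definition unit_vec :: "'m \<Rightarrow> real ^ 'm" where
  "unit_vec i = axis i 1"

section \<open>Normalized lattice volume\<close>

text \<open>A lattice frame of \<open>G\<close>, of dimension \<open>r\<close>, is a system of affine coordinates on the affine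
  hull of \<open>G\<close> in which the lattice points of the affine hull are the integral coordinate
  vectors. In such coordinates the volume of \<open>G\<close>, relative to its affine hull, is ordinary
  \<open>r\<close>-dimensional Lebesgue measure. It does not depend on the frame, because two frames differ
  by an affine map with linear part in \<open>GL\<^sub>r(\<int>)\<close>; the factor \<open>r!\<close> gives unimodular simplices
  volume 1.\<close>

definition lattice_frame :: "(real ^ 'm) set \<Rightarrow> real ^ 'm \<Rightarrow> (nat \<Rightarrow> real ^ 'm) \<Rightarrow> bool" where
  "lattice_frame G p b \<longleftrightarrow>
     (let r = nat (aff_dim G) in
        inj_on b {..<r} \<and> independent (b ` {..<r}) \<and>
        lattice_points (affine hull G) =
          {p + (\<Sum>i<r. of_int (c i) *\<^sub>R b i) | c :: nat \<Rightarrow> int. True})"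

definition normalized_volume :: "(real ^ 'm) set \<Rightarrow> real" where
  "normalized_volume G =
     (let r = nat (aff_dim G);
          (p, b) = (SOME (p, b). lattice_frame G p b);
          M = PiM {..<r} (\<lambda>_. lborel :: real measure)
      in fact r * measure M {t \<in> space M. p + (\<Sum>i<r. t i *\<^sub>R b i) \<in> G})"

section \<open>Facet types of reflexive (d-1)-polytopes\<close>

text \<open>Throughout, the coordinates of the space of dimension \<open>d - 1\<close> are indexed by an arbitrary
  finite type \<open>'n\<close>, and those of the space of dimension \<open>d\<close> by \<open>'n option\<close>, with
  \<^const>\<open>None\<close> as the index of the last coordinate. Thus \<open>d\<close> is \<open>CARD('n option)\<close>, which
  ranges over all numbers \<open>d \<ge> 2\<close>, because types are non-empty.\<close>

definition affine_lattice_basis :: "(real ^ 'm) set \<Rightarrow> bool" where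
  "affine_lattice_basis B \<longleftrightarrow>
     B \<subseteq> lattice \<and> \<not> affine_dependent B \<and>
     (\<forall>x\<in>lattice_points (affine hull B). \<exists>c :: real ^ 'm \<Rightarrow> int.
        (\<Sum>b\<in>B. c b) = 1 \<and> x = (\<Sum>b\<in>B. of_int (c b) *\<^sub>R b))"

definition unimodular_facet :: "(real ^ 'n) set \<Rightarrow> bool" where
  "unimodular_facet G \<longleftrightarrow>
     (int CARD('n option) - 2) simplex G \<and> affine_lattice_basis (vertices G)"

text \<open>The relation of type \<open>(\<star>)\<close>, with index sets replaced by the sets of lattice points they
  index.\<close>

definition circuit_relation ::
  "(real ^ 'n) set \<Rightarrow> (real ^ 'n) set \<Rightarrow> (real ^ 'n) set \<Rightarrow> (real ^ 'n \<Rightarrow> nat) \<Rightarrow> bool" where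
  "circuit_relation G I J c \<longleftrightarrow>
     I \<noteq> {} \<and> J \<noteq> {} \<and> I \<inter> J = {} \<and> I \<subseteq> lattice_points G \<and> J \<subseteq> lattice_points G \<and>
     (\<forall>v\<in>J. c v > 0) \<and>
     (\<Sum>v\<in>I. v) = (\<Sum>v\<in>J. of_nat (c v) *\<^sub>R v) \<and>
     (\<Sum>v\<in>J. c v) = card I \<and> real (card I) = normalized_volume G"

definition circuit_facet :: "(real ^ 'n) set \<Rightarrow> bool" where
  "circuit_facet G \<longleftrightarrow>
     card (lattice_points G) = CARD('n option) \<and> (\<exists>I J c. circuit_relation G I J c)"

section \<open>The algorithm\<close>

definition fano_simplex :: "(real ^ 'm) set" where
  "fano_simplex = convex hull (insert (- (\<Sum>i\<in>UNIV. unit_vec i)) (range unit_vec))"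

text \<open>The enumeration \<open>e\<close> of the coordinates determines the decomposition into planes: the
  \<open>j\<close>-th one has the coordinates \<open>e (2 * j)\<close> and \<open>e (2 * j + 1)\<close>.\<close>

definition hexagon :: "'m \<Rightarrow> 'm \<Rightarrow> (real ^ 'm) set" where
  "hexagon a b = convex hull
     {unit_vec a, - unit_vec a, unit_vec b, - unit_vec b,
      unit_vec a + unit_vec b, - (unit_vec a + unit_vec b)}"

definition hexagon_sum :: "(nat \<Rightarrow> 'm) \<Rightarrow> (real ^ 'm) set" where
  "hexagon_sum e = convex hull (\<Union>j<CARD('m) div 2. hexagon (e (2 * j)) (e (2 * j + 1)))"

definition admissible_polytope :: "(real ^ 'n) set \<Rightarrow> bool" where
  "admissible_polytope P \<longleftrightarrow>
     card (lattice_points P) \<le> 3 * CARD('n option) - 1 \<and>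
     (\<forall>G. G facet_of P \<longrightarrow> unimodular_facet G \<or> circuit_facet G)"

definition base_simplices :: "(real ^ 'n) set \<Rightarrow> (real ^ 'n) set set" where
  "base_simplices P =
     {G. G facet_of P \<and> unimodular_facet G} \<union>
     {convex hull (lattice_points G - {v}) | G I J c v.
        G facet_of P \<and> circuit_facet G \<and> circuit_relation G I J c \<and> v \<in> I}"

definition admissible_heights :: "(real ^ 'n) set \<Rightarrow> (real ^ 'n \<Rightarrow> int) \<Rightarrow> bool" where
  "admissible_heights P k \<longleftrightarrow>
     (let W = lattice_points P - insert 0 (range unit_vec) in
        k 0 = -1 \<and> (\<forall>i. k (unit_vec i) = -1) \<and>
        (\<forall>w\<in>W. 0 \<le> k w \<and> k w \<le> int CARD('n option) - 1) \<and>
        (\<Sum>w\<in>W. k w) \<le> int CARD('n option) \<and>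
        card {w \<in> lattice_points P. k w = 0} \<le> CARD('n option))"

definition lift_point :: "(real ^ 'n \<Rightarrow> int) \<Rightarrow> real ^ 'n \<Rightarrow> real ^ ('n option)" where
  "lift_point k w =
     (\<chi> i. case i of Some j \<Rightarrow> w $ j | None \<Rightarrow> - (\<Sum>j\<in>UNIV. w $ j) - of_int (k w))"

definition admissible_double_points ::
  "(real ^ 'n) set \<Rightarrow> (real ^ 'n \<Rightarrow> int) \<Rightarrow> (real ^ 'n) set \<Rightarrow> bool" where
  "admissible_double_points P k D \<longleftrightarrow>
     D \<subseteq> lattice_points P \<and> card D \<le> 3 \<and>
     card (lattice_points P) + card D \<le> 3 * CARD('n option) - 1 \<and>
     (\<forall>w\<in>D - {0}. \<forall>G. G facet_of P \<and> circuit_facet G \<longrightarrow> w \<notin> G) \<and>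
     (\<forall>G. G facet_of P \<and> unimodular_facet G \<longrightarrow> card (D \<inter> G) \<le> 1) \<and>
     (0 \<in> D \<longrightarrow> (\<forall>G I J c. G facet_of P \<and> circuit_facet G \<and> circuit_relation G I J c \<longrightarrow>
        (\<forall>v\<in>J. c v = 1))) \<and>
     card (D - {0}) \<le> 2 \<and>
     (\<forall>w\<in>D - {0}. \<forall>u\<in>D - {0}. w \<noteq> u \<longrightarrow>
        u = - w \<and> lift_point k w + lift_point k u = unit_vec None)"

definition lifted_points ::
  "(real ^ 'n) set \<Rightarrow> (real ^ 'n \<Rightarrow> int) \<Rightarrow> (real ^ 'n) set \<Rightarrow> (real ^ ('n option)) set" where
  "lifted_points P k D =
     lift_point k ` lattice_points P \<union>
     {lift_point k w - unit_vec None | w. w \<in> D - {0}} \<union>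
     (if 0 \<in> D then {- unit_vec None} else {})"

text \<open>The algorithm leaves open which lattice transformation is applied for a given \<open>P'\<close> and
  \<open>C'\<close>; \<open>T\<close> records such choices, and a run is possible only if a suitable transformation
  exists for every \<open>C'\<close> that occurs. Only the set of output polytopes is prescribed, not their
  order or repetitions in the list.\<close>

definition admissible_transformations ::
  "(real ^ 'n) set list \<Rightarrow> ((real ^ 'n) set \<Rightarrow> (real ^ 'n) set \<Rightarrow> real ^ 'n \<Rightarrow> real ^ 'n) \<Rightarrow> bool"
  where
  "admissible_transformations Ps T \<longleftrightarrow>
     (\<forall>P\<in>set Ps. admissible_polytope P \<longrightarrow>
        (\<forall>C\<in>base_simplices P.
           T P C \<in> lattice_transformations \<and> T P C ` vertices C = range unit_vec))"

definition constructed_polytopes ::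
  "(real ^ 'n) set list \<Rightarrow> ((real ^ 'n) set \<Rightarrow> (real ^ 'n) set \<Rightarrow> real ^ 'n \<Rightarrow> real ^ 'n) \<Rightarrow>
     (real ^ ('n option)) set set" where
  "constructed_polytopes Ps T =
     {convex hull (lifted_points (T P C ` P) k D) | P C k D.
        P \<in> set Ps \<and> admissible_polytope P \<and> C \<in> base_simplices P \<and>
        admissible_heights (T P C ` P) k \<and> admissible_double_points (T P C ` P) k D \<and>
        fano_polytope (convex hull (lifted_points (T P C ` P) k D))}"

definition algorithm_run :: "(real ^ 'n) set list \<Rightarrow> (real ^ ('n option)) set list \<Rightarrow> bool" where
  "algorithm_run Ps L \<longleftrightarrow>
     (\<exists>e T. bij_betw e {..<CARD('n option)} (UNIV :: 'n option set) \<and>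
        admissible_transformations Ps T \<and>
        set L = {fano_simplex} \<union> (if even CARD('n option) then {hexagon_sum e} else {}) \<union>
          constructed_polytopes Ps T)"

end

theory Submission
  imports Defs
begin

text \<open>Let \<open>V\<close> be the set of vertices of a Fano polytope. Some facet, with normal \<open>u\<close>, has
  \<open>u \<bullet> \<Sum>V \<ge> 0\<close>. Its \<open>d\<close> vertices have height 1; every vertex of height 0 belongs to a
  neighbouring facet, and each neighbouring facet contains at most one, so that at most \<open>d\<close>
  vertices have height 0; and at most \<open>d\<close> have negative height. Hence \<open>card V \<le> 3 * d\<close>, and a
  vertex of height \<open>-d\<close> forces the simplex. In the case of equality \<open>\<Sum>V = 0\<close>, every facet is
  extremal in the same way, and this makes \<open>V\<close> a sum of hexagons.

  Otherwise divide out a vertex \<open>v\<close> of the facet. The result is a reflexive polytope whose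
  lattice points are the images of the vertices and 0, and each of its facets is covered either
  by a face of codimension two that lies in a facet through \<open>v\<close>, or by a facet parallel to \<open>v\<close>.
  In the second case the coordinates of \<open>v\<close> with respect to that facet, negative ones being
  \<open>-1\<close>, give the circuit relation. The fiber of a non-zero point contains at most two
  vertices, which then differ by \<open>v\<close>, so the polytope is recovered from the heights of the upper
  ones together with the double points.\<close>

section \<open>Lattice bases and lattice transformations\<close>

text \<open>Everything about heights rests on the unimodularity of two adjacent facets: the vertex
  that replaces \<open>b\<close> has coordinate exactly -1 at \<open>b\<close>, and a vertex at
  height 0 with a negative coordinate at \<open>b\<close> must be this replacement. For the same
  reason the negative coordinates of \<open>v\<close> with respect to a facet parallel to
  \<open>v\<close> are all -1. The constants of the algorithm mark exceptional cases. The bound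
  \<open>d - 1\<close> for the heights fails on the chosen facet only if some vertex has height
  \<open>-d\<close>; then \<open>\<Sum>V = 0\<close>, so every facet may be chosen, and either a
  neighbouring facet satisfies the bound or the polytope is a simplex. The bound
  \<open>3 * d - 1\<close> excludes just the sums of hexagons. The volume condition of a circuit
  relation is used in both directions. A circuit facet is triangulated by the simplices that omit
  one point of \<open>I\<close>, each of positive integral volume, so the volume equals
  \<open>card I\<close> if and only if all of them are unimodular. This yields the transformations
  that a run requires, and it shows that the non-simplicial facets of a projection are circuit
  facets.\<close>

lemma lattice_0 [simp]: "0 \<in> lattice"
  by (simp add: lattice_def)

lemma lattice_add: "x \<in> lattice \<Longrightarrow> y \<in> lattice \<Longrightarrow> x + y \<in> lattice"
  by (simp add: lattice_def)

lemma lattice_diff: "x \<in> lattice \<Longrightarrow> y \<in> lattice \<Longrightarrow> x - y \<in> lattice"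
  by (simp add: lattice_def)

lemma lattice_minus: "x \<in> lattice \<Longrightarrow> - x \<in> lattice"
  by (simp add: lattice_def)

lemma lattice_scale: "x \<in> lattice \<Longrightarrow> c \<in> \<int> \<Longrightarrow> c *\<^sub>R x \<in> lattice"
  by (simp add: lattice_def)

lemma lattice_sum: "(\<And>i. i \<in> I \<Longrightarrow> f i \<in> lattice) \<Longrightarrow> (\<Sum>i\<in>I. f i) \<in> lattice"
  by (induction I rule: infinite_finite_induct) (auto intro: lattice_add)

lemma lattice_unit_vec [simp]: "unit_vec i \<in> lattice"
  by (simp add: lattice_def unit_vec_def axis_def)

lemma lattice_inner: "x \<in> lattice \<Longrightarrow> y \<in> lattice \<Longrightarrow> x \<bullet> y \<in> \<int>"
  by (auto simp: lattice_def inner_vec_def intro!: Ints_sum)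

text \<open>The integral lattice is its own dual: testing against the unit vectors returns the
  coordinates.\<close>

lemma latticeI_inner: "(\<And>x. x \<in> lattice \<Longrightarrow> y \<bullet> x \<in> \<int>) \<Longrightarrow> y \<in> lattice"
  unfolding lattice_def
proof (intro CollectI allI)
  fix i assume *: "\<And>x. x \<in> {x. \<forall>i. x $ i \<in> \<int>} \<Longrightarrow> y \<bullet> x \<in> \<int>"
  have "y \<bullet> axis i 1 \<in> \<int>" by (rule *) (auto simp: axis_def)
  then show "y $ i \<in> \<int>" by (simp add: inner_axis)
qed

lemma span_unit_vec: "span (range (unit_vec :: 'm \<Rightarrow> real ^ 'm)) = UNIV"
proof -
  have "Basis \<subseteq> range (unit_vec :: 'm \<Rightarrow> real ^ 'm)"
    by (auto simp: Basis_vec_def unit_vec_def)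
  then show ?thesis by (metis span_Basis span_mono top.extremum_uniqueI)
qed

lemma unit_vec_eq_iff [simp]: "unit_vec i = unit_vec j \<longleftrightarrow> i = j"
  by (auto simp: unit_vec_def axis_eq_axis)

lemma unit_vec_nth: "unit_vec i $ j = (if j = i then 1 else 0)"
  by (auto simp: unit_vec_def axis_def)

lemma vec_eq_sum_unit_vec: "(x :: real ^ 'm) = (\<Sum>i\<in>UNIV. (x $ i) *\<^sub>R unit_vec i)"
  by (simp add: vec_eq_iff unit_vec_nth if_distrib cong: if_cong)

text \<open>The coordinate functional at \<open>b\<close>, written as a vector through the inner
  product. It is determined only up to the orthogonal complement of \<open>span B\<close>, hence the
  choice; for a basis of the whole space it is the dual basis.\<close>

definition dual_vec :: "'a::euclidean_space set \<Rightarrow> 'a \<Rightarrow> 'a" where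
  "dual_vec B b = (SOME f. \<forall>c\<in>B. f \<bullet> c = (if c = b then 1 else 0))"

lemma dual_vec:
  fixes B :: "'a::euclidean_space set"
  assumes "independent B" "c \<in> B"
  shows "dual_vec B b \<bullet> c = (if c = b then 1 else 0)"
proof -
  obtain g :: "'a \<Rightarrow> real" where g: "linear g" "\<forall>c\<in>B. g c = (if c = b then 1 else 0)"
    using linear_independent_extend[OF assms(1), of "\<lambda>c. if c = b then 1 else 0"] by blast
  have "\<forall>c\<in>B. adjoint g 1 \<bullet> c = (if c = b then 1 else 0)"
    using adjoint_works[OF g(1)] g(2) by (metis inner_commute inner_real_def mult.right_neutral)
  then have "\<forall>c\<in>B. dual_vec B b \<bullet> c = (if c = b then 1 else 0)"
    unfolding dual_vec_def by (rule someI)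
  then show ?thesis using assms by blast
qed

lemma dual_vec_sum:
  assumes "independent B" "b \<in> B"
  shows "dual_vec B b \<bullet> (\<Sum>c\<in>B. f c *\<^sub>R c) = f b"
proof -
  have "dual_vec B b \<bullet> (\<Sum>c\<in>B. f c *\<^sub>R c) = (\<Sum>c\<in>B. f c * (if c = b then 1 else 0))"
    using assms by (simp add: inner_sum_right dual_vec)
  also have "\<dots> = f b"
    using assms(2) independent_imp_finite[OF assms(1)] by (simp add: if_distrib cong: if_cong)
  finally show ?thesis .
qed

lemma dual_vec_expand:
  assumes "independent B" "span B = UNIV"
  shows "x = (\<Sum>b\<in>B. (dual_vec B b \<bullet> x) *\<^sub>R b)"
proof -
  have "finite B" using assms independent_imp_finite by blast
  then obtain f where f: "x = (\<Sum>c\<in>B. f c *\<^sub>R c)"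
    using assms(2) span_finite[of B] by auto
  have "(\<Sum>b\<in>B. (dual_vec B b \<bullet> x) *\<^sub>R b) = (\<Sum>b\<in>B. f b *\<^sub>R b)"
    by (rule sum.cong) (use dual_vec_sum[OF assms(1)] f in auto)
  then show ?thesis using f by simp
qed

lemma inner_eq_on_spanning:
  assumes "span B = UNIV" "\<And>b. b \<in> B \<Longrightarrow> u \<bullet> b = w \<bullet> b"
  shows "u = w"
proof -
  have "u \<bullet> x = w \<bullet> x" for x
    using linear_eq_on_span[of "\<lambda>x. u \<bullet> x" "\<lambda>x. w \<bullet> x" B x] assms
    by (simp add: bounded_linear.linear bounded_linear_inner_right)
  then show ?thesis by (metis inner_commute vector_eq_ldot)
qed

lemma lattice_basis_expand:
  assumes "lattice_basis B" "x \<in> lattice"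
  shows "\<exists>c :: _ \<Rightarrow> int. x = (\<Sum>b\<in>B. of_int (c b) *\<^sub>R b)"
  using assms unfolding lattice_basis_def by blast

lemma lattice_basisD:
  fixes B :: "(real ^ 'm) set"
  assumes "lattice_basis B"
  shows "B \<subseteq> lattice" "independent B" "finite B" "span B = UNIV" "card B = CARD('m)"
proof -
  show *: "B \<subseteq> lattice" "independent B" using assms by (auto simp: lattice_basis_def)
  show "finite B" using * independent_imp_finite by blast
  have "unit_vec i \<in> span B" for i :: 'm
  proof -
    obtain c :: "real ^ 'm \<Rightarrow> int" where "unit_vec i = (\<Sum>b\<in>B. of_int (c b) *\<^sub>R b)"
      using assms lattice_unit_vec unfolding lattice_basis_def by blast
    then show ?thesis by (metis (no_types, lifting) span_base span_scale span_sum)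
  qed
  then have "span (range unit_vec) \<subseteq> span B" by (intro span_minimal) auto
  then show "span B = UNIV" using span_unit_vec by blast
  then show "card B = CARD('m)"
    using * by (metis DIM_cart DIM_real dim_UNIV dim_span_eq_card_independent mult.right_neutral)
qed

lemma lattice_basis_coord:
  assumes "lattice_basis B" "x \<in> lattice" "b \<in> B"
  shows "dual_vec B b \<bullet> x \<in> \<int>"
proof -
  obtain c :: "_ \<Rightarrow> int" where "x = (\<Sum>b\<in>B. of_int (c b) *\<^sub>R b)"
    using assms by (auto simp: lattice_basis_def)
  then show ?thesis using dual_vec_sum[of B b "\<lambda>b. of_int (c b)"] assms
    by (auto simp: lattice_basis_def)
qed

lemma lattice_basis_unit_vec: "lattice_basis (range (unit_vec :: 'm \<Rightarrow> real ^ 'm))"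
  unfolding lattice_basis_def
proof (intro conjI ballI)
  have "range (unit_vec :: 'm \<Rightarrow> real ^ 'm) \<subseteq> Basis"
    by (auto simp: Basis_vec_def unit_vec_def)
  then show "independent (range (unit_vec :: 'm \<Rightarrow> real ^ 'm))"
    using independent_Basis independent_mono by blast
  fix x :: "real ^ 'm" assume x: "x \<in> lattice"
  let ?c = "\<lambda>b :: real ^ 'm. \<lfloor>x $ (inv unit_vec b)\<rfloor>"
  have i: "inv unit_vec (unit_vec i :: real ^ 'm) = i" for i by (rule inv_f_f) (simp add: inj_def)
  have "(\<Sum>b\<in>range unit_vec. of_int (?c b) *\<^sub>R b) = (\<Sum>i\<in>UNIV. of_int (?c (unit_vec i)) *\<^sub>R unit_vec i)"
    by (subst sum.reindex) (auto intro: injI)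
  also have "\<dots> = (\<Sum>i\<in>UNIV. (x $ i) *\<^sub>R unit_vec i)"
    using x by (intro sum.cong) (auto simp: i lattice_def of_int_floor)
  finally show "\<exists>c. x = (\<Sum>b\<in>range unit_vec. real_of_int (c b) *\<^sub>R b)"
    using vec_eq_sum_unit_vec[of x] by (intro exI[of _ ?c]) simp
qed auto

lemma lattice_basis_funct_int:
  assumes "lattice_basis B" "\<And>b. b \<in> B \<Longrightarrow> u \<bullet> b \<in> \<int>" "x \<in> lattice"
  shows "u \<bullet> x \<in> \<int>"
proof -
  have "x = (\<Sum>b\<in>B. (dual_vec B b \<bullet> x) *\<^sub>R b)"
    using lattice_basisD[OF assms(1)] by (intro dual_vec_expand) auto
  then have "u \<bullet> x = (\<Sum>b\<in>B. (dual_vec B b \<bullet> x) * (u \<bullet> b))"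
    by (metis (no_types, lifting) inner_scaleR_right inner_sum_right sum.cong)
  then show ?thesis using assms lattice_basis_coord[OF assms(1,3)] by (auto intro!: Ints_sum)
qed

section \<open>Linear maps that preserve the lattice\<close>

lemma image_inverse: "(\<And>x. g (f x) = x) \<Longrightarrow> g ` f ` S = S"
  by (simp add: image_image)

text \<open>Replaces integral matrices by a condition that is stable under images and inverses.
  Conversely, such an \<open>f\<close> and its inverse map unit vectors to lattice points, so both
  matrices are integral, and injectivity of \<open>of_int\<close> turns their product into an
  identity over the integers.\<close>

lemma lattice_transformations_eq:
  "lattice_transformations = {f :: real ^ 'm \<Rightarrow> real ^ 'm. linear f \<and> bij f \<and> f ` lattice = lattice}"
proof (intro equalityI subsetI CollectI)
  have maps: "(map_matrix of_int A :: real ^ 'm ^ 'm) *v x \<in> lattice"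
    if "x \<in> lattice" for A :: "int ^ 'm ^ 'm" and x :: "real ^ 'm"
    using that by (auto simp: lattice_def matrix_vector_mult_def map_matrix_def intro!: Ints_sum Ints_mult)
  have mm: "(map_matrix of_int A :: real ^ 'm ^ 'm) ** map_matrix of_int B = map_matrix of_int (A ** B)"
    for A B :: "int ^ 'm ^ 'm"
    by (simp add: matrix_matrix_mult_def map_matrix_def vec_eq_iff)
  have m1: "(map_matrix of_int (mat 1 :: int ^ 'm ^ 'm) :: real ^ 'm ^ 'm) = mat 1"
    by (simp add: mat_def map_matrix_def vec_eq_iff)
  fix f :: "real ^ 'm \<Rightarrow> real ^ 'm"
  {
    assume "f \<in> lattice_transformations"
    then obtain A :: "int ^ 'm ^ 'm" where f: "f = (*v) (map_matrix of_int A)" and "invertible A"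
      by (auto simp: lattice_transformations_def)
    then obtain B where AB: "A ** B = mat 1" "B ** A = mat 1" by (auto simp: invertible_def)
    define g where "g = (*v) (map_matrix of_int B :: real ^ 'm ^ 'm)"
    have fg: "f (g x) = x" "g (f x) = x" for x
      using AB by (simp_all add: f g_def matrix_vector_mul_assoc mm m1)
    have "bij f" using fg by (intro o_bij[of g]) auto
    moreover have "lattice \<subseteq> f ` lattice"
      using maps fg by (metis g_def image_eqI subsetI)
    ultimately show "linear f \<and> bij f \<and> f ` lattice = lattice"
      using maps by (auto simp: f matrix_vector_mul_linear)
  }
  {
    assume "f \<in> {f. linear f \<and> bij f \<and> f ` lattice = lattice}"
    then have f: "linear f" "bij f" "f ` lattice = lattice" by auto
    define g where "g = inv f"
    have g: "linear g" unfolding g_def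
      using f by (metis bij_def inj_linear_imp_inv_linear)
    have fg: "f (g x) = x" "g (f x) = x" for x
      using surj_f_inv_f[OF bij_is_surj[OF f(2)]] inv_f_f[OF bij_is_inj[OF f(2)]] by (auto simp: g_def)
    have gl: "g ` lattice = lattice" using image_inverse[of g f lattice] f(3) fg by simp
    have int: "\<exists>A. matrix h = (map_matrix of_int A :: real ^ 'm ^ 'm)"
      if "h ` lattice = lattice" for h :: "real ^ 'm \<Rightarrow> real ^ 'm"
    proof -
      have "h (axis j 1) $ i \<in> \<int>" for i j
        using that lattice_unit_vec[of j] by (auto simp: lattice_def unit_vec_def)
      then show ?thesis
        by (intro exI[of _ "\<chi> i j. \<lfloor>h (axis j 1) $ i\<rfloor>"])
          (auto simp: matrix_def map_matrix_def vec_eq_iff of_int_floor)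
    qed
    obtain A B where A: "matrix f = (map_matrix of_int A :: real ^ 'm ^ 'm)"
      and B: "matrix g = (map_matrix of_int B :: real ^ 'm ^ 'm)"
      using int[OF f(3)] int[OF gl] by blast
    have inj: "C = D" if "(map_matrix of_int C :: real ^ 'm ^ 'm) = map_matrix of_int D" for C D :: "int ^ 'm ^ 'm"
      using that by (auto simp: map_matrix_def vec_eq_iff)
    have "matrix f ** matrix g = mat 1" "matrix g ** matrix f = mat 1"
      using matrix_compose[OF g f(1)] matrix_compose[OF f(1) g] fg
      by (simp_all add: o_def matrix_id_mat_1[unfolded id_def])
    then have "A ** B = mat 1" "B ** A = mat 1"
      by (auto intro!: inj simp: A B m1 simp flip: mm)
    then have "invertible A" by (auto simp: invertible_def)
    moreover have "f = (*v) (map_matrix of_int A)" using f(1) by (simp flip: A)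
    ultimately show "f \<in> lattice_transformations" by (auto simp: lattice_transformations_def)
  }
qed

lemma lattice_transformation_inv:
  assumes "f \<in> lattice_transformations"
  shows "inv f \<in> lattice_transformations" "f (inv f x) = x" "inv f (f x) = x"
proof -
  have f: "linear f" "bij f" "f ` lattice = lattice"
    using assms unfolding lattice_transformations_eq by auto
  have e: "f (inv f x) = x" "inv f (f x) = x" for x
    using surj_f_inv_f[OF bij_is_surj[OF f(2)]] inv_f_f[OF bij_is_inj[OF f(2)]] by auto
  have "inv f ` lattice = lattice" using image_inverse[of "inv f" f lattice] f(3) e by simp
  moreover have "linear (inv f)" using f by (simp add: inj_linear_imp_inv_linear bij_is_inj)
  ultimately show "inv f \<in> lattice_transformations"
    using bij_imp_bij_inv[OF f(2)] unfolding lattice_transformations_eq by blast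
  show "f (inv f x) = x" "inv f (f x) = x" by (fact e)+
qed

lemma lattice_isomorphic_sym:
  assumes "lattice_isomorphic P Q"
  shows "lattice_isomorphic Q P"
proof -
  obtain f where f: "f \<in> lattice_transformations" "f ` P = Q"
    using assms unfolding lattice_isomorphic_def by blast
  have "inv f ` Q = P"
    using image_inverse[of "inv f" f P] f lattice_transformation_inv[OF f(1)] by simp
  then show ?thesis using lattice_transformation_inv(1)[OF f(1)] unfolding lattice_isomorphic_def by blast
qed

lemma lattice_basis_map:
  assumes "linear f" "inj_on f (span B)" "lattice_basis B" "f ` lattice = (lattice :: (real ^ 'k) set)"
  shows "lattice_basis (f ` B)"
  unfolding lattice_basis_def
proof (intro conjI ballI)
  note B = lattice_basisD[OF assms(3)]
  show "f ` B \<subseteq> lattice" using assms(4) B(1) by blast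
  show "independent (f ` B)" using linear_independent_injective_image[OF assms(1) B(2)] assms(2) by simp
  have injB: "inj_on f B" using assms(2) span_superset inj_on_subset by blast
  fix x :: "real ^ 'k" assume "x \<in> lattice"
  then obtain y where y: "x = f y" "y \<in> lattice" using assms(4) by blast
  then obtain c :: "_ \<Rightarrow> int" where c: "y = (\<Sum>b\<in>B. of_int (c b) *\<^sub>R b)"
    using assms(3) by (auto simp: lattice_basis_def)
  have "x = (\<Sum>b\<in>B. of_int (c b) *\<^sub>R f b)"
    by (simp add: y c linear_sum[OF assms(1)] linear_scale[OF assms(1)])
  also have "\<dots> = (\<Sum>b\<in>f ` B. of_int ((c \<circ> inv_into B f) b) *\<^sub>R b)"
    by (subst sum.reindex[OF injB]) (use injB in auto)
  finally show "\<exists>c. x = (\<Sum>b\<in>f ` B. real_of_int (c b) *\<^sub>R b)" by blast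
qed

lemma lattice_basis_image:
  assumes "f \<in> lattice_transformations" "lattice_basis B"
  shows "lattice_basis (f ` B)"
  using assms by (intro lattice_basis_map) (auto simp: lattice_transformations_eq intro: inj_on_subset[OF bij_is_inj])

text \<open>The image spans, so \<open>f\<close> is onto; equal cardinalities make it injective on
  the basis and hence everywhere. The index types may differ because the volume computation passes
  between \<open>'n\<close> and its ordered copy \<open>'n wo\<close>.\<close>

lemma lattice_basis_map_bij:
  fixes f :: "real ^ 'a \<Rightarrow> real ^ 'b"
  assumes "linear f" "lattice_basis B" "lattice_basis (f ` B)" "CARD('a) = CARD('b)"
  shows "bij f" "f ` lattice = lattice"
proof -
  note B = lattice_basisD[OF assms(2)] and C = lattice_basisD[OF assms(3)]
  have s: "surj f" using linear_span_image[OF assms(1), of B] B(4) C(4) by simp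
  have injB: "inj_on f B" using B(3,5) C(5) assms(4) by (simp add: eq_card_imp_inj_on)
  have "inj_on f (span B)"
    using linear_inj_on_span_iff_independent_image[OF assms(1) C(2)] injB by simp
  then show "bij f" using B(4) s by (simp add: bij_def)
  have "f x \<in> lattice" if x: "x \<in> lattice" for x
  proof -
    obtain c :: "_ \<Rightarrow> int" where c: "x = (\<Sum>b\<in>B. of_int (c b) *\<^sub>R b)"
      using lattice_basis_expand[OF assms(2) x] by blast
    show ?thesis using C(1)
      by (auto simp: c linear_sum[OF assms(1)] linear_scale[OF assms(1)] intro!: lattice_sum lattice_scale)
  qed
  moreover have "x \<in> f ` lattice" if x: "x \<in> lattice" for x
  proof -
    obtain c :: "_ \<Rightarrow> int" where c: "x = (\<Sum>b\<in>f ` B. of_int (c b) *\<^sub>R b)"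
      using lattice_basis_expand[OF assms(3) x] by blast
    have "x = f (\<Sum>b\<in>B. of_int (c (f b)) *\<^sub>R b)"
      by (simp add: c linear_sum[OF assms(1)] linear_scale[OF assms(1)] sum.reindex[OF injB])
    then show ?thesis using B(1) by (auto intro!: lattice_sum lattice_scale)
  qed
  ultimately show "f ` lattice = lattice" by auto
qed

lemma lattice_transformationI:
  fixes f :: "real ^ 'm \<Rightarrow> real ^ 'm"
  assumes "linear f" "lattice_basis B" "lattice_basis (f ` B)"
  shows "f \<in> lattice_transformations"
  using assms lattice_basis_map_bij[OF assms refl] by (simp add: lattice_transformations_eq)

section \<open>Facets and their normals\<close>

text \<open>If 0 is interior to \<open>convex hull W\<close>, a facet is represented by the unique functional that
  has the constant value 1 on it; \<open>tight\<close> gives the points of \<open>W\<close> on the facet.\<close>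

definition tight :: "'a::real_inner set \<Rightarrow> 'a \<Rightarrow> 'a set" where
  "tight W u = {w \<in> W. u \<bullet> w = 1}"

definition facet_normal :: "'a::real_inner set \<Rightarrow> 'a \<Rightarrow> bool" where
  "facet_normal W u \<longleftrightarrow> (\<forall>w\<in>W. u \<bullet> w \<le> 1) \<and> span (tight W u) = UNIV"

lemma facet_normal_le: "facet_normal W u \<Longrightarrow> w \<in> W \<Longrightarrow> u \<bullet> w \<le> 1"
  by (simp add: facet_normal_def)

lemma tight_subset: "tight W u \<subseteq> W"
  by (auto simp: tight_def)

lemma tight_inner: "b \<in> tight W u \<Longrightarrow> u \<bullet> b = 1"
  by (simp add: tight_def)

lemma inner_le_convex_hull:
  assumes "\<And>w. w \<in> W \<Longrightarrow> u \<bullet> w \<le> c" "x \<in> convex hull W"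
  shows "u \<bullet> x \<le> c"
proof -
  have "convex hull W \<subseteq> {x. u \<bullet> x \<le> c}"
    using assms(1) by (intro hull_minimal) (auto simp: convex_halfspace_le)
  then show ?thesis using assms(2) by blast
qed

lemma inner_eq_convex_hull:
  assumes "\<And>w. w \<in> W \<Longrightarrow> u \<bullet> w = c" "x \<in> convex hull W"
  shows "u \<bullet> x = c"
proof -
  have "convex hull W \<subseteq> {x. u \<bullet> x = c}"
    using assms(1) by (intro hull_minimal) (auto simp: convex_hyperplane)
  then show ?thesis using assms(2) by blast
qed

text \<open>A convex combination attains the maximal value 1 only if every point with positive
  weight does: the weighted sum of the slacks \<open>1 - u \<bullet> w\<close> vanishes and has
  non-negative terms.\<close>

lemma convex_hull_tight:
  assumes "finite W" "\<And>w. w \<in> W \<Longrightarrow> u \<bullet> w \<le> 1"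
  shows "convex hull W \<inter> {x. u \<bullet> x = 1} = convex hull (tight W u)"
proof (intro equalityI subsetI)
  fix x assume x: "x \<in> convex hull W \<inter> {x. u \<bullet> x = 1}"
  then obtain c where c: "\<forall>w\<in>W. 0 \<le> c w" "sum c W = 1" "(\<Sum>w\<in>W. c w *\<^sub>R w) = x"
    using assms(1) by (auto simp: convex_hull_finite)
  have "(\<Sum>w\<in>W. c w * (1 - u \<bullet> w)) = sum c W - u \<bullet> (\<Sum>w\<in>W. c w *\<^sub>R w)"
    by (simp add: inner_sum_right right_diff_distrib sum_subtractf)
  also have "\<dots> = 0" using c x by simp
  finally have "\<forall>w\<in>W. c w * (1 - u \<bullet> w) = 0"
    using c assms by (subst (asm) sum_nonneg_eq_0_iff) auto
  then have z: "c w = 0" if "w \<in> W - tight W u" for w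
    using that by (auto simp: tight_def)
  have "sum c (tight W u) = 1"
    using c(2) z tight_subset[of W u] by (subst sum.mono_neutral_left[OF assms(1)]) auto
  moreover have "(\<Sum>w\<in>tight W u. c w *\<^sub>R w) = x"
    unfolding c(3)[symmetric] using z tight_subset[of W u]
    by (intro sum.mono_neutral_left assms(1)) auto
  ultimately show "x \<in> convex hull (tight W u)"
    using c(1) finite_subset[OF tight_subset assms(1)] tight_subset[of W u]
    by (auto simp: convex_hull_finite)
next
  fix x assume x: "x \<in> convex hull (tight W u)"
  then show "x \<in> convex hull W \<inter> {x. u \<bullet> x = 1}"
    using hull_mono[OF tight_subset[of W u], of convex] inner_eq_convex_hull[of "tight W u" u 1 x] tight_inner
    by auto
qed

text \<open>The affine hull of a set at height 1 misses 0, so adjoining 0 raises the affine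
  dimension by one and turns it into the linear dimension.\<close>

lemma aff_dim_hyperplane_span:
  fixes T :: "'a::euclidean_space set"
  assumes "\<And>x. x \<in> T \<Longrightarrow> u \<bullet> x = 1"
  shows "int (dim (span T)) = aff_dim T + 1"
proof -
  have "affine hull T \<subseteq> {x. u \<bullet> x = 1}"
    using assms by (intro hull_minimal) (auto simp: affine_hyperplane)
  then have "0 \<notin> affine hull T" by auto
  then have "aff_dim (insert 0 T) = aff_dim T + 1" by (simp add: aff_dim_insert)
  moreover have "aff_dim (insert 0 T) = int (dim (insert 0 T))"
    by (intro aff_dim_zero hull_inc) simp
  ultimately show ?thesis by (metis (no_types, lifting) dim_span span_insert_0)
qed

lemma aff_dim_interior_0: "0 \<in> interior (S :: 'a::euclidean_space set) \<Longrightarrow> aff_dim S = int DIM('a)"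
  by (intro aff_dim_nonempty_interior) auto

text \<open>Because 0 is interior, a supporting hyperplane has positive offset and can be scaled to
  offset 1. At height 1, having codimension one is the same as spanning the space.\<close>

lemma facet_of_convex_hull_iff:
  fixes W :: "'a::euclidean_space set"
  assumes "finite W" "0 \<in> interior (convex hull W)"
  shows "F facet_of (convex hull W) \<longleftrightarrow> (\<exists>u. facet_normal W u \<and> F = convex hull (tight W u))"
proof
  note ad = aff_dim_interior_0[OF assms(2)]
  assume F: "F facet_of (convex hull W)"
  then have "F exposed_face_of (convex hull W)"
    using assms(1) by (simp add: exposed_face_of_polyhedron facet_of_imp_face_of polyhedron_convex_hull)
  moreover have "F \<noteq> {}" "F \<noteq> convex hull W" using F by (auto simp: facet_of_def)
  ultimately obtain a b where ab: "a \<noteq> 0" "convex hull W \<subseteq> {x. a \<bullet> x \<le> b}"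
      "F = convex hull W \<inter> {x. a \<bullet> x = b}"
    unfolding exposed_face_of by blast
  obtain e where e: "e > 0" "cball 0 e \<subseteq> convex hull W"
    using assms(2) by (auto simp: mem_interior_cball)
  have "(e / norm a) *\<^sub>R a \<in> cball 0 e" using e ab(1) by simp
  then have "a \<bullet> ((e / norm a) *\<^sub>R a) \<le> b" using e ab by blast
  moreover have "a \<bullet> ((e / norm a) *\<^sub>R a) > 0" using e ab(1) by simp
  ultimately have b: "b > 0" by linarith
  define u where "u = (1 / b) *\<^sub>R a"
  have u: "u \<bullet> x = 1 \<longleftrightarrow> a \<bullet> x = b" "u \<bullet> x \<le> 1 \<longleftrightarrow> a \<bullet> x \<le> b" for x
    using b by (auto simp: u_def field_simps)
  have le: "u \<bullet> w \<le> 1" if "w \<in> W" for w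
    using ab(2) that hull_inc[of w W] by (auto simp: u)
  have FT: "F = convex hull (tight W u)"
    using convex_hull_tight[OF assms(1) le] ab(3) by (simp add: u)
  have "aff_dim (tight W u) = int DIM('a) - 1"
    using F ad by (simp add: facet_of_def FT aff_dim_convex_hull)
  then have "dim (span (tight W u)) = DIM('a)"
    using aff_dim_hyperplane_span[of "tight W u" u] tight_inner[of _ W u] by simp
  then have "span (tight W u) = UNIV" by (metis dim_eq_full dim_span span_span)
  then show "\<exists>u. facet_normal W u \<and> F = convex hull (tight W u)"
    using le FT by (auto simp: facet_normal_def)
next
  note ad = aff_dim_interior_0[OF assms(2)]
  assume "\<exists>u. facet_normal W u \<and> F = convex hull (tight W u)"
  then obtain u where u: "facet_normal W u" and F: "F = convex hull (tight W u)" by blast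
  have le: "\<And>w. w \<in> W \<Longrightarrow> u \<bullet> w \<le> 1" and s: "span (tight W u) = UNIV"
    using u by (auto simp: facet_normal_def)
  have "F = convex hull W \<inter> {x. u \<bullet> x = 1}" using convex_hull_tight[OF assms(1) le] F by simp
  then have "F face_of convex hull W"
    using face_of_Int_supporting_hyperplane_le[of "convex hull W" u 1] inner_le_convex_hull[OF le] by simp
  moreover have "aff_dim (tight W u) = int DIM('a) - 1"
    using aff_dim_hyperplane_span[of "tight W u" u] tight_inner[of _ W u] s by simp
  moreover have "tight W u \<noteq> {}" using s
    by (metis DIM_positive dim_UNIV dim_empty dim_span less_numeral_extra(3))
  ultimately show "F facet_of (convex hull W)"
    using ad F by (simp add: facet_of_def aff_dim_convex_hull)
qed

text \<open>The cones over the facets cover the space: the ray from 0 through \<open>x\<close>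
  leaves the polytope in a point of some facet, and the convex coefficients there are scaled
  back.\<close>

lemma in_cone_of_facet:
  fixes W :: "'a::euclidean_space set"
  assumes "finite W" "0 \<in> interior (convex hull W)" "x \<noteq> 0"
  shows "\<exists>u c. facet_normal W u \<and> (\<forall>b\<in>tight W u. c b \<ge> 0) \<and> x = (\<Sum>b\<in>tight W u. c b *\<^sub>R b)"
proof -
  have bdd: "bounded (convex hull W)" using assms(1) by (intro bounded_convex_hull finite_imp_bounded)
  obtain d where d: "0 < d" "0 + d *\<^sub>R x \<in> frontier (convex hull W)"
    by (rule ray_to_frontier[OF bdd assms(2,3)])
  have "rel_frontier (convex hull W) = frontier (convex hull W)"
    using assms(2) by (intro rel_frontier_nonempty_interior) auto
  then have "d *\<^sub>R x \<in> \<Union>{F. F facet_of convex hull W}"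
    using d rel_frontier_of_polyhedron[of "convex hull W"] assms(1) by (simp add: polyhedron_convex_hull)
  then obtain u where u: "facet_normal W u" "d *\<^sub>R x \<in> convex hull (tight W u)"
    using facet_of_convex_hull_iff[OF assms(1,2)] by blast
  have "finite (tight W u)" using finite_subset[OF tight_subset assms(1)] .
  then obtain c where c: "\<forall>b\<in>tight W u. c b \<ge> 0" "(\<Sum>b\<in>tight W u. c b *\<^sub>R b) = d *\<^sub>R x"
    using u(2) by (auto simp: convex_hull_finite)
  have "x = (1 / d) *\<^sub>R (d *\<^sub>R x)" using d by simp
  also have "\<dots> = (\<Sum>b\<in>tight W u. (c b / d) *\<^sub>R b)"
    by (simp add: c(2)[symmetric] scaleR_sum_right)
  finally show ?thesis using u(1) c(1) d(1)
    by (intro exI[of _ u] exI[of _ "\<lambda>b. c b / d"]) auto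
qed

lemma positive_inner_exists:
  fixes W :: "'a::euclidean_space set"
  assumes "0 \<in> interior (convex hull W)" "z \<noteq> 0"
  shows "\<exists>w\<in>W. z \<bullet> w > 0"
proof (rule ccontr)
  assume "\<not> ?thesis"
  then have "z \<bullet> w \<le> 0" if "w \<in> W" for w using that by force
  note * = inner_le_convex_hull[OF this]
  obtain e where e: "e > 0" "cball 0 e \<subseteq> convex hull W"
    using assms(1) by (auto simp: mem_interior_cball)
  have "(e / norm z) *\<^sub>R z \<in> cball 0 e" using e assms(2) by simp
  then have "z \<bullet> ((e / norm z) *\<^sub>R z) \<le> 0" using e * by blast
  moreover have "z \<bullet> ((e / norm z) *\<^sub>R z) > 0" using e assms(2) by simp
  ultimately show False by linarith
qed

lemma facet_normal_exists:
  fixes W :: "'a::euclidean_space set"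
  assumes "finite W" "0 \<in> interior (convex hull W)"
  shows "\<exists>u. facet_normal W u"
  using in_cone_of_facet[OF assms nonzero_Basis[OF SOME_Basis]] by blast

text \<open>Turns the hyperplane \<open>u\<close> in direction \<open>z\<close> until it meets a
  further point. The parameter is the smallest ratio of slack \<open>1 - u \<bullet> w\<close> to
  speed \<open>z \<bullet> w\<close>; points of positive speed exist since 0 is interior, and they
  are not tight, so the ratio is positive.\<close>

lemma tilt:
  fixes W :: "'a::euclidean_space set"
  assumes "finite W" "0 \<in> interior (convex hull W)" "\<And>w. w \<in> W \<Longrightarrow> u \<bullet> w \<le> 1"
    and "z \<noteq> 0" "\<And>w. w \<in> tight W u \<Longrightarrow> z \<bullet> w \<le> 0"
  shows "\<exists>t>0. (\<forall>w\<in>W. (u + t *\<^sub>R z) \<bullet> w \<le> 1) \<and> (\<exists>n\<in>W. z \<bullet> n > 0 \<and> (u + t *\<^sub>R z) \<bullet> n = 1)"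
proof -
  define R where "R = (\<lambda>w. (1 - u \<bullet> w) / (z \<bullet> w)) ` {w \<in> W. z \<bullet> w > 0}"
  have R: "finite R" "R \<noteq> {}"
    using assms(1) positive_inner_exists[OF assms(2,4)] by (auto simp: R_def)
  define t where "t = Min R"
  have "t \<in> R" using R by (simp add: t_def)
  then obtain n where n: "n \<in> W" "z \<bullet> n > 0" "t = (1 - u \<bullet> n) / (z \<bullet> n)" by (auto simp: R_def)
  have "u \<bullet> n \<noteq> 1" using n assms(5)[of n] by (auto simp: tight_def)
  then have t0: "t > 0" using n assms(3)[of n] by simp
  have "(u + t *\<^sub>R z) \<bullet> w \<le> 1" if w: "w \<in> W" for w
  proof (cases "z \<bullet> w > 0")
    case True
    then have "(1 - u \<bullet> w) / (z \<bullet> w) \<in> R" using w unfolding R_def by blast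
    then have "t \<le> (1 - u \<bullet> w) / (z \<bullet> w)" using R by (simp add: t_def)
    then have "t * (z \<bullet> w) \<le> 1 - u \<bullet> w" using True by (simp add: pos_le_divide_eq)
    then show ?thesis by (simp add: inner_add_left)
  next
    case False
    then have "t * (z \<bullet> w) \<le> 0" using t0 by (simp add: mult_nonneg_nonpos)
    then show ?thesis using assms(3)[OF w] by (simp add: inner_add_left)
  qed
  moreover have "(u + t *\<^sub>R z) \<bullet> n = 1" using n by (simp add: inner_add_left)
  ultimately show ?thesis using t0 n by blast
qed

lemma vertices_convex_hull_subset: "vertices (convex hull W) \<subseteq> W"
  unfolding vertices_def using extreme_point_of_convex_hull by blast

lemma polytope_eq_convex_hull_vertices:
  assumes "polytope P"
  shows "P = convex hull (vertices P)" "finite (vertices P)"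
proof -
  obtain V where V: "finite V" "P = convex hull V" using assms by (auto simp: polytope_def)
  show "P = convex hull (vertices P)"
    using Krein_Milman_polytope[OF V(1)] by (simp add: vertices_def V(2))
  show "finite (vertices P)"
    using vertices_convex_hull_subset[of V] V finite_subset by auto
qed

lemma tight_vertices_facet:
  assumes "polytope P" "0 \<in> interior P" "facet_normal (vertices P) u"
  shows "vertices (convex hull (tight (vertices P) u)) = tight (vertices P) u"
proof -
  note P = polytope_eq_convex_hull_vertices[OF assms(1)]
  have le: "\<And>w. w \<in> vertices P \<Longrightarrow> u \<bullet> w \<le> 1" using assms(3) by (auto simp: facet_normal_def)
  have "convex hull (tight (vertices P) u) facet_of P"
    using facet_of_convex_hull_iff[of "vertices P"] P assms by auto
  then have f: "convex hull (tight (vertices P) u) face_of P" by (rule facet_of_imp_face_of)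
  have "x \<in> convex hull (tight (vertices P) u) \<longleftrightarrow> u \<bullet> x = 1" if "x \<in> vertices P" for x
    using convex_hull_tight[OF P(2) le] that hull_inc[of x "vertices P" convex] by auto
  then show ?thesis
    using extreme_point_of_face[OF f] by (auto simp: vertices_def tight_def)
qed

section \<open>Fano polytopes and neighbouring facets\<close>

text \<open>A Fano polytope given by a finite point set and its facet normals. Every element of
  \<open>V\<close> is then a vertex of the hull: by \<open>fano_vertex_facet\<close> it lies on a
  facet, and the points of \<open>V\<close> on a facet are independent.\<close>

definition fano_set :: "(real ^ 'm) set \<Rightarrow> bool" where
  "fano_set V \<longleftrightarrow> finite V \<and> V \<subseteq> lattice \<and> 0 \<notin> V \<and> 0 \<in> interior (convex hull V) \<and>
     (\<forall>u. facet_normal V u \<longrightarrow> lattice_basis (tight V u))"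

lemma fano_polytope_vertices:
  fixes P :: "(real ^ 'm) set"
  assumes "fano_polytope P"
  shows "fano_set (vertices P)" "P = convex hull (vertices P)"
proof -
  have poly: "polytope P" and P0: "0 \<in> interior P" and lat: "vertices P \<subseteq> lattice"
    and F: "\<And>F. F facet_of P \<Longrightarrow> lattice_basis (vertices F)"
    using assms by (auto simp: fano_polytope_def lattice_polytope_def)
  note P = polytope_eq_convex_hull_vertices[OF poly]
  show "P = convex hull (vertices P)" by (rule P)
  have "lattice_basis (tight (vertices P) u)" if u: "facet_normal (vertices P) u" for u
  proof -
    have "convex hull (tight (vertices P) u) facet_of P"
      using facet_of_convex_hull_iff[of "vertices P"] P P0 u by auto
    then show ?thesis using F tight_vertices_facet[OF poly P0 u] by metis
  qed
  moreover have "0 \<notin> vertices P"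
    using P0 extreme_point_not_in_interior[of 0 P] by (auto simp: vertices_def)
  ultimately show "fano_set (vertices P)" using P P0 lat by (auto simp: fano_set_def)
qed

lemma independent_vertices:
  assumes "independent B"
  shows "vertices (convex hull B) = B"
proof -
  have "\<not> affine_dependent B" using assms affine_dependent_imp_dependent by blast
  then show ?thesis by (simp add: vertices_def extreme_point_of_convex_hull_affine_independent)
qed

lemma fano_set_polytope:
  fixes V :: "(real ^ 'm) set"
  assumes "fano_set V"
  shows "fano_polytope (convex hull V)"
proof -
  have V: "finite V" "V \<subseteq> lattice" "0 \<in> interior (convex hull V)"
    and t: "\<And>u. facet_normal V u \<Longrightarrow> lattice_basis (tight V u)"
    using assms by (auto simp: fano_set_def)
  have "lattice_basis (vertices F)" if F: "F facet_of convex hull V" for F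
  proof -
    obtain u where u: "facet_normal V u" "F = convex hull (tight V u)"
      using F facet_of_convex_hull_iff[OF V(1,3)] by blast
    then show ?thesis using independent_vertices[OF lattice_basisD(2)[OF t[OF u(1)]]] t[OF u(1)] by simp
  qed
  moreover have "polytope (convex hull V)" using V(1) by (auto simp: polytope_def)
  ultimately show ?thesis
    using V vertices_convex_hull_subset[of V] aff_dim_interior_0[OF V(3)]
    by (auto simp: fano_polytope_def lattice_polytope_def)
qed

lemma fano_setD:
  assumes "fano_set V"
  shows "finite V" "V \<subseteq> lattice" "0 \<notin> V" "0 \<in> interior (convex hull V)"
    "facet_normal V u \<Longrightarrow> lattice_basis (tight V u)"
  using assms by (auto simp: fano_set_def)

lemma facet_normal_int:
  assumes "fano_set V" "facet_normal V u" "x \<in> lattice"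
  shows "u \<bullet> x \<in> \<int>"
  using lattice_basis_funct_int[OF fano_setD(5)[OF assms(1,2)] _ assms(3)] tight_inner[of _ V u]
  by simp

text \<open>In a unimodular cone the coordinates are non-negative integers. They are not all 0 and
  their sum, the height, is at most 1, so exactly one of them is 1.\<close>

lemma lattice_cone_point:
  assumes B: "lattice_basis B" and x: "x \<in> lattice" "x \<noteq> 0"
    and c: "\<And>b. b \<in> B \<Longrightarrow> c b \<ge> (0::real)" "x = (\<Sum>b\<in>B. c b *\<^sub>R b)"
    and u: "\<And>b. b \<in> B \<Longrightarrow> u \<bullet> b = 1" "u \<bullet> x \<le> 1"
  shows "x \<in> B"
proof -
  note BD = lattice_basisD[OF B]
  have ci: "c b \<in> \<int>" if "b \<in> B" for b
    using lattice_basis_coord[OF B x(1) that] dual_vec_sum[OF BD(2) that, of c] c(2) by simp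
  have "\<exists>b\<in>B. c b \<noteq> 0"
  proof (rule ccontr)
    assume "\<not> ?thesis"
    then show False using c(2) x(2) by simp
  qed
  then obtain b where b: "b \<in> B" "c b \<noteq> 0" by blast
  then have b1: "c b \<ge> 1" using ci[OF b(1)] c(1)[OF b(1)] by (auto elim!: Ints_cases)
  have "sum c B \<le> 1" using u by (simp add: c(2) inner_sum_right)
  then have "c b + sum c (B - {b}) \<le> 1" using BD(3) b(1) by (simp add: sum.remove)
  moreover have "sum c (B - {b}) \<ge> 0" using c(1) by (intro sum_nonneg) auto
  ultimately have s: "c b = 1" "sum c (B - {b}) = 0" using b1 by auto
  then have "\<forall>a\<in>B - {b}. c a = 0"
    using BD(3) c(1) by (subst (asm) sum_nonneg_eq_0_iff) auto
  then have "(\<Sum>a\<in>B - {b}. c a *\<^sub>R a) = 0" by (intro sum.neutral) auto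
  then have "x = b" using c(2) BD(3) b(1) s(1) by (simp add: sum.remove)
  then show ?thesis using b by simp
qed

text \<open>Consequently 0 and the elements of \<open>V\<close> are the only lattice points of the
  polytope: \<open>x\<close> lies in the cone over some facet, which is unimodular.\<close>

lemma fano_lattice_point:
  assumes V: "fano_set V" and x: "x \<in> lattice" "x \<in> convex hull V" "x \<noteq> 0"
  shows "\<exists>u. facet_normal V u \<and> x \<in> tight V u"
proof -
  obtain u c where u: "facet_normal V u" and c: "\<forall>b\<in>tight V u. c b \<ge> 0" "x = (\<Sum>b\<in>tight V u. c b *\<^sub>R b)"
    using in_cone_of_facet[OF fano_setD(1,4)[OF V] x(3)] by blast
  have "u \<bullet> x \<le> 1" using inner_le_convex_hull[OF _ x(2)] facet_normal_le[OF u] by blast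
  then have "x \<in> tight V u"
    using lattice_cone_point[OF fano_setD(5)[OF V u] x(1,3) _ c(2)] c(1) tight_inner[of _ V u] by blast
  then show ?thesis using u by blast
qed

lemma fano_vertex_facet:
  assumes "fano_set V" "x \<in> V"
  shows "\<exists>u. facet_normal V u \<and> x \<in> tight V u"
  using assms fano_setD[OF assms(1)] hull_inc[of x V convex] by (intro fano_lattice_point) auto

text \<open>Crosses the ridge opposite to \<open>b\<close> by tilting along \<open>- z\<close>,
  which keeps the other vertices of the facet. Old and new facet are lattice bases that differ in a
  single vertex, so \<open>z \<bullet> n\<close> is a unit of the integers.\<close>

lemma neighbour:
  fixes V :: "(real ^ 'm) set"
  assumes V: "fano_set V" and u: "facet_normal V u" and b: "b \<in> tight V u"
  defines "z \<equiv> dual_vec (tight V u) b"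
  shows "\<exists>t n. t \<in> \<int> \<and> t \<ge> 1 \<and> n \<in> V \<and> n \<notin> tight V u \<and> z \<bullet> n = -1 \<and> facet_normal V (u - t *\<^sub>R z) \<and>
    tight V (u - t *\<^sub>R z) = insert n (tight V u - {b})"
proof -
  let ?B = "tight V u"
  note VD = fano_setD[OF V]
  note B = lattice_basisD[OF VD(5)[OF u]]
  have z: "z \<bullet> c = (if c = b then 1 else 0)" if "c \<in> ?B" for c
    unfolding z_def using dual_vec[OF B(2) that] .
  have z0: "- z \<noteq> 0" using z[OF b] by auto
  have "\<exists>t>0. (\<forall>w\<in>V. (u + t *\<^sub>R (- z)) \<bullet> w \<le> 1) \<and> (\<exists>n\<in>V. (- z) \<bullet> n > 0 \<and> (u + t *\<^sub>R (- z)) \<bullet> n = 1)"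
    using z by (intro tilt[OF VD(1,4) facet_normal_le[OF u] z0]) auto
  then obtain t n where t: "t > 0" "\<And>w. w \<in> V \<Longrightarrow> (u - t *\<^sub>R z) \<bullet> w \<le> 1"
    and n: "n \<in> V" "z \<bullet> n < 0" "(u - t *\<^sub>R z) \<bullet> n = 1" by auto
  let ?u = "u - t *\<^sub>R z" let ?C = "insert n (?B - {b})"
  have nB: "n \<notin> ?B" using z[of n] n(2) by (auto split: if_splits)
  have sub: "?C \<subseteq> tight V ?u"
  proof -
    have "?u \<bullet> c = 1" if "c \<in> ?B - {b}" for c
      using z[of c] that tight_inner[of c V u] by (simp add: inner_diff_left)
    then show ?thesis using n tight_subset[of V u] by (auto simp: tight_def)
  qed
  \<comment> \<open>The coordinate of \<open>n\<close> at \<open>b\<close> is non-zero, so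
    \<open>b\<close> can be solved for and the new tight points span as well.\<close>
  have "b \<in> span ?C"
  proof -
    have "n = (\<Sum>c\<in>?B. (dual_vec ?B c \<bullet> n) *\<^sub>R c)" by (rule dual_vec_expand[OF B(2,4)])
    also have "\<dots> = (z \<bullet> n) *\<^sub>R b + (\<Sum>c\<in>?B - {b}. (dual_vec ?B c \<bullet> n) *\<^sub>R c)"
      using B(3) b by (simp add: sum.remove z_def)
    finally have "(z \<bullet> n) *\<^sub>R b = n - (\<Sum>c\<in>?B - {b}. (dual_vec ?B c \<bullet> n) *\<^sub>R c)"
      by (simp add: algebra_simps)
    moreover have "n - (\<Sum>c\<in>?B - {b}. (dual_vec ?B c \<bullet> n) *\<^sub>R c) \<in> span ?C"
      by (intro span_diff span_sum span_scale span_base) auto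
    ultimately have "(1 / (z \<bullet> n)) *\<^sub>R ((z \<bullet> n) *\<^sub>R b) \<in> span ?C" by (metis span_scale)
    then show ?thesis using n(2) by simp
  qed
  then have "?B \<subseteq> span ?C" using span_base[of _ ?C] by blast
  then have "span ?B \<subseteq> span ?C" by (intro span_minimal) auto
  then have "span (tight V ?u) = UNIV" using B(4) span_mono[OF sub] by auto
  then have fu: "facet_normal V ?u" using t(2) by (auto simp: facet_normal_def)
  note C = lattice_basisD[OF VD(5)[OF fu]]
  have "card ?C = card (tight V ?u)" using B(3,5) C(5) nB b by (simp add: card.insert_remove card_Diff_singleton)
  then have eq: "tight V ?u = ?C" using card_subset_eq[OF C(3) sub] by simp
  \<comment> \<open>The new functional has the value \<open>1 - t\<close> at the lattice point
    \<open>b\<close>, so \<open>t\<close> is an integer.\<close>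
  have "?u \<bullet> b \<in> \<int>" using b B(1) by (intro facet_normal_int[OF V fu]) auto
  then have "1 - (1 - t) \<in> \<int>" using z[OF b] tight_inner[OF b] by (intro Ints_diff) (auto simp: inner_diff_left)
  then have ti: "t \<in> \<int>" by simp
  then have t1: "t \<ge> 1" using t(1) by (auto elim!: Ints_cases)
  have zn: "z \<bullet> n \<in> \<int>" unfolding z_def using n(1) VD(2) b by (intro lattice_basis_coord[OF VD(5)[OF u]]) auto
  \<comment> \<open>In the new basis the coordinate functional of \<open>n\<close> is a multiple of
    \<open>z\<close>. Its value at the lattice point \<open>b\<close> is the reciprocal of
    \<open>z \<bullet> n\<close>, which must therefore be an integer too.\<close>
  have "dual_vec (tight V ?u) n = (1 / (z \<bullet> n)) *\<^sub>R z"
  proof (rule inner_eq_on_spanning[OF C(4)])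
    fix c assume c: "c \<in> tight V ?u"
    then show "dual_vec (tight V ?u) n \<bullet> c = (1 / (z \<bullet> n)) *\<^sub>R z \<bullet> c"
      using dual_vec[OF C(2) c, of n] n(2) z[of c] nB unfolding eq by auto
  qed
  then have "1 / (z \<bullet> n) = dual_vec (tight V ?u) n \<bullet> b" using z[OF b] by simp
  also have "\<dots> \<in> \<int>" using b B(1) eq by (intro lattice_basis_coord[OF VD(5)[OF fu]]) auto
  finally have "1 / (z \<bullet> n) \<in> \<int>" .
  then obtain k :: int where k: "1 / (z \<bullet> n) = of_int k" by (auto elim: Ints_cases)
  obtain l :: int where l: "z \<bullet> n = of_int l" using zn by (auto elim: Ints_cases)
  have "real_of_int (k * l) = 1" using k l n(2) by (simp add: field_simps)
  then have "k * l = 1" by linarith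
  then have "l = -1" using n(2) l by (auto simp: zmult_eq_1_iff)
  then show ?thesis using ti t1 n(1) nB fu eq l by (intro exI[of _ t] exI[of _ n]) auto
qed

text \<open>On the neighbouring facet \<open>y\<close> has height
  \<open>t * (- (z \<bullet> y))\<close>, a product of two factors that are at least 1. As it cannot
  exceed 1, both factors are 1, and \<open>y\<close> is the new vertex.\<close>

lemma height_zero_neighbour:
  fixes V :: "(real ^ 'm) set"
  assumes V: "fano_set V" and u: "facet_normal V u" and b: "b \<in> tight V u"
    and y: "y \<in> V" "u \<bullet> y = 0" "dual_vec (tight V u) b \<bullet> y < 0"
  shows "dual_vec (tight V u) b \<bullet> y = -1" "facet_normal V (u - dual_vec (tight V u) b)"
    "tight V (u - dual_vec (tight V u) b) = insert y (tight V u - {b})"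
proof -
  let ?z = "dual_vec (tight V u) b"
  obtain t n where t: "t \<in> \<int>" "t \<ge> 1" and fu: "facet_normal V (u - t *\<^sub>R ?z)"
    and eq: "tight V (u - t *\<^sub>R ?z) = insert n (tight V u - {b})"
    using neighbour[OF V u b] by blast
  have "?z \<bullet> y \<in> \<int>" using y(1) fano_setD(2)[OF V] b by (intro lattice_basis_coord[OF fano_setD(5)[OF V u]]) auto
  then have y1: "- (?z \<bullet> y) \<ge> 1" using y(3) by (auto elim!: Ints_cases)
  have "(u - t *\<^sub>R ?z) \<bullet> y \<le> 1" by (rule facet_normal_le[OF fu y(1)])
  then have le: "t * (- (?z \<bullet> y)) \<le> 1" using y(2) by (simp add: inner_diff_left)
  have "t * 1 \<le> t * (- (?z \<bullet> y))" using t y1 by (intro mult_left_mono) auto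
  then have t1: "t = 1" using t le by linarith
  then show y2: "?z \<bullet> y = -1" using le y1 by simp
  show "facet_normal V (u - ?z)" using fu t1 by simp
  have "y \<in> tight V (u - ?z)" using y y2 by (simp add: tight_def inner_diff_left)
  moreover have "y \<notin> tight V u" using y(2) by (auto simp: tight_def)
  ultimately have "y = n" using eq t1 by auto
  then show "tight V (u - ?z) = insert y (tight V u - {b})" using eq t1 by simp
qed

lemma height_zero_neighbour_unique:
  fixes V :: "(real ^ 'm) set"
  assumes V: "fano_set V" and u: "facet_normal V u" and b: "b \<in> tight V u"
    and "y \<in> V" "u \<bullet> y = 0" "dual_vec (tight V u) b \<bullet> y < 0"
    and "y' \<in> V" "u \<bullet> y' = 0" "dual_vec (tight V u) b \<bullet> y' < 0"
  shows "y = y'"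
proof -
  have "insert y (tight V u - {b}) = insert y' (tight V u - {b})"
    using height_zero_neighbour(3)[OF V u b] assms by metis
  moreover have "y \<notin> tight V u" "y' \<notin> tight V u" using assms by (auto simp: tight_def)
  ultimately show ?thesis by blast
qed

section \<open>Duality and reflexive polytopes\<close>

lemma finite_lattice_points:
  fixes S :: "(real ^ 'm) set"
  assumes "bounded S"
  shows "finite (lattice_points S)"
proof -
  obtain B where B: "\<And>x. x \<in> S \<Longrightarrow> norm x \<le> B" using assms by (auto simp: bounded_iff)
  define N where "N = \<lceil>B\<rceil>"
  let ?F = "PiE (UNIV :: 'm set) (\<lambda>_. {- N..N})"
  have "lattice_points S \<subseteq> (\<lambda>f. \<chi> i. of_int (f i)) ` ?F"
  proof
    fix x assume x: "x \<in> lattice_points S"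
    have "\<bar>x $ i\<bar> \<le> of_int N" for i
      using component_le_norm_cart[of x i] B[of x] x by (simp add: lattice_points_def N_def) linarith
    then have "- N \<le> \<lfloor>x $ i\<rfloor> \<and> \<lfloor>x $ i\<rfloor> \<le> N" for i
      by (smt (verit, best) abs_le_iff floor_le_iff le_floor_iff of_int_minus)
    then show "x \<in> (\<lambda>f. \<chi> i. of_int (f i)) ` ?F"
      using x by (intro image_eqI[of _ _ "\<lambda>i. \<lfloor>x $ i\<rfloor>"])
       (auto simp: lattice_points_def lattice_def vec_eq_iff of_int_floor)
  qed
  then show ?thesis by (rule finite_subset) (intro finite_imageI finite_PiE; simp)
qed

lemma dual_polytope_convex_hull:
  "dual_polytope (convex hull W) = {y. \<forall>w\<in>W. - y \<bullet> w \<le> 1}"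
proof (intro equalityI subsetI)
  fix y assume "y \<in> dual_polytope (convex hull W)"
  then show "y \<in> {y. \<forall>w\<in>W. - y \<bullet> w \<le> 1}"
    using hull_inc[of _ W convex] by (force simp: dual_polytope_def)
next
  fix y assume "y \<in> {y. \<forall>w\<in>W. - y \<bullet> w \<le> 1}"
  then have "- y \<bullet> x \<le> 1" if "x \<in> convex hull W" for x
    using that by (intro inner_le_convex_hull[of W "- y" 1 x]) auto
  then show "y \<in> dual_polytope (convex hull W)" by (force simp: dual_polytope_def)
qed

text \<open>Vertices of the dual are facet normals; the sign comes from the convention
  \<open>\<ge> -1\<close> in the dual against \<open>\<le> 1\<close> for facets. If the tight points
  do not span, \<open>y\<close> can be moved both ways along a vector orthogonal to them; if they do
  span, a segment with \<open>y\<close> inside is constant on them and hence degenerate.\<close>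

lemma extreme_point_dual_polytope:
  fixes W :: "(real ^ 'm) set"
  assumes W: "finite W"
  shows "y extreme_point_of dual_polytope (convex hull W) \<longleftrightarrow> facet_normal W (- y)"
proof
  assume y: "y extreme_point_of dual_polytope (convex hull W)"
  then have le: "- y \<bullet> w \<le> 1" if "w \<in> W" for w
    using that by (auto simp: extreme_point_of_def dual_polytope_convex_hull)
  show "facet_normal W (- y)"
  proof (rule ccontr)
    assume "\<not> facet_normal W (- y)"
    then have "span (tight W (- y)) \<subset> UNIV" using le by (auto simp: facet_normal_def)
    then obtain z where z: "z \<noteq> 0" "\<And>x. x \<in> span (tight W (- y)) \<Longrightarrow> orthogonal z x"
      using orthogonal_to_subspace_exists_gen[of "tight W (- y)" UNIV] by auto
    have zt: "z \<bullet> w = 0" if "w \<in> tight W (- y)" for w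
      using z(2)[OF span_base[OF that]] by (simp add: orthogonal_def)
    have "\<exists>e>0. \<forall>w\<in>W. \<forall>s\<in>{-1, 1}. - (y + (s * e) *\<^sub>R z) \<bullet> w \<le> 1"
    proof -
      \<comment> \<open>A step of length \<open>g w\<close> respects the inequality of
        \<open>w\<close>. Tight points set no limit, since \<open>z\<close> vanishes on
        them.\<close>
      define g where "g = (\<lambda>w. if w \<in> tight W (- y) then 1 else (1 + y \<bullet> w) / (1 + \<bar>z \<bullet> w\<bar>))"
      define e where "e = Min (insert 1 (g ` W))"
      have gpos: "g w > 0" if "w \<in> W" for w
        using le[OF that] that by (auto simp: g_def tight_def intro!: divide_pos_pos)
      have e0: "e > 0" using gpos W by (auto simp: e_def)
      have "- (y + (s * e) *\<^sub>R z) \<bullet> w \<le> 1" if w: "w \<in> W" "s \<in> {-1, 1}" for w s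
      proof (cases "w \<in> tight W (- y)")
        case True
        then show ?thesis using zt le[OF w(1)] by (simp add: inner_left_distrib inner_diff_left)
      next
        case False
        have "e \<le> g w" using W w by (auto simp: e_def)
        then have "e * (1 + \<bar>z \<bullet> w\<bar>) \<le> 1 + y \<bullet> w" using False by (simp add: g_def pos_le_divide_eq)
        moreover have "- (s * e * (z \<bullet> w)) \<le> e * (1 + \<bar>z \<bullet> w\<bar>)"
        proof -
          have "- (s * e * (z \<bullet> w)) \<le> \<bar>s * e * (z \<bullet> w)\<bar>" by linarith
          also have "\<dots> = e * \<bar>z \<bullet> w\<bar>" using w(2) e0 by (auto simp: abs_mult)
          also have "\<dots> \<le> e * (1 + \<bar>z \<bullet> w\<bar>)" using e0 by (simp add: distrib_left)
          finally show ?thesis .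
        qed
        ultimately show ?thesis by (simp add: inner_left_distrib inner_diff_left)
      qed
      then show ?thesis using e0 by blast
    qed
    then obtain e where e: "e > 0" "\<And>w s. w \<in> W \<Longrightarrow> s \<in> {-1, 1} \<Longrightarrow> - (y + (s * e) *\<^sub>R z) \<bullet> w \<le> 1" by blast
    let ?a = "y + (1 * e) *\<^sub>R z" and ?b = "y + (-1 * e) *\<^sub>R z"
    have "?a \<in> dual_polytope (convex hull W)" "?b \<in> dual_polytope (convex hull W)"
      unfolding dual_polytope_convex_hull mem_Collect_eq using e(2)[of _ 1] e(2)[of _ "-1"] by blast+
    moreover have "y \<in> open_segment ?a ?b"
    proof -
      have "?a - ?b \<noteq> 0" using e(1) z(1) by (simp add: algebra_simps flip: scaleR_2)
      then have "?a \<noteq> ?b" by auto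
      moreover have "y = (1 - 1 / 2) *\<^sub>R ?a + (1 / 2) *\<^sub>R ?b"
        by (simp add: algebra_simps flip: scaleR_left_distrib)
      ultimately show ?thesis unfolding in_segment by (intro conjI exI[of _ "1/2"]) auto
    qed
    ultimately show False using y by (auto simp: extreme_point_of_def)
  qed
next
  assume y: "facet_normal W (- y)"
  have mem: "y \<in> dual_polytope (convex hull W)"
    using y by (auto simp: dual_polytope_convex_hull facet_normal_def)
  have False if ab: "a \<in> dual_polytope (convex hull W)" "b \<in> dual_polytope (convex hull W)"
    "y \<in> open_segment a b" for a b
  proof -
    obtain s where s: "a \<noteq> b" "0 < s" "s < 1" "y = (1 - s) *\<^sub>R a + s *\<^sub>R b"
      using ab(3) by (auto simp: in_segment)
    have "a = b"
    proof (rule inner_eq_on_spanning)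
      show "span (tight W (- y)) = UNIV" using y by (simp add: facet_normal_def)
      fix w assume w: "w \<in> tight W (- y)"
      then have "- a \<bullet> w \<le> 1" "- b \<bullet> w \<le> 1" "- y \<bullet> w = 1"
        using ab by (auto simp: dual_polytope_convex_hull tight_def)
      then have "(1 - s) * (1 + a \<bullet> w) + s * (1 + b \<bullet> w) = 0" "1 + a \<bullet> w \<ge> 0" "1 + b \<bullet> w \<ge> 0"
        by (auto simp: s(4) inner_left_distrib algebra_simps)
      then have "(1 - s) * (1 + a \<bullet> w) = 0" "s * (1 + b \<bullet> w) = 0"
        using s(2,3) by (auto simp: add_nonneg_eq_0_iff)
      then show "a \<bullet> w = b \<bullet> w" using s(2,3) by simp
    qed
    then show False using s by simp
  qed
  then show "y extreme_point_of dual_polytope (convex hull W)"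
    using mem by (auto simp: extreme_point_of_def)
qed

lemma polytope_dual_polytope:
  fixes W :: "(real ^ 'm) set"
  assumes W: "finite W" "0 \<in> interior (convex hull W)"
  shows "polytope (dual_polytope (convex hull W))"
proof -
  have "dual_polytope (convex hull W) = \<Inter> ((\<lambda>w. {y. - w \<bullet> y \<le> 1}) ` W)"
    by (auto simp: dual_polytope_convex_hull inner_commute)
  then have "polyhedron (dual_polytope (convex hull W))"
    using W(1) by (auto intro!: polyhedron_Inter polyhedron_halfspace_ge)
  moreover have "bounded (dual_polytope (convex hull W))"
  proof -
    obtain e where e: "e > 0" "cball 0 e \<subseteq> convex hull W"
      using W(2) by (auto simp: mem_interior_cball)
    have "norm y \<le> 1 / e" if y: "y \<in> dual_polytope (convex hull W)" for y
    proof (cases "y = 0")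
      case False
      have "- ((e / norm y) *\<^sub>R y) \<in> convex hull W" using e False by (intro subsetD[OF e(2)]) simp
      then have "y \<bullet> (- ((e / norm y) *\<^sub>R y)) \<ge> -1" using y unfolding dual_polytope_def by blast
      then have "e * (y \<bullet> y) / norm y \<le> 1" by simp
      then have "e * norm y \<le> 1" using False by (simp add: dot_square_norm power2_eq_square)
      then show ?thesis using e by (simp add: field_simps)
    qed (use e in auto)
    then show ?thesis by (auto simp: bounded_iff)
  qed
  ultimately show ?thesis by (simp add: polytope_eq_bounded_polyhedron)
qed

lemma reflexive_convex_hullI:
  fixes W :: "(real ^ 'm) set"
  assumes W: "finite W" "0 \<in> interior (convex hull W)" "W \<subseteq> lattice"
    and y: "\<And>y. facet_normal W y \<Longrightarrow> y \<in> lattice"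
  shows "reflexive_polytope (convex hull W)"
proof -
  have "polytope (convex hull W)" using W(1) by (auto simp: polytope_def)
  moreover have "vertices (dual_polytope (convex hull W)) \<subseteq> lattice"
    using y lattice_minus[of "- _"] by (force simp: vertices_def extreme_point_dual_polytope[OF W(1)])
  ultimately show ?thesis
    using W aff_dim_interior_0[OF W(2)] vertices_convex_hull_subset[of W] polytope_dual_polytope[OF W(1,2)]
    by (auto simp: reflexive_polytope_def lattice_polytope_def)
qed

lemma reflexive_polytope_vertices:
  fixes P :: "(real ^ 'm) set"
  assumes "reflexive_polytope P"
  shows "P = convex hull (vertices P)" "finite (vertices P)" "vertices P \<subseteq> lattice" "0 \<in> interior P"
    "facet_normal (vertices P) y \<Longrightarrow> y \<in> lattice" "polytope P"
proof -
  have P: "polytope P" "vertices P \<subseteq> lattice" "0 \<in> interior P" "vertices (dual_polytope P) \<subseteq> lattice"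
    using assms by (auto simp: reflexive_polytope_def lattice_polytope_def)
  show e: "P = convex hull (vertices P)" "finite (vertices P)"
    by (rule polytope_eq_convex_hull_vertices[OF P(1)])+
  show "vertices P \<subseteq> lattice" "0 \<in> interior P" "polytope P" by fact+
  assume "facet_normal (vertices P) y"
  then have "- y extreme_point_of dual_polytope P"
    using extreme_point_dual_polytope[OF e(2), of "- y"] e(1) by simp
  then have "- y \<in> lattice" using P(4) by (auto simp: vertices_def)
  then show "y \<in> lattice" using lattice_minus[of "- y"] by simp
qed

lemma tight_image:
  fixes f :: "'a::euclidean_space \<Rightarrow> 'b::euclidean_space"
  assumes "linear f"
  shows "tight (f ` V) y = f ` tight V (adjoint f y)"
  using adjoint_works[OF assms] by (auto simp: tight_def inner_commute)

lemma fano_set_image: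
  assumes f: "f \<in> lattice_transformations" and V: "fano_set V"
  shows "fano_set (f ` V)"
proof -
  note VD = fano_setD[OF V]
  have lin: "linear f" and bij: "bij f" and fl: "f ` lattice = lattice"
    using f unfolding lattice_transformations_eq by auto
  have hull: "convex hull (f ` V) = f ` (convex hull V)"
    by (rule convex_hull_linear_image[OF lin, symmetric])
  have "f 0 \<in> f ` interior (convex hull V)" using VD(4) by blast
  then have "0 \<in> interior (convex hull (f ` V))"
    using interior_bijective_linear_image[OF lin bij] linear_0[OF lin] by (simp add: hull)
  moreover have "0 \<notin> f ` V"
    using VD(3) linear_0[OF lin] bij by (metis bij_is_inj imageE injD)
  moreover have "lattice_basis (tight (f ` V) y)" if y: "facet_normal (f ` V) y" for y
  proof -
    have "span (tight V (adjoint f y)) = UNIV"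
    proof -
      have "f ` span (tight V (adjoint f y)) = UNIV"
        using y linear_span_image[OF lin] by (simp add: facet_normal_def tight_image[OF lin])
      then show ?thesis using bij by (metis bij_is_inj image_strict_mono bij_is_surj inj_image_eq_iff)
    qed
    moreover have "adjoint f y \<bullet> w \<le> 1" if "w \<in> V" for w
      using facet_normal_le[OF y, of "f w"] that adjoint_works[OF lin] by (simp add: inner_commute)
    ultimately have "facet_normal V (adjoint f y)" by (auto simp: facet_normal_def)
    then show ?thesis using lattice_basis_image[OF f VD(5)] by (simp add: tight_image[OF lin])
  qed
  moreover have "f ` V \<subseteq> lattice" using VD(2) fl by blast
  ultimately show ?thesis using VD(1) by (auto simp: fano_set_def)
qed

lemma fano_polytope_image:
  assumes f: "f \<in> lattice_transformations" and P: "fano_polytope P"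
  shows "fano_polytope (f ` P)"
proof -
  have lin: "linear f" using f unfolding lattice_transformations_eq by auto
  have "f ` P = convex hull (f ` vertices P)"
    using convex_hull_linear_image[OF lin, of "vertices P"] fano_polytope_vertices(2)[OF P] by simp
  then show ?thesis using fano_set_polytope[OF fano_set_image[OF f fano_polytope_vertices(1)[OF P]]] by simp
qed

section \<open>The number of vertices of a Fano polytope\<close>

lemma Ints_less_imp_le: "k \<in> \<int> \<Longrightarrow> l \<in> \<int> \<Longrightarrow> k < l \<Longrightarrow> k \<le> l - (1::real)"
  by (auto elim!: Ints_cases)

locale fano_facet =
  fixes V :: "(real ^ 'm) set" and u :: "real ^ 'm"
  assumes fano: "fano_set V" and facet: "facet_normal V u"
begin

abbreviation "B \<equiv> tight V u"
abbreviation "z \<equiv> dual_vec B"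
abbreviation "N0 \<equiv> {y \<in> V. u \<bullet> y = 0}"
abbreviation "N1 \<equiv> {y \<in> V. u \<bullet> y < 0}"

lemmas VD = fano_setD[OF fano]
lemmas basis = VD(5)[OF facet]
lemmas BD = lattice_basisD[OF basis]

lemma BV: "b \<in> B \<Longrightarrow> b \<in> V" by (simp add: tight_def)

lemma ub: "b \<in> B \<Longrightarrow> u \<bullet> b = 1" by (rule tight_inner)

lemma zb: "c \<in> B \<Longrightarrow> z b \<bullet> c = (if c = b then 1 else 0)"
  by (rule dual_vec[OF BD(2)])

lemma zint: "b \<in> B \<Longrightarrow> v \<in> V \<Longrightarrow> z b \<bullet> v \<in> \<int>"
  using lattice_basis_coord[OF basis] VD(2) by auto

lemma uint: "v \<in> V \<Longrightarrow> u \<bullet> v \<in> \<int>"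
  using facet_normal_int[OF fano facet] VD(2) by auto

lemma expand: "x = (\<Sum>b\<in>B. (z b \<bullet> x) *\<^sub>R b)"
  by (rule dual_vec_expand[OF BD(2,4)])

lemma height_sum: "u \<bullet> x = (\<Sum>b\<in>B. z b \<bullet> x)"
proof -
  have "u \<bullet> x = u \<bullet> (\<Sum>b\<in>B. (z b \<bullet> x) *\<^sub>R b)" using arg_cong[OF expand[of x]] .
  also have "\<dots> = (\<Sum>b\<in>B. (z b \<bullet> x) * (u \<bullet> b))"
    by (simp only: inner_sum_right inner_scaleR_right)
  also have "\<dots> = (\<Sum>b\<in>B. z b \<bullet> x)" by (rule sum.cong) (auto simp: ub)
  finally show ?thesis .
qed

lemma sum_zB: "b \<in> B \<Longrightarrow> (\<Sum>c\<in>B. z b \<bullet> c) = 1"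
proof -
  assume "b \<in> B"
  then have "(\<Sum>c\<in>B. if c = b then 1 else (0::real)) = 1" using BD(3) by (simp add: sum.delta)
  moreover have "(\<Sum>c\<in>B. z b \<bullet> c) = (\<Sum>c\<in>B. if c = b then 1 else 0)" by (rule sum.cong) (auto simp: zb)
  ultimately show ?thesis by simp
qed

lemma cases_V: "V = B \<union> N0 \<union> N1"
proof (intro equalityI subsetI)
  fix v assume v: "v \<in> V"
  have "u \<bullet> v \<le> 1" by (rule facet_normal_le[OF facet v])
  then have "u \<bullet> v = 1 \<or> u \<bullet> v = 0 \<or> u \<bullet> v < 0"
    using Ints_less_imp_le[OF uint[OF v] Ints_1] by force
  then show "v \<in> B \<union> N0 \<union> N1" using v by (auto simp: tight_def)
qed (auto simp: tight_def)

lemma finN: "finite N0" "finite N1" using VD(1) by auto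

lemma sum_V: "sum f V = sum f B + sum f N0 + sum f N1" for f :: "real ^ 'm \<Rightarrow> 'b::comm_monoid_add"
proof -
  have "sum f V = sum f (B \<union> N0 \<union> N1)" by (rule arg_cong[OF cases_V])
  also have "\<dots> = sum f (B \<union> N0) + sum f N1"
    using BD(3) finN by (intro sum.union_disjoint) (auto simp: tight_def)
  also have "sum f (B \<union> N0) = sum f B + sum f N0"
    using BD(3) finN by (intro sum.union_disjoint) (auto simp: tight_def)
  finally show ?thesis .
qed

lemma card_V: "card V = card B + card N0 + card N1"
  using sum_V[of "\<lambda>_. 1 :: nat"] by simp

lemma neg_le: "v \<in> N1 \<Longrightarrow> u \<bullet> v \<le> -1"
  using uint[of v] by (auto elim!: Ints_cases)

lemma height_total: "u \<bullet> \<Sum>V = real (card B) + (\<Sum>v\<in>N1. u \<bullet> v)"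
proof -
  have "u \<bullet> \<Sum>V = (\<Sum>v\<in>V. u \<bullet> v)" by (simp add: inner_sum_right)
  also have "\<dots> = (\<Sum>v\<in>B. u \<bullet> v) + (\<Sum>v\<in>N0. u \<bullet> v) + (\<Sum>v\<in>N1. u \<bullet> v)" by (rule sum_V)
  finally show ?thesis by (simp add: ub)
qed

lemma neg_coord: assumes "y \<in> N0" shows "\<exists>b\<in>B. z b \<bullet> y < 0"
proof (rule ccontr)
  assume "\<not> ?thesis"
  then have nn: "\<And>b. b \<in> B \<Longrightarrow> z b \<bullet> y \<ge> 0" by force
  have "(\<Sum>b\<in>B. z b \<bullet> y) = 0" using assms height_sum[of y] by simp
  then have "\<forall>b\<in>B. z b \<bullet> y = 0" using nn BD(3) by (subst (asm) sum_nonneg_eq_0_iff) auto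
  then have "(\<Sum>b\<in>B. (z b \<bullet> y) *\<^sub>R b) = 0" by (intro sum.neutral) auto
  then have "y = 0" using expand[of y] by simp
  then show False using assms VD(3) by simp
qed

lemma unique: "y \<in> N0 \<Longrightarrow> y' \<in> N0 \<Longrightarrow> b \<in> B \<Longrightarrow> z b \<bullet> y < 0 \<Longrightarrow> z b \<bullet> y' < 0 \<Longrightarrow> y = y'"
  using height_zero_neighbour_unique[OF fano facet] by blast

text \<open>A vertex at height 0 has coordinate sum 0 and so a negative coordinate at some
  \<open>b\<close>, which makes it the replacement of \<open>b\<close>. Different vertices replace
  different \<open>b\<close>; this is the origin of the bound \<open>d\<close> for the points with
  \<open>k = 0\<close>.\<close>

lemma N0_choice: "\<exists>g. inj_on g N0 \<and> (\<forall>y\<in>N0. g y \<in> B \<and> z (g y) \<bullet> y < 0)"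
proof -
  obtain g where g: "\<And>y. y \<in> N0 \<Longrightarrow> g y \<in> B \<and> z (g y) \<bullet> y < 0" using neg_coord by metis
  have "inj_on g N0"
  proof (rule inj_onI)
    fix y y' assume y: "y \<in> N0" "y' \<in> N0" "g y = g y'"
    show "y = y'" using unique[OF y(1,2), of "g y"] g[OF y(1)] g[OF y(2)] y(3) by simp
  qed
  then show ?thesis using g by blast
qed

lemma card_N0: "card N0 \<le> card B"
proof -
  obtain g where "inj_on g N0" "g ` N0 \<subseteq> B" using N0_choice by blast
  then show ?thesis using card_inj_on_le BD(3) by blast
qed

lemma card_N1: "u \<bullet> \<Sum>V \<ge> 0 \<Longrightarrow> card N1 \<le> card B"
proof -
  assume s: "u \<bullet> \<Sum>V \<ge> 0"
  have "real (card N1) = (\<Sum>v\<in>N1. 1)" by simp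
  also have "\<dots> \<le> (\<Sum>v\<in>N1. - (u \<bullet> v))" using neg_le by (intro sum_mono) force
  also have "\<dots> \<le> card B" using s height_total by (simp add: sum_negf)
  finally show ?thesis by (simp add: ub)
qed

lemma card_V_le: "u \<bullet> \<Sum>V \<ge> 0 \<Longrightarrow> card V \<le> 3 * CARD('m)"
  using card_N0 card_N1 card_V BD(5) by simp

text \<open>The facet contributes \<open>card B\<close> to the non-negative height of
  \<open>\<Sum>V\<close>, so the negative heights add up to at least \<open>- card B\<close>. A
  vertex that consumes this amount alone leaves no room for another one.\<close>

lemma height_ge: assumes "u \<bullet> \<Sum>V \<ge> 0" "x \<in> V" shows "u \<bullet> x \<ge> - real (card B)"
    "u \<bullet> x = - real (card B) \<Longrightarrow> N1 = {x} \<and> u \<bullet> \<Sum>V = 0"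
proof -
  have B0: "card B > 0" using BD(5) by simp
  have s: "(\<Sum>v\<in>N1. u \<bullet> v) = u \<bullet> x + (\<Sum>v\<in>N1 - {x}. u \<bullet> v)" if "x \<in> N1"
    using that finN by (simp add: sum.remove)
  have n: "(\<Sum>v\<in>N1 - {x}. u \<bullet> v) \<le> - real (card (N1 - {x}))"
  proof -
    have "(\<Sum>v\<in>N1 - {x}. u \<bullet> v) \<le> (\<Sum>v\<in>N1 - {x}. -1)" using neg_le by (intro sum_mono) auto
    then show ?thesis by simp
  qed
  show g: "u \<bullet> x \<ge> - real (card B)"
  proof (cases "x \<in> N1")
    case True
    then show ?thesis using s n assms(1) height_total by auto
  next
    case False
    then have "u \<bullet> x \<ge> 0" using assms(2) by auto
    then show ?thesis by simp
  qed
  assume e: "u \<bullet> x = - real (card B)"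
  then have x: "x \<in> N1" using B0 assms(2) by auto
  then have "real (card (N1 - {x})) \<le> 0" using s n e assms(1) height_total by auto
  then have "N1 - {x} = {}" using finN by simp
  then have N: "N1 = {x}" using x by auto
  then have "u \<bullet> \<Sum>V = 0" using height_total e by simp
  then show "N1 = {x} \<and> u \<bullet> \<Sum>V = 0" using N by blast
qed

end

text \<open>Take the facet whose cone contains the sum of the vertices.\<close>

lemma special_facet:
  fixes V :: "(real ^ 'm) set"
  assumes "fano_set V"
  shows "\<exists>u. facet_normal V u \<and> u \<bullet> \<Sum>V \<ge> 0 \<and> (u \<bullet> \<Sum>V = 0 \<longrightarrow> \<Sum>V = 0)"
proof (cases "\<Sum>V = 0")
  case True
  then show ?thesis using facet_normal_exists[OF fano_setD(1,4)[OF assms]] by auto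
next
  case False
  obtain u c where u: "facet_normal V u" and c: "\<forall>b\<in>tight V u. c b \<ge> 0" "\<Sum>V = (\<Sum>b\<in>tight V u. c b *\<^sub>R b)"
    using in_cone_of_facet[OF fano_setD(1,4)[OF assms] False] by blast
  have e: "u \<bullet> \<Sum>V = sum c (tight V u)" unfolding c(2) by (simp add: inner_sum_right tight_inner)
  have "sum c (tight V u) = 0 \<Longrightarrow> \<forall>b\<in>tight V u. c b = 0"
    using c(1) lattice_basisD(3)[OF fano_setD(5)[OF assms u]] by (subst (asm) sum_nonneg_eq_0_iff) auto
  then have "u \<bullet> \<Sum>V = 0 \<Longrightarrow> \<Sum>V = 0" using e c(2) by simp
  moreover have "u \<bullet> \<Sum>V \<ge> 0" using e c(1) by (simp add: sum_nonneg)
  ultimately show ?thesis using u by blast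
qed

text \<open>On a facet through \<open>x\<close> the equation becomes
  \<open>1 = k * (u \<bullet> b)\<close> with integral factors.\<close>

lemma fano_set_primitive:
  assumes V: "fano_set V" and "x \<in> V" "b \<in> lattice" "x = k *\<^sub>R b" "k \<in> \<int>"
  shows "\<bar>k\<bar> = 1"
proof -
  obtain u where u: "facet_normal V u" "x \<in> tight V u" using fano_vertex_facet[OF V assms(2)] by blast
  then have "k * (u \<bullet> b) = 1" using tight_inner[OF u(2)] assms(4) by simp
  moreover have "u \<bullet> b \<in> \<int>" by (rule facet_normal_int[OF V u(1) assms(3)])
  ultimately obtain i j :: int where "k = of_int i" "u \<bullet> b = of_int j" "real_of_int (i * j) = 1"
    using assms(5) by (auto elim!: Ints_cases)
  then show ?thesis by (metis abs_zmult_eq_1 of_int_1 of_int_abs of_int_eq_1_iff zabs_less_one_iff abs_1)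
qed

text \<open>A vertex \<open>x\<close> at height \<open>-d\<close> is the only negative one and
  forces \<open>\<Sum>V = 0\<close>, so the sum condition holds on all facets. Its coordinates turn
  out to be non-positive. If some \<open>b\<close> with negative \<open>x\<close>-coordinate is
  replaced by a vertex at height 0, the facet across \<open>b\<close> satisfies the height bound.
  Otherwise every such \<open>b\<close> is replaced by \<open>x\<close> itself, so the coordinates
  of \<open>x\<close> are at least -1; as they add up to \<open>-d\<close>, they are all -1.\<close>

lemma good_facet:
  fixes V :: "(real ^ 'm) set"
  assumes V: "fano_set V" and d2: "CARD('m) \<ge> 2"
  shows "(\<exists>u. facet_normal V u \<and> u \<bullet> \<Sum>V \<ge> 0 \<and> (\<forall>v\<in>V. u \<bullet> v \<ge> 1 - real CARD('m))) \<or>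
    (\<exists>B. lattice_basis B \<and> V = insert (- \<Sum>B) B)"
proof -
  obtain u where u: "facet_normal V u" "u \<bullet> \<Sum>V \<ge> 0" "u \<bullet> \<Sum>V = 0 \<longrightarrow> \<Sum>V = 0"
    using special_facet[OF V] by blast
  interpret fano_facet V u by standard fact+
  let ?d = "CARD('m)"
  show ?thesis
  proof (cases "\<forall>v\<in>V. u \<bullet> v \<ge> 1 - real ?d")
    case True
    then show ?thesis using u by blast
  next
    case False
    then obtain x where x: "x \<in> V" "u \<bullet> x < 1 - real ?d" by force
    have ux: "u \<bullet> x = - real ?d"
      using Ints_less_imp_le[OF uint[OF x(1)] _ x(2)] height_ge(1)[OF u(2) x(1)] BD(5) by simp
    then have N1: "N1 = {x}" and us: "u \<bullet> \<Sum>V = 0"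
      using height_ge(2)[OF u(2) x(1)] BD(5) by auto
    have S0: "\<Sum>V = 0" using u(3) us by blast
    have hge: "w \<bullet> v \<ge> - real ?d" if w: "facet_normal V w" and v: "v \<in> V" for w v
    proof -
      interpret w: fano_facet V w by standard fact+
      show ?thesis using w.height_ge(1)[of v] S0 v w.BD(5) by simp
    qed
    have x0: "- x \<noteq> 0" using x VD(3) by auto
    obtain w c where w: "facet_normal V w" and c: "\<forall>g\<in>tight V w. c g \<ge> 0" "- x = (\<Sum>g\<in>tight V w. c g *\<^sub>R g)"
      using in_cone_of_facet[OF VD(1,4) x0] by blast
    have finw: "finite (tight V w)" using finite_subset[OF tight_subset VD(1)] .
    have "sum c (tight V w) = w \<bullet> (- x)" unfolding c(2) by (simp add: inner_sum_right tight_inner)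
    also have "\<dots> \<le> ?d" using hge[OF w x(1)] by simp
    finally have le: "sum c (tight V w) \<le> ?d" .
    \<comment> \<open>The coefficients of \<open>- x\<close> in the cone over \<open>w\<close> have
      sum at most \<open>d\<close>, but weighted by heights \<open>u \<bullet> g \<le> 1\<close>
      they still give \<open>d\<close>. Hence only vertices \<open>g\<close> in \<open>B\<close>
      occur, and the coordinates of \<open>- x\<close> are non-negative.\<close>
    have "real ?d = (\<Sum>g\<in>tight V w. c g * (u \<bullet> g))"
      using ux c(2) by (metis (no_types, lifting) add.inverse_inverse inner_minus_right inner_scaleR_right inner_sum_right sum.cong)
    then have "(\<Sum>g\<in>tight V w. c g * (1 - u \<bullet> g)) \<le> 0"
      using le by (simp add: right_diff_distrib sum_subtractf)
    moreover have nn: "c g * (1 - u \<bullet> g) \<ge> 0" if "g \<in> tight V w" for g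
      using that c(1) facet_normal_le[OF u(1), of g] tight_subset[of V w]
      by (intro mult_nonneg_nonneg) auto
    ultimately have "(\<Sum>g\<in>tight V w. c g * (1 - u \<bullet> g)) = 0"
      by (simp add: order_antisym sum_nonneg)
    then have "\<forall>g\<in>tight V w. c g * (1 - u \<bullet> g) = 0"
      using nn finw by (subst (asm) sum_nonneg_eq_0_iff) auto
    then have cB: "c g = 0 \<or> g \<in> B" if "g \<in> tight V w" for g
      using that by (auto simp: tight_def)
    have zx: "z b \<bullet> x \<le> 0" if b: "b \<in> B" for b
    proof -
      have "c g * (z b \<bullet> g) \<ge> 0" if "g \<in> tight V w" for g
        using cB[OF that] zb[of g b] c(1) that by auto
      then have "z b \<bullet> (- x) \<ge> 0" unfolding c(2) by (simp add: inner_sum_right sum_nonneg)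
      then show ?thesis by simp
    qed
    have sx: "(\<Sum>b\<in>B. - (z b \<bullet> x)) = ?d" using height_sum[of x] ux by (simp add: sum_negf)
    have zge: "- (z b \<bullet> x) \<le> ?d" if b: "b \<in> B" for b
      using member_le_sum[of b B "\<lambda>b. - (z b \<bullet> x)"] zx b BD(3) sx by force
    show ?thesis
    proof (cases "\<exists>b\<in>B. \<exists>y\<in>N0. z b \<bullet> y < 0 \<and> z b \<bullet> x < 0")
      case True
      then obtain b y where b: "b \<in> B" and y: "y \<in> N0" "z b \<bullet> y < 0" "z b \<bullet> x < 0" by blast
      have w: "facet_normal V (u - z b)" and y1: "z b \<bullet> y = -1"
        using height_zero_neighbour[OF V u(1) b] y by auto
      \<comment> \<open>The coordinates at \<open>b\<close> of all vertices cancel. The facet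
        contributes 1 and \<open>y\<close> contributes -1, so the rest of \<open>N0\<close> balances
        \<open>x\<close>, which bounds each coordinate there.\<close>
      have "(\<Sum>v\<in>V. z b \<bullet> v) = 0" using inner_sum_right[of "z b" "\<lambda>v. v" V] S0 by simp
      then have "1 + (\<Sum>v\<in>N0. z b \<bullet> v) + z b \<bullet> x = 0"
        using sum_V[of "\<lambda>v. z b \<bullet> v"] sum_zB[OF b] N1 by simp
      then have sN: "(\<Sum>v\<in>N0 - {y}. z b \<bullet> v) = - (z b \<bullet> x)"
        using sum.remove[OF finN(1) y(1), of "\<lambda>v. z b \<bullet> v"] y1 by simp
      have nn: "z b \<bullet> v \<ge> 0" if "v \<in> N0 - {y}" for v
      proof (rule ccontr)
        assume "\<not> z b \<bullet> v \<ge> 0"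
        then show False using unique[of v y b] that y b by simp
      qed
      have "(u - z b) \<bullet> v \<ge> 1 - real ?d" if v: "v \<in> V" for v
      proof -
        consider "v \<in> B" | "v = y" | "v \<in> N0 - {y}" | "v = x" using cases_V v N1 by blast
        then show ?thesis
        proof cases
          case 1
          then show ?thesis using zb[of v b] ub[of v] ub[OF b] d2 by (auto simp: inner_diff_left)
        next
          case 2
          then show ?thesis using y y1 by (simp add: inner_diff_left)
        next
          case 3
          have "z b \<bullet> v \<le> - (z b \<bullet> x)"
            using member_le_sum[of v "N0 - {y}" "\<lambda>v. z b \<bullet> v"] 3 nn finN sN by force
          \<comment> \<open>Coordinate \<open>-d\<close> at \<open>b\<close> would make
            \<open>x\<close> the multiple \<open>-d\<close> of the lattice point \<open>b\<close>,
            which is impossible for a primitive vector as \<open>d \<ge> 2\<close>.\<close>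
          moreover have "- (z b \<bullet> x) \<noteq> ?d"
          proof
            assume e: "- (z b \<bullet> x) = ?d"
            have "(\<Sum>c\<in>B - {b}. - (z c \<bullet> x)) = 0"
              using sx e sum.remove[OF BD(3) b, of "\<lambda>b. - (z b \<bullet> x)"] by simp
            then have "\<forall>c\<in>B - {b}. - (z c \<bullet> x) = 0"
              using zx BD(3) by (subst (asm) sum_nonneg_eq_0_iff) auto
            then have "(\<Sum>c\<in>B - {b}. (z c \<bullet> x) *\<^sub>R c) = 0" by (intro sum.neutral) auto
            then have "x = (z b \<bullet> x) *\<^sub>R b"
              using expand[of x] sum.remove[OF BD(3) b, of "\<lambda>c. (z c \<bullet> x) *\<^sub>R c"] by simp
            then have "\<bar>z b \<bullet> x\<bar> = 1"
              using fano_set_primitive[OF V x(1)] BD(1) b zint[OF b x(1)] by blast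
            then show False using e d2 by simp
          qed
          moreover have "z b \<bullet> v \<in> \<int>" "z b \<bullet> x \<in> \<int>" using zint b 3 x by auto
          ultimately have "z b \<bullet> v \<le> real ?d - 1"
            using zge[OF b] by (intro Ints_less_imp_le) auto
          then show ?thesis using 3 by (simp add: inner_diff_left)
        next
          case 4
          have "z b \<bullet> x \<le> -1" using zint[OF b x(1)] y(3) by (auto elim!: Ints_cases)
          then show ?thesis using 4 ux by (simp add: inner_diff_left)
        qed
      qed
      then show ?thesis using w S0 by auto
    next
      case False
      have z1: "z b \<bullet> x \<ge> -1" if b: "b \<in> B" for b
      proof (cases "z b \<bullet> x < 0")
        case True
        obtain n where n: "n \<in> V" "n \<notin> B" "z b \<bullet> n = -1"
          using neighbour[OF V u(1) b] by blast
        then have "n \<notin> N0" using False True b by force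
        then have "n = x" using n cases_V N1 by blast
        then show ?thesis using n by simp
      qed simp
      have "(\<Sum>b\<in>B. 1 + z b \<bullet> x) = 0"
        using sx BD(5) by (simp add: sum.distrib sum_negf)
      then have "\<forall>b\<in>B. 1 + z b \<bullet> x = 0"
        using z1 BD(3) by (subst (asm) sum_nonneg_eq_0_iff) force+
      then have zm: "z b \<bullet> x = -1" if "b \<in> B" for b using that by force
      then have "N0 = {}" using False neg_coord by fastforce
      then have "V = insert x B" using cases_V N1 by auto
      moreover have "x = - \<Sum>B" using expand[of x] zm by (simp add: sum_negf)
      ultimately show ?thesis using basis by blast
    qed
  qed
qed

section \<open>The extremal case of \<open>3 * d\<close> vertices\<close>

context fano_facet begin

context
  assumes S0: "\<Sum>V = 0" and card_V_max: "card V = 3 * CARD('m)"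
begin

lemma extremal_counts: "card N0 = card B" "card N1 = card B"
  using card_N0 card_N1 card_V card_V_max BD(5) S0 by simp_all

lemma extremal_N1: assumes "v \<in> N1" shows "u \<bullet> v = -1"
proof -
  have "(\<Sum>v\<in>N1. - (u \<bullet> v) - 1) = 0"
    using height_total S0 extremal_counts(2) by (simp add: sum_subtractf sum_negf)
  moreover have "- (u \<bullet> v) - 1 \<ge> 0" if "v \<in> N1" for v using neg_le[OF that] by simp
  ultimately have "\<forall>v\<in>N1. - (u \<bullet> v) - 1 = 0"
    using finN(2) by (subst (asm) sum_nonneg_eq_0_iff) blast+
  then have "- (u \<bullet> v) - 1 = 0" using assms by blast
  then show ?thesis by simp
qed

text \<open>Equality in the count turns the injective choice into a bijection onto \<open>B\<close>,
  so each \<open>y\<close> has a single negative coordinate, equal to -1. The remaining ones are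
  non-negative integers with sum 1.\<close>

lemma extremal_N0:
  shows "y \<in> N0 \<Longrightarrow> \<exists>b\<in>B. \<exists>s\<in>B. s \<noteq> b \<and> y = s - b"
    and "b \<in> B \<Longrightarrow> \<exists>s\<in>B. s \<noteq> b \<and> s - b \<in> V"
proof -
  obtain g where inj: "inj_on g N0" and g: "\<And>y. y \<in> N0 \<Longrightarrow> g y \<in> B \<and> z (g y) \<bullet> y < 0"
    using N0_choice by blast
  have gB: "g ` N0 = B"
    using g inj extremal_counts(1) BD(3) by (intro card_subset_eq) (auto simp: card_image)
  have only: "b = g y" if y: "y \<in> N0" and b: "b \<in> B" "z b \<bullet> y < 0" for y b
  proof -
    obtain y' where y': "y' \<in> N0" "b = g y'" using gB b(1) by blast
    then have "y = y'" using unique[OF y y'(1) b(1) b(2)] g[OF y'(1)] by simp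
    then show ?thesis using y' by simp
  qed
  have main: "\<exists>s\<in>B. s \<noteq> g y \<and> y = s - g y" if y: "y \<in> N0" for y
  proof -
    have y': "y \<in> V" "u \<bullet> y = 0" and gy: "g y \<in> B" using y g by auto
    have m1: "z (g y) \<bullet> y = -1"
      using height_zero_neighbour(1)[OF fano facet gy y'] g[OF y] by simp
    let ?C = "B - {g y}"
    have s: "(\<Sum>b\<in>?C. z b \<bullet> y) = 1"
      using height_sum[of y] y'(2) m1 sum.remove[OF BD(3) gy, of "\<lambda>b. z b \<bullet> y"] by simp
    have nn: "z b \<bullet> y \<ge> 0" if "b \<in> ?C" for b
    proof (rule ccontr)
      assume "\<not> z b \<bullet> y \<ge> 0"
      then show False using only[OF y, of b] that by simp
    qed
    have "\<exists>b\<in>?C. z b \<bullet> y \<noteq> 0"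
    proof (rule ccontr)
      assume "\<not> ?thesis"
      then have "(\<Sum>b\<in>?C. z b \<bullet> y) = 0" by (intro sum.neutral) auto
      then show False using s by simp
    qed
    then obtain b where b: "b \<in> ?C" "z b \<bullet> y \<noteq> 0" by blast
    have bB: "b \<in> B" using b by simp
    have "z b \<bullet> y > 0" using nn[OF b(1)] b(2) by simp
    then have b1: "z b \<bullet> y \<ge> 1" using Ints_less_imp_le[OF Ints_0 zint[OF bB y'(1)]] by simp
    have finC: "finite ?C" using BD(3) by simp
    have r: "z b \<bullet> y + (\<Sum>c\<in>?C - {b}. z c \<bullet> y) = 1"
      using s sum.remove[OF finC b(1), of "\<lambda>b. z b \<bullet> y"] by simp
    moreover have "(\<Sum>c\<in>?C - {b}. z c \<bullet> y) \<ge> 0" using nn by (intro sum_nonneg) blast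
    ultimately have e: "z b \<bullet> y = 1" "(\<Sum>c\<in>?C - {b}. z c \<bullet> y) = 0" using b1 by linarith+
    then have "\<forall>c\<in>?C - {b}. z c \<bullet> y = 0"
      using nn finC by (subst (asm) sum_nonneg_eq_0_iff) blast+
    then have "(\<Sum>c\<in>?C - {b}. (z c \<bullet> y) *\<^sub>R c) = 0" by (intro sum.neutral) auto
    then have "(\<Sum>c\<in>?C. (z c \<bullet> y) *\<^sub>R c) = b"
      using sum.remove[OF finC b(1), of "\<lambda>c. (z c \<bullet> y) *\<^sub>R c"] e by simp
    then have "y = - g y + b"
      using expand[of y] sum.remove[OF BD(3) gy, of "\<lambda>c. (z c \<bullet> y) *\<^sub>R c"] m1 by simp
    then show ?thesis using b by (intro bexI[of _ b]) auto
  qed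
  show "\<exists>b\<in>B. \<exists>s\<in>B. s \<noteq> b \<and> y = s - b" if "y \<in> N0" for y
    using main[OF that] g[OF that] by blast
  show "\<exists>s\<in>B. s \<noteq> b \<and> s - b \<in> V" if b: "b \<in> B" for b
  proof -
    obtain y where y: "y \<in> N0" "b = g y" using gB b by blast
    obtain s where "s \<in> B" "s \<noteq> g y" "y = s - g y" using main[OF y(1)] by blast
    then show ?thesis using y by auto
  qed
qed

text \<open>A positive coordinate of \<open>x\<close> at \<open>b\<close> would push the height of
  \<open>x\<close> on the facet across \<open>b\<close> below -1, but that facet is extremal too. So
  \<open>x\<close> has non-positive integral coordinates with sum -1 and is the negative of a facet
  vertex; counting shows that all negatives occur.\<close>

lemma extremal_neg: "b \<in> B \<Longrightarrow> - b \<in> V"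
proof -
  have sub: "N1 \<subseteq> uminus ` B"
  proof
    fix x assume x: "x \<in> N1"
    have ux: "u \<bullet> x = -1" by (rule extremal_N1[OF x])
    have xV: "x \<in> V" using x by simp
    have np: "z b \<bullet> x \<le> 0" if b: "b \<in> B" for b
    proof -
      \<comment> \<open>The vertex \<open>s - b\<close> at height 0 identifies the functional of the
        facet across \<open>b\<close> as \<open>u - z b\<close>.\<close>
      obtain s where s: "s \<in> B" "s \<noteq> b" "s - b \<in> V" using extremal_N0(2)[OF b] by blast
      have h: "u \<bullet> (s - b) = 0" "z b \<bullet> (s - b) < 0" using s b by (simp_all add: inner_diff_right ub zb)
      note f = height_zero_neighbour(2)[OF fano facet b s(3) h]
      interpret w: fano_facet V "u - z b" by standard (fact fano, fact f)
      have "(u - z b) \<bullet> x \<ge> -1"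
      proof (cases "(u - z b) \<bullet> x < 0")
        case True
        then show ?thesis using w.extremal_N1[OF S0 card_V_max, of x] xV by simp
      qed simp
      then show ?thesis using ux by (simp add: inner_diff_left)
    qed
    have s: "(\<Sum>b\<in>B. - (z b \<bullet> x)) = 1" using height_sum[of x] ux by (simp add: sum_negf)
    have "\<exists>b\<in>B. z b \<bullet> x \<noteq> 0"
    proof (rule ccontr)
      assume "\<not> ?thesis"
      then have "(\<Sum>b\<in>B. - (z b \<bullet> x)) = 0" by (intro sum.neutral) auto
      then show False using s by simp
    qed
    then obtain b where b: "b \<in> B" "z b \<bullet> x \<noteq> 0" by blast
    then have "z b \<bullet> x < 0" using np[of b] by simp
    then have b1: "z b \<bullet> x \<le> -1" using Ints_less_imp_le[OF zint[OF b(1) xV] Ints_0] by simp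
    have r: "- (z b \<bullet> x) + (\<Sum>c\<in>B - {b}. - (z c \<bullet> x)) = 1"
      using s sum.remove[OF BD(3) b(1), of "\<lambda>b. - (z b \<bullet> x)"] by simp
    moreover have "(\<Sum>c\<in>B - {b}. - (z c \<bullet> x)) \<ge> 0" using np by (intro sum_nonneg) auto
    ultimately have e: "z b \<bullet> x = -1" "(\<Sum>c\<in>B - {b}. - (z c \<bullet> x)) = 0" using b1 by linarith+
    then have "\<forall>c\<in>B - {b}. - (z c \<bullet> x) = 0"
      using np BD(3) by (subst (asm) sum_nonneg_eq_0_iff) auto
    then have "(\<Sum>c\<in>B - {b}. (z c \<bullet> x) *\<^sub>R c) = 0" by (intro sum.neutral) auto
    then have "x = - b"
      using expand[of x] sum.remove[OF BD(3) b(1), of "\<lambda>c. (z c \<bullet> x) *\<^sub>R c"] e by simp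
    then show "x \<in> uminus ` B" using b by blast
  qed
  have "N1 = uminus ` B"
    using extremal_counts(2) BD(3) by (intro card_subset_eq sub) (auto simp: card_image)
  then show "b \<in> B \<Longrightarrow> - b \<in> V" by auto
qed

end

end

text \<open>Splits off one orbit at a time. Partners receive consecutive numbers, which is how
  \<open>hexagon_sum\<close> groups the coordinates into planes.\<close>

lemma involution_pairing:
  assumes "finite B" "\<And>b. b \<in> B \<Longrightarrow> \<sigma> b \<in> B \<and> \<sigma> b \<noteq> b \<and> \<sigma> (\<sigma> b) = b"
  shows "\<exists>(n::nat) h. bij_betw h {..<2 * n} B \<and> (\<forall>j<n. \<sigma> (h (2 * j)) = h (2 * j + 1))"
  using assms
proof (induction "card B" arbitrary: B rule: less_induct)
  case less
  show ?case
  proof (cases "B = {}")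
    case True
    then show ?thesis by (intro exI[of _ 0] exI[of _ "\<lambda>_. undefined"]) (auto simp: bij_betw_def)
  next
    case False
    then obtain b where b: "b \<in> B" by blast
    note \<sigma> = less.prems(2)
    let ?C = "B - {b, \<sigma> b}"
    have "card ?C < card B" using b less.prems(1) by (intro psubset_card_mono) auto
    moreover have "\<sigma> c \<in> ?C \<and> \<sigma> c \<noteq> c \<and> \<sigma> (\<sigma> c) = c" if "c \<in> ?C" for c
      using \<sigma>[of c] \<sigma>[of b] b that by auto
    ultimately obtain n :: nat and h where h: "bij_betw h {..<2 * n} ?C" "\<forall>j<n. \<sigma> (h (2 * j)) = h (2 * j + 1)"
      using less.hyps[of ?C] less.prems(1) by blast
    define k where "k = (\<lambda>i. if i < 2 * n then h i else if i = 2 * n then b else \<sigma> b)"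
    have "bij_betw k {..<2 * n} ?C" using h(1) by (subst bij_betw_cong[of _ _ h]) (auto simp: k_def)
    moreover have "bij_betw k {2 * n, 2 * n + 1} {b, \<sigma> b}"
      using \<sigma>[OF b] by (auto simp: bij_betw_def k_def)
    ultimately have "bij_betw k ({..<2 * n} \<union> {2 * n, 2 * n + 1}) (?C \<union> {b, \<sigma> b})"
      by (rule bij_betw_combine) auto
    moreover have "{..<2 * n} \<union> {2 * n, 2 * n + 1} = {..<2 * Suc n}" by auto
    moreover have "?C \<union> {b, \<sigma> b} = B" using b \<sigma>[OF b] by auto
    ultimately have "bij_betw k {..<2 * Suc n} B" by simp
    moreover have "\<sigma> (k (2 * j)) = k (2 * j + 1)" if j: "j < Suc n" for j
    proof (cases "j = n")
      case False
      then have "j < n" using j by simp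
      then show ?thesis using h(2) by (simp add: k_def)
    qed (simp add: k_def)
    ultimately show ?thesis by blast
  qed
qed

text \<open>Each \<open>b\<close> has exactly one partner \<open>s\<close> such that
  \<open>s - b\<close> is a vertex. Since every vertex lies on a facet and every facet is extremal,
  \<open>V\<close> is closed under negation, so the partner relation is symmetric.\<close>

lemma extremal_involution:
  fixes V :: "(real ^ 'm) set"
  assumes V: "fano_set V" and u: "facet_normal V u" and S0: "\<Sum>V = 0" and c: "card V = 3 * CARD('m)"
  shows "\<exists>\<sigma>. (\<forall>b\<in>tight V u. \<sigma> b \<in> tight V u \<and> \<sigma> b \<noteq> b \<and> \<sigma> (\<sigma> b) = b) \<and>
    V = tight V u \<union> uminus ` tight V u \<union> (\<lambda>b. \<sigma> b - b) ` tight V u"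
proof -
  interpret fano_facet V u by standard fact+
  have neg: "- v \<in> V" if v: "v \<in> V" for v
  proof -
    obtain w where w: "facet_normal V w" "v \<in> tight V w" using fano_vertex_facet[OF V v] by blast
    interpret w: fano_facet V w by standard fact+
    show ?thesis using w.extremal_neg[OF S0 c w(2)] .
  qed
  obtain \<sigma> where s: "\<And>b. b \<in> B \<Longrightarrow> \<sigma> b \<in> B \<and> \<sigma> b \<noteq> b \<and> \<sigma> b - b \<in> V"
    using extremal_N0(2)[OF S0 c] by metis
  have uniq: "s' = \<sigma> b" if b: "b \<in> B" and s': "s' \<in> B" "s' \<noteq> b" "s' - b \<in> V" for s' b
  proof -
    have "s' - b \<in> N0" "z b \<bullet> (s' - b) < 0" "\<sigma> b - b \<in> N0" "z b \<bullet> (\<sigma> b - b) < 0"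
      using b s' s[OF b] by (simp_all add: inner_diff_right ub zb)
    then have "s' - b = \<sigma> b - b" using unique b by blast
    then show ?thesis by simp
  qed
  have inv: "\<sigma> (\<sigma> b) = b" if b: "b \<in> B" for b
  proof -
    have "b - \<sigma> b \<in> V" using neg[of "\<sigma> b - b"] s[OF b] by simp
    then show ?thesis using uniq[of "\<sigma> b" b] s[OF b] b by auto
  qed
  have "V = B \<union> uminus ` B \<union> (\<lambda>b. \<sigma> b - b) ` B"
  proof (intro equalityI subsetI)
    fix v assume v: "v \<in> V"
    then consider "v \<in> B" | "v \<in> N0" | "v \<in> N1" using cases_V by blast
    then show "v \<in> B \<union> uminus ` B \<union> (\<lambda>b. \<sigma> b - b) ` B"
    proof cases
      case 2
      then obtain b s where "b \<in> B" "s \<in> B" "s \<noteq> b" "v = s - b" using extremal_N0(1)[OF S0 c 2] by blast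
      then show ?thesis using uniq[of b s] v by blast
    next
      case 3
      then have "- v \<in> B" using neg[OF v] extremal_N1[OF S0 c 3] unfolding tight_def by simp
      then have "- (- v) \<in> uminus ` B" by (rule imageI)
      then show ?thesis by simp
    qed simp
  next
    fix v assume "v \<in> B \<union> uminus ` B \<union> (\<lambda>b. \<sigma> b - b) ` B"
    then consider "v \<in> B" | "v \<in> uminus ` B" | "v \<in> (\<lambda>b. \<sigma> b - b) ` B" by blast
    then show "v \<in> V"
    proof cases
      case 1
      then show ?thesis by (rule BV)
    next
      case 2
      then show ?thesis using neg BV by blast
    next
      case 3
      then show ?thesis using s by blast
    qed
  qed
  then show ?thesis using s inv by (intro exI[of _ \<sigma>]) auto
qed

section \<open>The Fano simplex and the sum of hexagons\<close>

definition int_span :: "(real ^ 'm) set \<Rightarrow> (real ^ 'm) set" where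
  "int_span C = {x. \<exists>c :: real ^ 'm \<Rightarrow> int. x = (\<Sum>b\<in>C. of_int (c b) *\<^sub>R b)}"

lemma int_span_add: "x \<in> int_span C \<Longrightarrow> y \<in> int_span C \<Longrightarrow> x + y \<in> int_span C"
proof -
  assume "x \<in> int_span C" "y \<in> int_span C"
  then obtain c d :: "_ \<Rightarrow> int" where "x = (\<Sum>b\<in>C. of_int (c b) *\<^sub>R b)" "y = (\<Sum>b\<in>C. of_int (d b) *\<^sub>R b)"
    unfolding int_span_def by blast
  then have "x + y = (\<Sum>b\<in>C. of_int (c b + d b) *\<^sub>R b)" by (simp add: scaleR_add_left sum.distrib)
  then show "x + y \<in> int_span C" unfolding int_span_def by (intro CollectI exI[of _ "\<lambda>b. c b + d b"])
qed

lemma int_span_scale: "x \<in> int_span C \<Longrightarrow> of_int k *\<^sub>R x \<in> int_span C"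
proof -
  assume "x \<in> int_span C"
  then obtain c :: "_ \<Rightarrow> int" where "x = (\<Sum>b\<in>C. of_int (c b) *\<^sub>R b)"
    unfolding int_span_def by blast
  then have "of_int k *\<^sub>R x = (\<Sum>b\<in>C. of_int (k * c b) *\<^sub>R b)" by (simp add: scaleR_sum_right)
  then show "of_int k *\<^sub>R x \<in> int_span C" unfolding int_span_def by (intro CollectI exI[of _ "\<lambda>b. k * c b"])
qed

lemma int_span_0: "0 \<in> int_span C"
  unfolding int_span_def by (intro CollectI exI[of _ "\<lambda>_. 0"]) simp

lemma int_span_minus: "x \<in> int_span C \<Longrightarrow> - x \<in> int_span C"
  using int_span_scale[of x C "-1"] by simp

lemma int_span_diff: "x \<in> int_span C \<Longrightarrow> y \<in> int_span C \<Longrightarrow> x - y \<in> int_span C"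
  using int_span_add[of x C "- y"] int_span_minus[of y C] by simp

lemma int_span_sum: "(\<And>i. i \<in> I \<Longrightarrow> f i \<in> int_span C) \<Longrightarrow> (\<Sum>i\<in>I. f i) \<in> int_span C"
  by (induction I rule: infinite_finite_induct) (auto intro: int_span_add int_span_0)

lemma int_span_base:
  assumes "finite C" "x \<in> C"
  shows "x \<in> int_span C"
proof -
  have "(\<Sum>b\<in>C. of_int (if b = x then 1 else 0) *\<^sub>R b) = (\<Sum>b\<in>C. if b = x then b else 0)"
    by (rule sum.cong) auto
  also have "\<dots> = x" using assms by simp
  finally show ?thesis unfolding int_span_def by (intro CollectI exI[of _ "\<lambda>b. if b = x then 1 else 0"]) simp
qed

lemma int_span_lattice_basis:
  assumes "lattice_basis B" "B \<subseteq> int_span C" "x \<in> lattice"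
  shows "x \<in> int_span C"
proof -
  obtain c :: "_ \<Rightarrow> int" where "x = (\<Sum>b\<in>B. of_int (c b) *\<^sub>R b)"
    using lattice_basis_expand[OF assms(1,3)] by blast
  then show ?thesis using assms(2) by (auto intro!: int_span_sum int_span_scale)
qed

text \<open>The integral span of \<open>C\<close> contains all lattice points, in particular the
  unit vectors. Hence \<open>C\<close> spans the real space, and having at most as many elements as
  the dimension it is independent.\<close>

lemma lattice_basis_int_spanI:
  fixes B :: "(real ^ 'm) set"
  assumes "finite C" "card C \<le> CARD('m)" "C \<subseteq> lattice" "lattice_basis B" "B \<subseteq> int_span C"
  shows "lattice_basis C"
proof -
  have L: "\<And>x. x \<in> lattice \<Longrightarrow> x \<in> int_span C" using int_span_lattice_basis[OF assms(4,5)] .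
  have "int_span C \<subseteq> span C"
    unfolding int_span_def by (clarify, rule span_sum, rule span_scale, rule span_base)
  then have "range unit_vec \<subseteq> span C" using L by auto
  then have "span C = UNIV" using span_unit_vec span_minimal[of "range unit_vec" "span C"] by auto
  then have "independent C"
    using assms(1,2) by (intro card_le_dim_spanning[of C UNIV]) auto
  then show ?thesis using assms(3) L unfolding lattice_basis_def int_span_def by blast
qed

text \<open>The coefficient of \<open>b\<close> in \<open>n\<close> is 1 or -1, so \<open>b\<close>
  is an integral combination of \<open>n\<close> and the other elements.\<close>

lemma lattice_basis_exchange:
  fixes B :: "(real ^ 'm) set"
  assumes B: "lattice_basis B" and b: "b \<in> B" and n: "n \<in> lattice" and k: "\<bar>dual_vec B b \<bullet> n\<bar> = 1"
  shows "lattice_basis (insert n (B - {b}))"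
proof (rule lattice_basis_int_spanI[OF _ _ _ B])
  note BD = lattice_basisD[OF B]
  let ?C = "insert n (B - {b})"
  show fin: "finite ?C" using BD by simp
  show "card ?C \<le> CARD('m)"
    using BD(3,5) b by (simp add: card_insert_if card_Diff_singleton)
  show "?C \<subseteq> lattice" using BD n by auto
  have "n = (dual_vec B b \<bullet> n) *\<^sub>R b + (\<Sum>c\<in>B - {b}. (dual_vec B c \<bullet> n) *\<^sub>R c)"
    using dual_vec_expand[OF BD(2,4), of n] sum.remove[OF BD(3) b, of "\<lambda>c. (dual_vec B c \<bullet> n) *\<^sub>R c"] by simp
  then have e: "(dual_vec B b \<bullet> n) *\<^sub>R b = n - (\<Sum>c\<in>B - {b}. (dual_vec B c \<bullet> n) *\<^sub>R c)"
    by (simp add: algebra_simps)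
  have cs: "(dual_vec B c \<bullet> n) *\<^sub>R c \<in> int_span ?C" if c: "c \<in> B - {b}" for c
  proof -
    have "dual_vec B c \<bullet> n \<in> \<int>" using lattice_basis_coord[OF B n] c by blast
    then obtain i :: int where "dual_vec B c \<bullet> n = of_int i" by (auto elim: Ints_cases)
    moreover have "c \<in> int_span ?C" using c by (intro int_span_base[OF fin]) auto
    ultimately show ?thesis using int_span_scale[of c ?C i] by simp
  qed
  have s: "(dual_vec B b \<bullet> n) *\<^sub>R b \<in> int_span ?C"
    unfolding e by (rule int_span_diff[OF int_span_base[OF fin] int_span_sum[OF cs]]) auto
  consider "dual_vec B b \<bullet> n = 1" | "dual_vec B b \<bullet> n = -1" using k by linarith
  then have "b \<in> int_span ?C"
  proof cases
    case 1
    then show ?thesis using s by simp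
  next
    case 2
    then show ?thesis using int_span_minus[OF s] by simp
  qed
  then show "B \<subseteq> int_span ?C" using int_span_base[OF fin] by blast
qed

text \<open>Otherwise the hull has empty interior and lies in a hyperplane, or 0 can be separated
  from its interior and the hull lies in a half space. The assumption for the normal vector, in the
  first case also for its negative, contradicts this.\<close>

lemma zero_in_interiorI:
  fixes V :: "'a::euclidean_space set"
  assumes "\<And>a. a \<noteq> 0 \<Longrightarrow> \<exists>v\<in>V. a \<bullet> v < 0"
  shows "0 \<in> interior (convex hull V)"
proof (rule ccontr)
  let ?P = "convex hull V"
  assume n: "0 \<notin> interior ?P"
  show False
  proof (cases "interior ?P = {}")
    case True
    obtain a b where ab: "a \<noteq> 0" "?P \<subseteq> {x. a \<bullet> x = b}"
      using empty_interior_subset_hyperplane[OF convex_convex_hull True] by blast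
    obtain v where v: "v \<in> V" "a \<bullet> v < 0" using assms[OF ab(1)] by blast
    obtain w where w: "w \<in> V" "- a \<bullet> w < 0" using assms[of "- a"] ab(1) by auto
    have "a \<bullet> v = b" "a \<bullet> w = b" using ab(2) v(1) w(1) hull_subset[of V convex] by auto
    then show False using v(2) w(2) by simp
  next
    case False
    obtain a where a: "a \<noteq> 0" "\<forall>x\<in>interior ?P. 0 \<le> a \<bullet> x"
      using separating_hyperplane_set_0[OF convex_interior[OF convex_convex_hull] n] by blast
    have "closure (interior ?P) \<subseteq> {x. 0 \<le> a \<bullet> x}"
      using a(2) closed_halfspace_ge[of 0 a] by (intro closure_minimal) auto
    then have "closure ?P \<subseteq> {x. 0 \<le> a \<bullet> x}" using convex_closure_interior[of ?P] False by simp
    then have "V \<subseteq> {x. 0 \<le> a \<bullet> x}" using closure_subset[of ?P] hull_subset[of V convex] by blast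
    then show False using assms[OF a(1)] by force
  qed
qed

text \<open>A facet contains at least as many points as the dimension, but not all of them, since
  the points of \<open>?V\<close> add up to 0. So exactly one is missing, and the others arise from
  \<open>B\<close> by an exchange, or are \<open>B\<close> itself.\<close>

lemma fano_set_simplex:
  fixes B :: "(real ^ 'm) set"
  assumes B: "lattice_basis B"
  shows "fano_set (insert (- \<Sum>B) B)"
  unfolding fano_set_def
proof (intro conjI allI impI)
  note BD = lattice_basisD[OF B]
  let ?V = "insert (- \<Sum>B) B"
  have zs: "dual_vec B b \<bullet> (- \<Sum>B) = -1" if "b \<in> B" for b
    using dual_vec_sum[OF BD(2) that, of "\<lambda>_. 1"] by simp
  have B0: "B \<noteq> {}" using BD(5) by auto
  have nB: "- \<Sum>B \<notin> B"
  proof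
    assume "- \<Sum>B \<in> B"
    then show False using zs[of "- \<Sum>B"] dual_vec[OF BD(2), of "- \<Sum>B" "- \<Sum>B"] by simp
  qed
  show "finite ?V" using BD by simp
  show "?V \<subseteq> lattice" using BD(1) by (auto intro!: lattice_minus lattice_sum)
  show "0 \<notin> ?V"
  proof
    assume "0 \<in> ?V"
    moreover have "0 \<notin> B" using BD(2) dependent_zero by blast
    ultimately have "- \<Sum>B = 0" by auto
    then show False using zs B0 by (metis all_not_in_conv inner_zero_right neg_equal_0_iff_equal one_neq_zero)
  qed
  show "0 \<in> interior (convex hull ?V)"
  proof (rule zero_in_interiorI, rule ccontr)
    fix a :: "real ^ 'm" assume a: "a \<noteq> 0" and "\<not> (\<exists>v\<in>?V. a \<bullet> v < 0)"
    then have nn: "\<And>b. b \<in> B \<Longrightarrow> a \<bullet> b \<ge> 0" "a \<bullet> (- \<Sum>B) \<ge> 0" by force+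
    then have "(\<Sum>b\<in>B. a \<bullet> b) = 0" using sum_nonneg[of B "\<lambda>b. a \<bullet> b"] by (simp add: inner_sum_right)
    then have "\<forall>b\<in>B. a \<bullet> b = 0" using nn(1) BD(3) by (subst (asm) sum_nonneg_eq_0_iff) auto
    then have "a = 0" by (intro inner_eq_on_spanning[OF BD(4)]) auto
    then show False using a by simp
  qed
  fix y assume y: "facet_normal ?V y"
  have sub: "tight ?V y \<subseteq> ?V" by (rule tight_subset)
  have "card (tight ?V y) \<ge> CARD('m)"
  proof -
    have "DIM(real ^ 'm) \<le> card (tight ?V y)"
      using y dim_le_card[of "UNIV" "tight ?V y"] finite_subset[OF sub] BD(3) by (simp add: facet_normal_def)
    then show ?thesis by simp
  qed
  have "tight ?V y \<noteq> ?V"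
  proof
    assume e: "tight ?V y = ?V"
    then have "y \<bullet> b = 1" if "b \<in> B" for b using that tight_inner[of b ?V y] by simp
    moreover have "y \<bullet> (- \<Sum>B) = 1" using e tight_inner[of "- \<Sum>B" ?V y] by simp
    ultimately show False by (simp add: inner_sum_right)
  qed
  then obtain v where v: "v \<in> ?V" "v \<notin> tight ?V y" using sub by blast
  have "card (?V - {v}) = CARD('m)" using v(1) BD(3,5) nB by simp
  then have t: "tight ?V y = ?V - {v}"
    using card_seteq[of "?V - {v}" "tight ?V y"] sub v BD(3) \<open>card (tight ?V y) \<ge> CARD('m)\<close> by auto
  show "lattice_basis (tight ?V y)"
  proof (cases "v = - \<Sum>B")
    case True
    then have "tight ?V y = B" using t nB by auto
    then show ?thesis using B by simp
  next
    case False
    then have b: "v \<in> B" using v(1) by auto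
    have "tight ?V y = insert (- \<Sum>B) (B - {v})" using t False by auto
    then show ?thesis using lattice_basis_exchange[OF B b, of "- \<Sum>B"] zs[OF b] BD(1)
      by (auto intro!: lattice_minus lattice_sum)
  qed
qed

lemma lattice_basis_linear_extend:
  fixes B :: "(real ^ 'm) set" and g :: "real ^ 'm \<Rightarrow> real ^ 'm"
  assumes "lattice_basis B" "lattice_basis (g ` B)"
  shows "\<exists>f\<in>lattice_transformations. \<forall>b\<in>B. f b = g b"
proof -
  obtain f where f: "linear f" "\<forall>b\<in>B. f b = g b"
    using linear_independent_extend[OF lattice_basisD(2)[OF assms(1)]] by blast
  then have "f ` B = g ` B" by auto
  then show ?thesis using lattice_transformationI[OF f(1) assms(1)] assms(2) f(2) by auto
qed

lemma sum_range_unit_vec: "\<Sum>(range unit_vec) = (\<Sum>i\<in>UNIV. unit_vec i :: real ^ 'm)"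
  by (subst sum.reindex) (auto intro: injI)

lemma fano_polytope_fano_simplex: "fano_polytope (fano_simplex :: (real ^ 'm) set)"
  using fano_set_polytope[OF fano_set_simplex[OF lattice_basis_unit_vec]]
  by (simp add: fano_simplex_def sum_range_unit_vec)

lemma lattice_isomorphic_fano_simplex:
  fixes B :: "(real ^ 'm) set"
  assumes B: "lattice_basis B"
  shows "lattice_isomorphic (convex hull (insert (- \<Sum>B) B)) fano_simplex"
proof -
  note BD = lattice_basisD[OF B]
  obtain g :: "real ^ 'm \<Rightarrow> 'm" where g: "bij_betw g B UNIV"
    using BD(3,5) finite_same_card_bij[of B "UNIV :: 'm set"] by auto
  have im: "(unit_vec \<circ> g) ` B = range unit_vec"
    using bij_betw_imp_surj_on[OF g] by (metis image_comp)
  obtain f where f: "f \<in> lattice_transformations" "\<forall>b\<in>B. f b = (unit_vec \<circ> g) b"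
    using lattice_basis_linear_extend[OF B, of "unit_vec \<circ> g"] lattice_basis_unit_vec im by auto
  have lin: "linear f" using f unfolding lattice_transformations_eq by auto
  have "f (- \<Sum>B) = - (\<Sum>b\<in>B. unit_vec (g b))"
    using f(2) by (simp add: linear_neg[OF lin] linear_sum[OF lin])
  also have "\<dots> = - (\<Sum>i\<in>UNIV. unit_vec i)" using sum.reindex_bij_betw[OF g, of unit_vec] by simp
  finally have "f ` insert (- \<Sum>B) B = insert (- (\<Sum>i\<in>UNIV. unit_vec i)) (range unit_vec)"
    using f(2) im by auto
  then show ?thesis
    unfolding lattice_isomorphic_def fano_simplex_def
    by (intro bexI[of _ f] f(1)) (simp only: convex_hull_linear_image[OF lin])
qed

section \<open>Sums of hexagons\<close>

definition hexagon_points :: "(nat \<Rightarrow> 'm::finite) \<Rightarrow> nat \<Rightarrow> (real ^ 'm) set" where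
  "hexagon_points e j = (let a = unit_vec (e (2 * j)); b = unit_vec (e (2 * j + 1)) in
     {a, - a, b, - b, a + b, - (a + b)})"

lemma hexagon_sum_eq: "hexagon_sum (e :: nat \<Rightarrow> 'm::finite) = convex hull (\<Union>j<CARD('m) div 2. hexagon_points e j)"
proof -
  have h: "hexagon (e (2 * j)) (e (2 * j + 1)) = convex hull hexagon_points e j" for j
    by (simp add: hexagon_def hexagon_points_def Let_def)
  show ?thesis
    unfolding hexagon_sum_def h
  proof (intro equalityI)
    show "convex hull (\<Union>j<CARD('m) div 2. convex hull hexagon_points e j)
       \<subseteq> convex hull (\<Union>j<CARD('m) div 2. hexagon_points e j)"
      by (intro hull_minimal UN_least hull_mono) auto
    show "convex hull (\<Union>j<CARD('m) div 2. hexagon_points e j)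
       \<subseteq> convex hull (\<Union>j<CARD('m) div 2. convex hull hexagon_points e j)"
      by (intro hull_mono UN_mono hull_subset) auto
  qed
qed

text \<open>A functional bounded by 1 touches the hexagon in at most one vertex or along an edge.
  The last inclusion records that the ends \<open>p\<close> and \<open>q\<close> of an edge generate
  \<open>a\<close> and \<open>b\<close> over the integers.\<close>

lemma hexagon_tight_cases:
  fixes a b y :: "'a::real_inner"
  defines "H \<equiv> {a, - a, b, - b, a + b, - (a + b)}"
  assumes le: "\<And>v. v \<in> H \<Longrightarrow> y \<bullet> v \<le> 1"
  shows "(\<exists>p. tight H y \<subseteq> {p}) \<or> (\<exists>p q. tight H y = {p, q} \<and>
    {a, b} \<subseteq> {p, - p, q, - q, p - q, q - p})"
proof -
  have ab: "\<bar>y \<bullet> a\<bar> \<le> 1" "\<bar>y \<bullet> b\<bar> \<le> 1" "\<bar>y \<bullet> a + y \<bullet> b\<bar> \<le> 1"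
    using le[of a] le[of "- a"] le[of b] le[of "- b"] le[of "a + b"] le[of "- (a + b)"]
    by (auto simp: H_def inner_add_right inner_diff_right)
  have t: "v \<in> tight H y \<longleftrightarrow> (v = a \<and> y \<bullet> a = 1) \<or> (v = - a \<and> y \<bullet> a = -1) \<or> (v = b \<and> y \<bullet> b = 1) \<or>
    (v = - b \<and> y \<bullet> b = -1) \<or> (v = a + b \<and> y \<bullet> a + y \<bullet> b = 1) \<or> (v = - (a + b) \<and> y \<bullet> a + y \<bullet> b = -1)" for v
    by (auto simp: tight_def H_def inner_add_right inner_diff_right)
  consider (1) "y \<bullet> a = 1" "y \<bullet> b = -1" | (2) "y \<bullet> a = 1" "y \<bullet> b = 0" | (3) "y \<bullet> a = 0" "y \<bullet> b = 1"
    | (4) "y \<bullet> a = -1" "y \<bullet> b = 1" | (5) "y \<bullet> a = -1" "y \<bullet> b = 0" | (6) "y \<bullet> a = 0" "y \<bullet> b = -1"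
    | (7) "\<exists>p. tight H y \<subseteq> {p}"
  proof (cases "y \<bullet> a = 1 \<or> y \<bullet> a = -1")
    case True
    then show ?thesis
    proof
      assume e: "y \<bullet> a = 1"
      then consider "y \<bullet> b = -1" | "y \<bullet> b = 0" | "y \<bullet> b < 0" "y \<bullet> b > -1" using ab by linarith
      then show ?thesis
      proof cases
        case 3
        then have "tight H y \<subseteq> {a}" using e t by auto
        then show ?thesis using that by blast
      qed (use e that in auto)
    next
      assume e: "y \<bullet> a = -1"
      then consider "y \<bullet> b = 1" | "y \<bullet> b = 0" | "y \<bullet> b > 0" "y \<bullet> b < 1" using ab by linarith
      then show ?thesis
      proof cases
        case 3
        then have "tight H y \<subseteq> {- a}" using e t by auto
        then show ?thesis using that by blast
      qed (use e that in auto)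
    qed
  next
    case na: False
    show ?thesis
    proof (cases "y \<bullet> a = 0")
      case True
      show ?thesis
      proof (cases "y \<bullet> b = 1 \<or> y \<bullet> b = -1")
        case False
        \<comment> \<open>No point is tight here; \<open>{0}\<close> just serves as some
          singleton.\<close>
        then have "tight H y \<subseteq> {0}" using True t by auto
        then show ?thesis using that by blast
      qed (use True that in auto)
    next
      case False
      consider "y \<bullet> b = 1" | "y \<bullet> b = -1" | "y \<bullet> b \<noteq> 1" "y \<bullet> b \<noteq> -1" "y \<bullet> a + y \<bullet> b = 1"
        | "y \<bullet> b \<noteq> 1" "y \<bullet> b \<noteq> -1" "y \<bullet> a + y \<bullet> b \<noteq> 1" by blast
      then have "tight H y \<subseteq> {b} \<or> tight H y \<subseteq> {- b} \<or> tight H y \<subseteq> {a + b} \<or> tight H y \<subseteq> {- (a + b)}"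
      proof cases
        case 1
        then have "tight H y \<subseteq> {b}" using na False ab t by auto
        then show ?thesis by blast
      next
        case 2
        then have "tight H y \<subseteq> {- b}" using na False ab t by auto
        then show ?thesis by blast
      next
        case 3
        then have "tight H y \<subseteq> {a + b}" using na False ab t by auto
        then show ?thesis by blast
      next
        case 4
        then have "tight H y \<subseteq> {- (a + b)}" using na False ab t by auto
        then show ?thesis by blast
      qed
      then show ?thesis using that by blast
    qed
  qed
  then show ?thesis
  proof cases
    case 1
    then have "tight H y = {a, - b}" using t by auto
    then show ?thesis by (intro disjI2 exI[of _ a] exI[of _ "- b"]) auto
  next
    case 2
    then have "tight H y = {a, a + b}" using t by auto
    then show ?thesis by (intro disjI2 exI[of _ a] exI[of _ "a + b"]) auto
  next
    case 3
    then have "tight H y = {b, a + b}" using t by auto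
    then show ?thesis by (intro disjI2 exI[of _ b] exI[of _ "a + b"]) auto
  next
    case 4
    then have "tight H y = {- a, b}" using t by auto
    then show ?thesis by (intro disjI2 exI[of _ "- a"] exI[of _ b]) auto
  next
    case 5
    then have "tight H y = {- a, - (a + b)}" using t by auto
    then show ?thesis by (intro disjI2 exI[of _ "- a"] exI[of _ "- (a + b)"]) auto
  next
    case 6
    then have "tight H y = {- b, - (a + b)}" using t by auto
    then show ?thesis by (intro disjI2 exI[of _ "- b"] exI[of _ "- (a + b)"]) auto
  next
    case 7
    then show ?thesis by blast
  qed
qed

lemma even_index:
  assumes "even (d :: nat)" "i < d"
  obtains j where "j < d div 2" "i = 2 * j \<or> i = 2 * j + 1"
proof -
  have "i div 2 < d div 2" using assms by (auto elim!: evenE)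
  moreover have "i = 2 * (i div 2) \<or> i = 2 * (i div 2) + 1" by presburger
  ultimately show ?thesis using that by blast
qed

text \<open>Each plane contributes at most two tight points, while a facet must span. So every plane
  contributes an entire edge, and the ends of the edges generate the unit vectors of their
  planes.\<close>

lemma fano_set_hexagon_points:
  fixes e :: "nat \<Rightarrow> 'm::finite"
  assumes e: "bij_betw e {..<CARD('m)} UNIV" and ev: "even CARD('m)"
  shows "fano_set (\<Union>j<CARD('m) div 2. hexagon_points e j)"
  unfolding fano_set_def
proof (intro conjI allI impI)
  let ?d = "CARD('m)" let ?V = "\<Union>j<CARD('m) div 2. hexagon_points e j"
  have ne: "e (2 * j) \<noteq> e (2 * j + 1)" if "j < ?d div 2" for j
  proof -
    have "2 * j < ?d" "2 * j + 1 < ?d" using that ev by auto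
    then show ?thesis using e by (auto simp: bij_betw_def inj_on_eq_iff)
  qed
  show "finite ?V" by (auto simp: hexagon_points_def Let_def)
  show lat: "?V \<subseteq> lattice"
    by (auto simp: hexagon_points_def Let_def intro!: lattice_add lattice_minus lattice_diff)
  show "0 \<notin> ?V"
  proof
    assume "0 \<in> ?V"
    then obtain j where j: "j < ?d div 2" "0 \<in> hexagon_points e j" by blast
    let ?x = "e (2 * j)" and ?y = "e (2 * j + 1)"
    have "v $ ?x \<noteq> 0 \<or> v $ ?y \<noteq> 0" if "v \<in> hexagon_points e j" for v
      using that ne[OF j(1)] by (auto simp: hexagon_points_def Let_def unit_vec_nth)
    from this[OF j(2)] show False by simp
  qed
  have pm: "unit_vec i \<in> ?V" "- unit_vec i \<in> ?V" for i
  proof -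
    obtain k where k: "k < ?d" "i = e k" using e by (auto simp: bij_betw_def)
    obtain j where j: "j < ?d div 2" "k = 2 * j \<or> k = 2 * j + 1" using even_index[OF ev k(1)] .
    then have "unit_vec i \<in> hexagon_points e j" "- unit_vec i \<in> hexagon_points e j"
      using k by (auto simp: hexagon_points_def Let_def)
    then show "unit_vec i \<in> ?V" "- unit_vec i \<in> ?V" using j by blast+
  qed
  show "0 \<in> interior (convex hull ?V)"
  proof (rule zero_in_interiorI, rule ccontr)
    fix a :: "real ^ 'm" assume a: "a \<noteq> 0" and nn: "\<not> (\<exists>v\<in>?V. a \<bullet> v < 0)"
    have "a \<bullet> unit_vec i = 0" for i
    proof -
      have "\<not> a \<bullet> unit_vec i < 0" "\<not> a \<bullet> (- unit_vec i) < 0" using nn pm by blast+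
      then show ?thesis by simp
    qed
    then have "a = 0" by (intro inner_eq_on_spanning[OF span_unit_vec]) auto
    then show False using a by simp
  qed
  fix y assume y: "facet_normal ?V y"
  define T where "T = (\<lambda>j. tight (hexagon_points e j) y)"
  have tV: "tight ?V y = (\<Union>j<?d div 2. T j)" by (auto simp: T_def tight_def)
  have cases: "(\<exists>p. T j \<subseteq> {p}) \<or> (\<exists>p q. T j = {p, q} \<and>
    {unit_vec (e (2 * j)), unit_vec (e (2 * j + 1))} \<subseteq> {p, - p, q, - q, p - q, q - p})" if j: "j < ?d div 2" for j
  proof -
    have le: "y \<bullet> v \<le> 1" if "v \<in> hexagon_points e j" for v
      using facet_normal_le[OF y, of v] that j by blast
    show ?thesis
      using hexagon_tight_cases[of "unit_vec (e (2 * j))" "unit_vec (e (2 * j + 1))" y] le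
      unfolding T_def hexagon_points_def Let_def by blast
  qed
  have finT: "finite (T j)" for j
    unfolding T_def by (rule finite_subset[OF tight_subset]) (simp add: hexagon_points_def Let_def)
  have c2: "card (T j) \<le> 2" if j: "j < ?d div 2" for j
  proof -
    have "\<exists>p q. T j \<subseteq> {p, q}" using cases[OF j] by blast
    then obtain p q where "T j \<subseteq> {p, q}" by blast
    then have "card (T j) \<le> card {p, q}" by (intro card_mono) auto
    also have "\<dots> \<le> 2" by (simp add: card_insert_if)
    finally show ?thesis .
  qed
  have finV: "finite (tight ?V y)" unfolding tV using finT by auto
  have "DIM(real ^ 'm) \<le> card (tight ?V y)"
    using y dim_le_card[of "UNIV" "tight ?V y"] finV by (simp add: facet_normal_def)
  then have dc: "?d \<le> card (tight ?V y)" by simp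
  have cU: "card (tight ?V y) \<le> (\<Sum>j<?d div 2. card (T j))"
    unfolding tV by (rule card_UN_le) simp
  have d2: "(\<Sum>j<?d div 2. 2) = ?d" using ev by simp
  have "card (tight ?V y) \<le> ?d"
    using cU sum_mono[of "{..<?d div 2}" "\<lambda>j. card (T j)" "\<lambda>_. 2"] c2 d2 by simp
  moreover have "range unit_vec \<subseteq> int_span (tight ?V y)"
  proof (rule subsetI)
    fix x :: "real ^ 'm" assume "x \<in> range unit_vec"
    then obtain i where i: "x = unit_vec i" by blast
    obtain k where k: "k < ?d" "i = e k" using e by (auto simp: bij_betw_def)
    obtain j where j: "j < ?d div 2" "k = 2 * j \<or> k = 2 * j + 1" using even_index[OF ev k(1)] .
    have "\<not> card (T j) \<le> 1"
    proof
      assume 1: "card (T j) \<le> 1"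
      have "(\<Sum>j<?d div 2. card (T j)) < (\<Sum>j<?d div 2. 2)"
        using 1 j(1) c2 by (intro sum_strict_mono_ex1) force+
      then show False using dc cU d2 by simp
    qed
    then have "\<not> (\<exists>p. T j \<subseteq> {p})" using card_mono[of "{_}" "T j"] by fastforce
    then obtain p q where pq: "T j = {p, q}"
      "{unit_vec (e (2 * j)), unit_vec (e (2 * j + 1))} \<subseteq> {p, - p, q, - q, p - q, q - p}"
      using cases[OF j(1)] by blast
    have "T j \<subseteq> tight ?V y" unfolding tV using j(1) by blast
    then have pT: "p \<in> tight ?V y" and qT: "q \<in> tight ?V y" using pq(1) by auto
    note int_span_base[OF finV pT] int_span_base[OF finV qT]
    moreover have "x \<in> {p, - p, q, - q, p - q, q - p}" using pq(2) i k j by auto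
    ultimately show "x \<in> int_span (tight ?V y)"
      by (auto intro: int_span_minus int_span_diff)
  qed
  moreover have "tight ?V y \<subseteq> lattice" by (rule order_trans[OF tight_subset lat])
  ultimately show "lattice_basis (tight ?V y)"
    by (intro lattice_basis_int_spanI[OF finV _ _ lattice_basis_unit_vec])
qed

lemma lattice_isomorphic_hexagon_sum:
  fixes V :: "(real ^ 'm) set" and e :: "nat \<Rightarrow> 'm"
  assumes V: "fano_set V" and c: "card V = 3 * CARD('m)" and S0: "\<Sum>V = 0"
    and e: "bij_betw e {..<CARD('m)} UNIV"
  shows "even CARD('m)" "lattice_isomorphic (convex hull V) (hexagon_sum e)"
proof -
  let ?d = "CARD('m)"
  obtain u where u: "facet_normal V u" using facet_normal_exists[OF fano_setD(1,4)[OF V]] by blast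
  let ?B = "tight V u"
  note B = fano_setD(5)[OF V u]
  note BD = lattice_basisD[OF B]
  obtain \<sigma> where s: "\<And>b. b \<in> ?B \<Longrightarrow> \<sigma> b \<in> ?B \<and> \<sigma> b \<noteq> b \<and> \<sigma> (\<sigma> b) = b"
    and VB: "V = ?B \<union> uminus ` ?B \<union> (\<lambda>b. \<sigma> b - b) ` ?B"
    using extremal_involution[OF V u S0 c] by blast
  obtain n :: nat and h where h: "bij_betw h {..<2 * n} ?B"
    and \<sigma>h: "\<And>j. j < n \<Longrightarrow> \<sigma> (h (2 * j)) = h (2 * j + 1)"
    using involution_pairing[OF BD(3), of \<sigma>] s by blast
  have d: "?d = 2 * n" using bij_betw_same_card[OF h] BD(5) by simp
  then show ev: "even ?d" by simp
  have hB: "h i \<in> ?B" if "i < 2 * n" for i using h that by (auto simp: bij_betw_def)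
  have \<sigma>h': "\<sigma> (h (2 * j + 1)) = h (2 * j)" if "j < n" for j
    using \<sigma>h[OF that] s[OF hB[of "2 * j"]] that by simp
  \<comment> \<open>The sign at odd positions is needed because the third pair of opposite vertices
    consists of differences \<open>\<sigma> b - b\<close> in \<open>V\<close>, but of sums of unit
    vectors in \<open>hexagon_points\<close>.\<close>
  define g where "g = (\<lambda>b. let i = inv_into {..<2 * n} h b in
    if even i then unit_vec (e i) else - unit_vec (e i) :: real ^ 'm)"
  have gh: "g (h (2 * j)) = unit_vec (e (2 * j))" "g (h (2 * j + 1)) = - unit_vec (e (2 * j + 1))" if "j < n" for j
  proof -
    have "inv_into {..<2 * n} h (h i) = i" if "i < 2 * n" for i
      using h that by (auto simp: bij_betw_def)
    then show "g (h (2 * j)) = unit_vec (e (2 * j))" "g (h (2 * j + 1)) = - unit_vec (e (2 * j + 1))"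
      using that by (auto simp: g_def Let_def)
  qed
  have Bcase: "\<exists>j<n. b = h (2 * j) \<or> b = h (2 * j + 1)" if b: "b \<in> ?B" for b
  proof -
    obtain i where i: "i < 2 * n" "b = h i" using h b by (auto simp: bij_betw_def)
    obtain j where "j < 2 * n div 2" "i = 2 * j \<or> i = 2 * j + 1" using even_index[OF _ i(1)] by auto
    then show ?thesis using i by auto
  qed
  have "lattice_basis (g ` ?B)"
  proof (rule lattice_basis_int_spanI[OF _ _ _ lattice_basis_unit_vec])
    show fin: "finite (g ` ?B)" using BD(3) by simp
    show "card (g ` ?B) \<le> ?d" using card_image_le[OF BD(3), of g] BD(5) by simp
    show "g ` ?B \<subseteq> lattice" by (auto simp: g_def Let_def intro: lattice_minus)
    show "range unit_vec \<subseteq> int_span (g ` ?B)"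
    proof
      fix x :: "real ^ 'm" assume "x \<in> range unit_vec"
      then obtain i where i: "x = unit_vec i" by blast
      obtain k where k: "k < ?d" "i = e k" using e by (auto simp: bij_betw_def)
      obtain j where j: "j < ?d div 2" "k = 2 * j \<or> k = 2 * j + 1" using even_index[OF ev k(1)] .
      then have jn: "j < n" using d by simp
      have "g (h (2 * j)) \<in> int_span (g ` ?B)" "g (h (2 * j + 1)) \<in> int_span (g ` ?B)"
        using jn by (auto intro!: int_span_base[OF fin] imageI hB)
      then show "x \<in> int_span (g ` ?B)"
        using gh[OF jn] j(2) i k int_span_minus[of "- unit_vec (e (2 * j + 1))"] by auto
    qed
  qed
  then obtain f where f: "f \<in> lattice_transformations" "\<forall>b\<in>?B. f b = g b"
    using lattice_basis_linear_extend[OF B] by blast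
  have lin: "linear f" using f unfolding lattice_transformations_eq by auto
  have fh: "f (h (2 * j)) = unit_vec (e (2 * j))" "f (h (2 * j + 1)) = - unit_vec (e (2 * j + 1))" if "j < n" for j
    using gh[OF that] f(2) hB[of "2 * j"] hB[of "2 * j + 1"] that by auto
  define W where "W = (\<lambda>j. {h (2 * j), h (2 * j + 1), - h (2 * j), - h (2 * j + 1),
     h (2 * j + 1) - h (2 * j), h (2 * j) - h (2 * j + 1)})"
  have "V = (\<Union>j<n. W j)"
  proof (intro equalityI subsetI)
    fix v assume "v \<in> V"
    then obtain b where b: "b \<in> ?B" "v = b \<or> v = - b \<or> v = \<sigma> b - b" using VB by auto
    obtain j where j: "j < n" "b = h (2 * j) \<or> b = h (2 * j + 1)" using Bcase[OF b(1)] by blast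
    then have "v \<in> W j" using b(2) \<sigma>h[OF j(1)] \<sigma>h'[OF j(1)] by (auto simp: W_def)
    then show "v \<in> (\<Union>j<n. W j)" using j by blast
  next
    fix v assume "v \<in> (\<Union>j<n. W j)"
    then obtain j where j: "j < n" "v \<in> W j" by blast
    have hh: "h (2 * j) \<in> ?B" "h (2 * j + 1) \<in> ?B" using hB j by auto
    have "v \<in> ?B \<union> uminus ` ?B \<union> (\<lambda>b. \<sigma> b - b) ` ?B"
      using j(2) hh \<sigma>h[OF j(1)] \<sigma>h'[OF j(1)] unfolding W_def
      by (metis (no_types, lifting) Un_iff empty_iff image_eqI insert_iff)
    then show "v \<in> V" using VB by blast
  qed
  moreover have "f ` W j = hexagon_points e j" if j: "j < n" for j
    using fh[OF j] by (auto simp: W_def hexagon_points_def Let_def linear_neg[OF lin] linear_diff[OF lin])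
  ultimately have "f ` V = (\<Union>j<?d div 2. hexagon_points e j)"
    using d by (simp add: image_UN)
  then have "f ` (convex hull V) = hexagon_sum e"
    by (simp add: hexagon_sum_eq convex_hull_linear_image[OF lin])
  then show "lattice_isomorphic (convex hull V) (hexagon_sum e)"
    unfolding lattice_isomorphic_def using f(1) by blast
qed

section \<open>Normalized volume of circuits\<close>

text \<open>The change of variables formula for linear maps on \<open>real ^ 'm\<close> requires the index type to
  be well-ordered. The copy \<open>'a wo\<close> of a finite type carries an arbitrary such order.\<close>

typedef 'a wo = "UNIV :: 'a set" by auto

lemma bij_Rep_wo: "bij Rep_wo"
  unfolding bij_def inj_def surj_def using Rep_wo_inject Abs_wo_inverse by (metis UNIV_I)

instance wo :: (finite) finite
proof
  show "finite (UNIV :: 'a wo set)"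
    using bij_Rep_wo bij_betw_finite by (metis finite_class.finite_UNIV)
qed

lemma card_wo: "CARD('a wo) = CARD('a)"
  by (rule bij_betw_same_card[OF bij_Rep_wo])

definition wo_index :: "'a::finite wo \<Rightarrow> nat" where
  "wo_index = (SOME f. inj f)"

lemma inj_wo_index: "inj (wo_index :: 'a::finite wo \<Rightarrow> nat)"
proof -
  have "\<exists>f :: 'a wo \<Rightarrow> nat. inj f"
    using finite_imp_inj_to_nat_seg[OF finite_class.finite_UNIV[where 'a = "'a wo"]] by blast
  then show ?thesis unfolding wo_index_def by (rule someI_ex)
qed

instantiation wo :: (finite) wellorder
begin

definition less_eq_wo :: "'a wo \<Rightarrow> 'a wo \<Rightarrow> bool" where "less_eq_wo x y \<longleftrightarrow> wo_index x \<le> wo_index y"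
definition less_wo :: "'a wo \<Rightarrow> 'a wo \<Rightarrow> bool" where "less_wo x y \<longleftrightarrow> wo_index x < wo_index y"

instance
proof
  fix P :: "'a wo \<Rightarrow> bool" and a :: "'a wo"
  assume step: "\<And>x. (\<And>y. y < x \<Longrightarrow> P y) \<Longrightarrow> P x"
  show "P a"
  proof (induction "wo_index a" arbitrary: a rule: less_induct)
    case less
    show ?case by (rule step, rule less) (simp add: less_wo_def)
  qed
qed (auto simp: less_eq_wo_def less_wo_def dest: injD[OF inj_wo_index])

end

text \<open>Connects the product measure in \<open>normalized_volume\<close> with Lebesgue measure
  on vectors: both assign the product of the side lengths to a box.\<close>

lemma lborel_eq_PiM_lessThan:
  fixes e :: "nat \<Rightarrow> 'w::finite"
  assumes e: "bij_betw e {..<n} UNIV"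
  shows "lborel = distr (PiM {..<n} (\<lambda>_. lborel)) borel (\<lambda>f. \<Sum>i<n. f i *\<^sub>R axis (e i) (1::real))"
proof (rule lborel_eqI)
  let ?N = "PiM {..<n} (\<lambda>_. lborel :: real measure)"
  let ?\<phi> = "\<lambda>f. \<Sum>i<n. f i *\<^sub>R axis (e i) (1::real)"
  interpret product_sigma_finite "\<lambda>_. lborel :: real measure" by standard
  have m: "?\<phi> \<in> borel_measurable ?N" by measurable
  have nth: "?\<phi> f $ e k = f k" if "k < n" for f k
  proof -
    have eq: "e k = e i \<longleftrightarrow> i = k" if "i < n" for i
      using e that \<open>k < n\<close> by (auto simp: bij_betw_def inj_on_eq_iff)
    have "?\<phi> f $ e k = (\<Sum>i<n. f i * axis (e i) 1 $ e k)" by (simp del: sum.lessThan_Suc)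
    also have "\<dots> = (\<Sum>i<n. if i = k then f i else 0)"
      by (rule sum.cong) (auto simp: axis_def eq)
    finally show ?thesis using that by simp
  qed
  have all: "(\<forall>j. Q j) \<longleftrightarrow> (\<forall>k<n. Q (e k))" for Q :: "'w \<Rightarrow> bool"
    using e by (auto simp: bij_betw_def) (metis UNIV_I imageE lessThan_iff)
  fix l u :: "real ^ 'w"
  assume lu: "\<And>b. b \<in> Basis \<Longrightarrow> l \<bullet> b \<le> u \<bullet> b"
  have le: "l $ j \<le> u $ j" for j
    using lu[of "axis j 1"] by (simp add: inner_axis)
  have "emeasure (distr ?N borel ?\<phi>) (box l u) = emeasure ?N (?\<phi> -` box l u \<inter> space ?N)"
    by (rule emeasure_distr[OF m]) simp
  also have "?\<phi> -` box l u \<inter> space ?N = PiE {..<n} (\<lambda>i. {l $ e i<..<u $ e i})"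
  proof (intro set_eqI iffI)
    fix f assume "f \<in> ?\<phi> -` box l u \<inter> space ?N"
    then show "f \<in> PiE {..<n} (\<lambda>i. {l $ e i<..<u $ e i})"
      by (auto simp: mem_box_cart all nth space_PiM PiE_iff simp del: sum_component)
  next
    fix f assume "f \<in> PiE {..<n} (\<lambda>i. {l $ e i<..<u $ e i})"
    then show "f \<in> ?\<phi> -` box l u \<inter> space ?N"
      by (auto simp: mem_box_cart all nth space_PiM PiE_iff simp del: sum_component)
  qed
  also have "emeasure ?N (PiE {..<n} (\<lambda>i. {l $ e i<..<u $ e i})) = (\<Prod>i<n. ennreal (u $ e i - l $ e i))"
    by (subst emeasure_PiM) (auto simp: le)
  also have "\<dots> = (\<Prod>j\<in>UNIV. ennreal (u $ j - l $ j))"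
    by (rule prod.reindex_bij_betw[OF e])
  also have "\<dots> = ennreal (\<Prod>j\<in>UNIV. u $ j - l $ j)"
    by (rule prod_ennreal) (simp add: le)
  also have "(\<Prod>j\<in>UNIV. u $ j - l $ j) = (\<Prod>b\<in>Basis. (u - l) \<bullet> b)"
  proof -
    have B: "(Basis :: (real ^ 'w) set) = (\<lambda>j. axis j 1) ` UNIV" by (auto simp: Basis_vec_def)
    have "(\<Prod>b\<in>Basis. (u - l) \<bullet> b) = (\<Prod>j\<in>UNIV. (u - l) \<bullet> axis j 1)"
      unfolding B by (subst prod.reindex) (auto simp: inj_on_def axis_eq_axis)
    then show ?thesis by (simp add: inner_axis)
  qed
  finally show "emeasure (distr ?N borel ?\<phi>) (box l u) = ennreal (\<Prod>b\<in>Basis. (u - l) \<bullet> b)" .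
qed simp

text \<open>By Fubini the last coordinate, which runs through the unit interval, contributes a
  factor 1. This makes the base of dimension \<open>r\<close> accessible to the change of variables
  formula in dimension \<open>Suc r\<close>.\<close>

lemma
  fixes e :: "nat \<Rightarrow> 'w::finite"
  assumes e: "bij_betw e {..<Suc r} UNIV" and A: "A \<in> sets (PiM {..<r} (\<lambda>_. lborel :: real measure))"
  defines "C \<equiv> {x :: real ^ 'w. restrict (\<lambda>i. x $ e i) {..<r} \<in> A \<and> 0 \<le> x $ e r \<and> x $ e r \<le> 1}"
  shows sets_prism: "C \<in> sets borel"
    and emeasure_prism: "emeasure lborel C = emeasure (PiM {..<r} (\<lambda>_. lborel)) A"
proof -
  let ?M = "PiM {..<r} (\<lambda>_. lborel :: real measure)"
  let ?N = "PiM {..<Suc r} (\<lambda>_. lborel :: real measure)"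
  let ?\<phi> = "\<lambda>f. \<Sum>i<Suc r. f i *\<^sub>R axis (e i) (1::real)"
  interpret product_sigma_finite "\<lambda>_. lborel :: real measure" by standard
  have mR: "(\<lambda>x :: real ^ 'w. restrict (\<lambda>i. x $ e i) {..<r}) \<in> measurable borel ?M"
    by (rule measurable_restrict) measurable
  have m0: "(\<lambda>x :: real ^ 'w. x $ e r) \<in> borel_measurable borel" by measurable
  have "C = ((\<lambda>x. restrict (\<lambda>i. x $ e i) {..<r}) -` A \<inter> space borel) \<inter> ((\<lambda>x. x $ e r) -` {0..1} \<inter> space borel)"
    by (auto simp: C_def)
  then show C: "C \<in> sets borel"
    using measurable_sets[OF mR A] measurable_sets[OF m0, of "{0..1}"] by auto
  have m: "?\<phi> \<in> borel_measurable ?N" by measurable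
  have nth: "?\<phi> f $ e k = f k" if "k < Suc r" for f k
  proof -
    have eq: "e k = e i \<longleftrightarrow> i = k" if "i < Suc r" for i
      using e that \<open>k < Suc r\<close> by (auto simp: bij_betw_def inj_on_eq_iff)
    have "?\<phi> f $ e k = (\<Sum>i<Suc r. f i * axis (e i) 1 $ e k)" by (simp del: sum.lessThan_Suc)
    also have "\<dots> = (\<Sum>i<Suc r. if i = k then f i else 0)"
      by (rule sum.cong) (auto simp: axis_def eq)
    finally show ?thesis using that by simp
  qed
  have AM: "A \<subseteq> space ?M" using sets.sets_into_space[OF A] .
  have pre: "?\<phi> -` C \<inter> space ?N = {f \<in> space ?N. restrict f {..<r} \<in> A \<and> f r \<in> {0..1}}" (is "_ = ?D")
  proof -
    have "restrict (\<lambda>i. ?\<phi> f $ e i) {..<r} = restrict f {..<r}" for f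
      by (rule restrict_ext) (rule nth, simp)
    then show ?thesis using nth[of r] unfolding C_def by auto
  qed
  have D: "?D \<in> sets ?N"
    unfolding pre[symmetric] using C by (intro measurable_sets[OF m]) simp
  have "emeasure lborel C = emeasure (distr ?N borel ?\<phi>) C"
    by (simp only: lborel_eq_PiM_lessThan[OF e, symmetric])
  also have "\<dots> = emeasure ?N ?D"
    unfolding pre[symmetric] by (rule emeasure_distr[OF m C])
  also have "\<dots> = (\<integral>\<^sup>+ f. indicator ?D f \<partial>?N)" using D by simp
  also have "\<dots> = (\<integral>\<^sup>+ y. \<integral>\<^sup>+ x. indicator ?D (x(r := y)) \<partial>?M \<partial>lborel)"
    using D by (simp only: lessThan_Suc, subst product_nn_integral_insert_rev) auto
  also have "\<dots> = (\<integral>\<^sup>+ y. \<integral>\<^sup>+ x. indicator {0..1} (y::real) * indicator A x \<partial>?M \<partial>lborel)"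
  proof (intro nn_integral_cong)
    fix y :: real and x assume x: "x \<in> space ?M"
    have "restrict (x(r := y)) {..<r} = x"
      using x by (auto simp: space_PiM PiE_iff extensional_def restrict_def fun_eq_iff)
    moreover have "x(r := y) \<in> space ?N"
      using x by (auto simp: space_PiM PiE_iff extensional_def)
    ultimately show "indicator ?D (x(r := y)) = (indicator {0..1} y * indicator A x :: ennreal)"
      by (auto simp: indicator_def)
  qed
  also have "\<dots> = (\<integral>\<^sup>+ y. indicator {0..1} (y::real) * emeasure ?M A \<partial>lborel)"
    using A by (intro nn_integral_cong) (simp add: nn_integral_cmult)
  also have "\<dots> = emeasure ?M A" by (simp add: nn_integral_multc)
  finally show "emeasure lborel C = emeasure ?M A" .
qed

section \<open>Integral determinants\<close>

lemma det_int:
  fixes A :: "real ^ 'w ^ 'w"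
  assumes "\<And>i j. A $ i $ j \<in> \<int>"
  shows "det A \<in> \<int>"
  unfolding det_def using assms by (intro Ints_sum Ints_mult Ints_prod) auto

lemma matrix_int_lattice:
  fixes f :: "real ^ 'w \<Rightarrow> real ^ 'w"
  assumes "\<And>i. f (unit_vec i) \<in> lattice"
  shows "matrix f $ i $ j \<in> \<int>"
  using assms[of j] by (simp add: matrix_def lattice_def unit_vec_def)

text \<open>If the inverse is integral too, the two integral determinants have product 1.
  Conversely, Cramer's rule divides by 1 or -1 only, so preimages of lattice points are lattice
  points.\<close>

lemma det_lattice_transformation:
  fixes f :: "real ^ 'w \<Rightarrow> real ^ 'w"
  assumes "linear f" "\<And>i. f (unit_vec i) \<in> lattice"
  shows "f \<in> lattice_transformations \<longleftrightarrow> \<bar>det (matrix f)\<bar> = 1"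
proof
  assume f: "f \<in> lattice_transformations"
  note g = lattice_transformation_inv[OF f]
  have lin: "linear (inv f)" "inv f ` lattice = lattice"
    using g(1) unfolding lattice_transformations_eq by auto
  have "f \<circ> inv f = id" using g(2) by auto
  then have "matrix f ** matrix (inv f) = mat 1"
    using matrix_compose[OF lin(1) assms(1)] by (simp add: matrix_id_mat_1)
  then have "det (matrix f) * det (matrix (inv f)) = 1" by (metis det_I det_mul)
  moreover have "inv f (unit_vec i) \<in> lattice" for i using lin(2) by auto
  then have "det (matrix (inv f)) \<in> \<int>" by (intro det_int matrix_int_lattice)
  moreover have "det (matrix f) \<in> \<int>" using assms(2) by (intro det_int matrix_int_lattice)
  ultimately obtain i j :: int where "det (matrix f) = of_int i" "real_of_int (i * j) = 1"
    by (auto elim!: Ints_cases)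
  then have "\<bar>i\<bar> = 1" by (metis abs_zmult_eq_1 of_int_eq_1_iff abs_1)
  then show "\<bar>det (matrix f)\<bar> = 1" using \<open>det (matrix f) = of_int i\<close> by (metis of_int_1 of_int_abs)
next
  assume d: "\<bar>det (matrix f)\<bar> = 1"
  then have d0: "det (matrix f) \<noteq> 0" by auto
  have bij: "bij f"
    using d0 det_nz_iff_inj[OF assms(1)] linear_injective_imp_surjective[OF assms(1)] by (auto simp: bij_def)
  have fv: "f x = matrix f *v x" for x by (simp add: assms(1))
  have "f x \<in> lattice" if x: "x \<in> lattice" for x
  proof -
    have "f x = (\<Sum>i\<in>UNIV. (x $ i) *\<^sub>R f (unit_vec i))"
      by (subst vec_eq_sum_unit_vec) (simp add: linear_sum[OF assms(1)] linear_scale[OF assms(1)])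
    then show ?thesis using x assms(2) by (auto simp: lattice_def[of] intro!: lattice_sum lattice_scale)
  qed
  moreover have "x \<in> f ` lattice" if x: "x \<in> lattice" for x
  proof -
    obtain w where w: "f w = x" using bij by (metis bij_pointE)
    have "w = (\<chi> k. det (\<chi> i j. if j = k then x $ i else matrix f $ i $ j) / det (matrix f))"
      using cramer[OF d0, of w x] w fv by simp
    moreover have "det (\<chi> i j. if j = k then x $ i else matrix f $ i $ j) / det (matrix f) \<in> \<int>" for k
    proof -
      have "det (\<chi> i j. if j = k then x $ i else matrix f $ i $ j) \<in> \<int>"
        using x matrix_int_lattice[of f, OF assms(2)] by (intro det_int) (auto simp: lattice_def)
      moreover have "det (matrix f) = 1 \<or> det (matrix f) = -1" using d by linarith
      ultimately show ?thesis by auto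
    qed
    ultimately have "w \<in> lattice" by (simp add: lattice_def)
    then show ?thesis using w by blast
  qed
  ultimately show "f \<in> lattice_transformations"
    using assms(1) bij unfolding lattice_transformations_eq by blast
qed

text \<open>A spanning set of lattice points at height 1 whose determinant is minimal is a lattice basis:
  otherwise some lattice point has a fractional coordinate, and exchanging it, after a translation
  inside the hyperplane, lowers the determinant.\<close>

lemma lattice_basis_in_hyperplane:
  fixes y :: "real ^ 'n" and u0 :: "'n \<Rightarrow> real ^ 'n"
  assumes y: "y \<in> lattice" and u0: "\<And>j. u0 j \<in> lattice" "\<And>j. y \<bullet> u0 j = 1"
    and d0: "det (\<chi> i j. u0 j $ i) \<noteq> 0"
  shows "\<exists>U. lattice_basis U \<and> (\<forall>x\<in>U. y \<bullet> x = 1)"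
proof -
  define Q where "Q = (\<lambda>u :: 'n \<Rightarrow> real ^ 'n. (\<forall>j. u j \<in> lattice \<and> y \<bullet> u j = 1) \<and> det (\<chi> i j. u j $ i) \<noteq> 0)"
  define N where "N = (\<lambda>u :: 'n \<Rightarrow> real ^ 'n. nat \<lfloor>\<bar>det (\<chi> i j. u j $ i)\<bar>\<rfloor>)"
  have "Q u0" using u0 d0 by (auto simp: Q_def)
  then obtain u where u: "Q u" and min: "\<And>u'. Q u' \<Longrightarrow> N u \<le> N u'"
    using ex_has_least_nat[of Q u0 N] by blast
  let ?A = "(\<chi> i j. u j $ i) :: real ^ 'n ^ 'n"
  have ul: "u j \<in> lattice" "y \<bullet> u j = 1" for j using u by (auto simp: Q_def)
  have dA: "det ?A \<noteq> 0" using u by (auto simp: Q_def)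
  have Av: "?A *v x = (\<Sum>j\<in>UNIV. x $ j *\<^sub>R u j)" for x
    by (simp add: vec_eq_iff matrix_vector_mult_def mult.commute)
  have NR: "real (N u) = \<bar>det (\<chi> i j. u j $ i)\<bar>" if "\<And>j. u j \<in> lattice" for u :: "'n \<Rightarrow> real ^ 'n"
  proof -
    have "det (\<chi> i j. u j $ i) \<in> \<int>" using that by (intro det_int) (auto simp: lattice_def)
    then show ?thesis by (auto simp: N_def elim!: Ints_cases simp flip: of_int_abs)
  qed
  have coord: "\<exists>w. x = ?A *v w \<and> w \<in> lattice" if x: "x \<in> lattice" for x
  proof -
    have "invertible ?A" using dA by (simp add: invertible_det_nz)
    then obtain w where w: "?A *v w = x"
      by (metis invertible_def matrix_vector_mul_assoc matrix_vector_mul_lid)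
    have hw: "(\<Sum>j\<in>UNIV. w $ j) = y \<bullet> x"
      unfolding w[symmetric] Av by (simp add: inner_sum_right ul)
    have hx: "y \<bullet> x \<in> \<int>" using y x by (rule lattice_inner)
    have "w $ k \<in> \<int>" for k
    proof (rule ccontr)
      assume nk: "w $ k \<notin> \<int>"
      \<comment> \<open>If \<open>k\<close> were the only index, its coordinate would be the
        integral height of \<open>x\<close>.\<close>
      have "\<exists>j. j \<noteq> k"
      proof (rule ccontr)
        assume "\<not> ?thesis"
        then have U: "UNIV = {k}" by auto
        have "(\<Sum>j\<in>UNIV. w $ j) = (\<Sum>j\<in>{k}. w $ j)" by (rule arg_cong[OF U])
        then have "(\<Sum>j\<in>UNIV. w $ j) = w $ k" by simp
        then have "w $ k = y \<bullet> x" using hw by simp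
        then show False using hx nk by simp
      qed
      then obtain j where j: "j \<noteq> k" by blast
      \<comment> \<open>Once coordinate \<open>k\<close> is reduced to its fractional part, the
        multiple \<open>c\<close> of \<open>u j\<close> brings the point back to height 1 without
        touching coordinate \<open>k\<close>.\<close>
      define c where "c = 1 - y \<bullet> x + of_int \<lfloor>w $ k\<rfloor>"
      define w' where "w' = w - of_int \<lfloor>w $ k\<rfloor> *\<^sub>R axis k 1 + c *\<^sub>R axis j 1"
      define x' where "x' = x - of_int \<lfloor>w $ k\<rfloor> *\<^sub>R u k + c *\<^sub>R u j"
      have Ax: "?A *v axis i 1 = u i" for i
        by (simp add: Av axis_def if_distrib[of "\<lambda>c. c *\<^sub>R _"] cong: if_cong)
      have x': "?A *v w' = x'"
        by (simp add: w'_def x'_def matrix_vector_right_distrib matrix_vector_mult_diff_distrib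
            matrix_vector_mult_scaleR Ax w)
      have w'k: "w' $ k = frac (w $ k)" using j by (simp add: w'_def frac_def axis_def)
      define u' where "u' = u(k := x')"
      have "(\<chi> i j. u' j $ i) = (\<chi> i j. if j = k then (?A *v w') $ i else ?A $ i $ j)"
        by (simp add: u'_def x' vec_eq_iff)
      then have du': "det (\<chi> i j. u' j $ i) = frac (w $ k) * det ?A"
        using cramer_lemma[of k ?A w'] w'k by simp
      have ci: "c \<in> \<int>" using hx by (simp add: c_def)
      have u'l: "u' i \<in> lattice" for i
        using x ul ci by (auto simp: u'_def x'_def intro!: lattice_add lattice_diff lattice_scale)
      have "y \<bullet> u' i = 1" for i
        by (simp add: u'_def x'_def inner_add_right inner_diff_right ul c_def)
      moreover have fr: "frac (w $ k) > 0" "frac (w $ k) < 1" using nk by (auto simp: frac_lt_1)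
      ultimately have "Q u'" using u'l du' dA by (auto simp: Q_def)
      then have "real (N u) \<le> real (N u')" using min by simp
      then have "\<bar>det ?A\<bar> \<le> frac (w $ k) * \<bar>det ?A\<bar>"
        using NR[of u] NR[of u'] ul(1) u'l du' fr by (simp add: abs_mult)
      then show False using fr dA by (simp add: mult_le_cancel_right2)
    qed
    then show ?thesis using w by (intro exI[of _ w]) (auto simp: lattice_def)
  qed
  have "lattice_basis (range u)"
  proof (rule lattice_basis_int_spanI[OF _ _ _ lattice_basis_unit_vec])
    show "card (range u) \<le> CARD('n)" by (rule card_image_le) simp
    show "range u \<subseteq> lattice" using ul by auto
    show "range unit_vec \<subseteq> int_span (range u)"
    proof
      fix x :: "real ^ 'n" assume "x \<in> range unit_vec"
      then obtain w where w: "x = ?A *v w" "w \<in> lattice" using coord[of x] by auto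
      have "w $ j *\<^sub>R u j \<in> int_span (range u)" for j
      proof -
        obtain i :: int where "w $ j = of_int i" using w(2) by (auto simp: lattice_def elim: Ints_cases)
        then show ?thesis by (simp add: int_span_scale int_span_base)
      qed
      then show "x \<in> int_span (range u)" unfolding w(1) Av by (intro int_span_sum)
    qed
  qed simp
  then show ?thesis using ul by blast
qed

text \<open>In the coordinates of the lattice basis \<open>b\<close>, \<open>p\<close>, a polytope in the hyperplane at height 1
  becomes the base of a prism of height 1 in the full space, so that its relative volume is
  an ordinary Lebesgue measure.\<close>

locale frame_coords =
  fixes y p :: "real ^ 'n" and b :: "nat \<Rightarrow> real ^ 'n" and r :: nat and e :: "nat \<Rightarrow> 'n wo"
  assumes card: "CARD('n) = Suc r" and inj_b: "inj_on b {..<r}"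
    and basis: "lattice_basis (insert p (b ` {..<r}))"
    and yp: "y \<bullet> p = 1" and yb: "\<And>i. i < r \<Longrightarrow> y \<bullet> b i = 0"
    and e: "bij_betw e {..<Suc r} UNIV"
begin

definition L :: "real ^ 'n wo \<Rightarrow> real ^ 'n" where
  "L x = (\<Sum>i<r. (x $ e i) *\<^sub>R b i) + (x $ e r) *\<^sub>R p"

definition Prism :: "(real ^ 'n) set \<Rightarrow> (real ^ 'n wo) set" where
  "Prism G = {x. p + (\<Sum>i<r. (x $ e i) *\<^sub>R b i) \<in> G \<and> 0 \<le> x $ e r \<and> x $ e r \<le> 1}"

text \<open>The prism of height 1 over the standard simplex, the model whose volume is
  \<open>1 / fact r\<close>.\<close>

definition Q :: "(real ^ 'n wo) set" where
  "Q = {x. (\<forall>i<r. 0 \<le> x $ e i) \<and> (\<Sum>i<r. x $ e i) \<le> 1 \<and> 0 \<le> x $ e r \<and> x $ e r \<le> 1}"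

lemma e_eq: "i < Suc r \<Longrightarrow> k < Suc r \<Longrightarrow> e i = e k \<longleftrightarrow> i = k"
  using e by (auto simp: bij_betw_def inj_on_eq_iff)

lemma e_all: "(\<forall>j. R j) \<longleftrightarrow> (\<forall>k<Suc r. R (e k))" for R :: "'n wo \<Rightarrow> bool"
  using e by (auto simp: bij_betw_def) (metis UNIV_I imageE lessThan_iff)

lemma e_cases: obtains k where "k < Suc r" "j = e k"
  using e by (auto simp: bij_betw_def)

lemma range_unit_vec: "range unit_vec = insert (unit_vec (e r)) ((\<lambda>i. unit_vec (e i)) ` {..<r})"
proof -
  have "range unit_vec = unit_vec ` e ` {..<Suc r}" using e by (simp add: bij_betw_def)
  then show ?thesis by (simp add: lessThan_Suc image_image)
qed

lemma linear_L: "linear L"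
  by (rule linearI) (simp_all add: L_def algebra_simps sum.distrib scaleR_sum_right)

lemma L_unit: "i < r \<Longrightarrow> L (unit_vec (e i)) = b i" "L (unit_vec (e r)) = p"
proof -
  have "(\<Sum>i<r. (unit_vec (e k) $ e i) *\<^sub>R b i) = (\<Sum>i<r. if i = k then b i else 0)" if "k < Suc r" for k
    by (rule sum.cong) (use that e_eq in \<open>auto simp: unit_vec_nth\<close>)
  then show "i < r \<Longrightarrow> L (unit_vec (e i)) = b i" "L (unit_vec (e r)) = p"
    by (auto simp: L_def unit_vec_nth e_eq)
qed

lemma bij_L: "bij L" and L_lattice: "L ` lattice = lattice"
proof -
  have "L ` range unit_vec = insert p (b ` {..<r})"
    using L_unit by (simp add: image_image range_unit_vec)
  then have l: "lattice_basis (L ` range unit_vec)" using basis by simp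
  show "bij L" "L ` lattice = lattice"
    using lattice_basis_map_bij[OF linear_L lattice_basis_unit_vec l card_wo] by auto
qed

definition K :: "real ^ 'n \<Rightarrow> real ^ 'n wo" where "K = inv L"

lemma LK: "L (K x) = x" and KL: "K (L x') = x'"
  using surj_f_inv_f[OF bij_is_surj[OF bij_L]] inv_f_f[OF bij_is_inj[OF bij_L]] by (auto simp: K_def)

lemma linear_K: "linear K"
proof (rule linearI)
  fix v w :: "real ^ 'n" and c :: real
  have "K (L (K v + K w)) = K (v + w)" by (simp add: linear_add[OF linear_L] LK)
  then show "K (v + w) = K v + K w" by (simp add: KL)
  have "K (L (c *\<^sub>R K v)) = K (c *\<^sub>R v)" by (simp add: linear_scale[OF linear_L] LK)
  then show "K (c *\<^sub>R v) = c *\<^sub>R K v" by (simp add: KL)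
qed

lemma K_lattice: "K ` lattice = lattice"
  using image_inverse[of K L lattice] KL L_lattice by simp

lemma L_inj: "L x = L x' \<Longrightarrow> x = x'" using KL by metis

lemma L_height: "y \<bullet> L x = x $ e r"
  by (simp add: L_def inner_add_right inner_sum_right yp yb)

lemma p_plus: "p + (\<Sum>i<r. (x $ e i) *\<^sub>R b i) = L x - (x $ e r) *\<^sub>R p + p"
  by (simp add: L_def)

lemma Prism_measure:
  assumes "closed G"
  shows "measure (PiM {..<r} (\<lambda>_. lborel)) {t \<in> space (PiM {..<r} (\<lambda>_. lborel)). p + (\<Sum>i<r. t i *\<^sub>R b i) \<in> G}
    = measure lebesgue (Prism G)"
proof -
  let ?M = "PiM {..<r} (\<lambda>_. lborel :: real measure)"
  let ?T = "{t \<in> space ?M. p + (\<Sum>i<r. t i *\<^sub>R b i) \<in> G}"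
  have m: "(\<lambda>t. p + (\<Sum>i<r. t i *\<^sub>R b i)) \<in> borel_measurable ?M" by measurable
  have "?T = (\<lambda>t. p + (\<Sum>i<r. t i *\<^sub>R b i)) -` G \<inter> space ?M" by auto
  then have T: "?T \<in> sets ?M" using measurable_sets[OF m, of G] assms by simp
  have "Prism G = {x. restrict (\<lambda>i. x $ e i) {..<r} \<in> ?T \<and> 0 \<le> x $ e r \<and> x $ e r \<le> 1}"
    by (auto simp: Prism_def space_PiM)
  then have "emeasure lborel (Prism G) = emeasure ?M ?T" "Prism G \<in> sets borel"
    using emeasure_prism[OF e T] sets_prism[OF e T] by simp_all
  then show ?thesis by (simp add: measure_def)
qed

lemma Q_measure: "Q \<in> lmeasurable" "measure lebesgue Q = 1 / fact r"
proof -
  let ?M = "PiM {..<r} (\<lambda>_. lborel :: real measure)"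
  let ?A = "{t. (\<forall>i\<in>{..<r}. 0 \<le> t i) \<and> sum t {..<r} \<le> 1} \<inter> space ?M"
  have "?A = {t \<in> space ?M. (\<forall>i\<in>{..<r}. 0 \<le> t i) \<and> sum t {..<r} \<le> 1}" by auto
  also have "\<dots> \<in> sets ?M" by measurable
  finally have A: "?A \<in> sets ?M" .
  have QA: "Q = {x. restrict (\<lambda>i. x $ e i) {..<r} \<in> ?A \<and> 0 \<le> x $ e r \<and> x $ e r \<le> 1}"
    by (auto simp: Q_def space_PiM)
  have "emeasure ?M ?A = ennreal (1 / fact r)"
    using emeasure_std_simplex_aux[of "{..<r}" 1] by simp
  then have em: "emeasure lborel Q = ennreal (1 / fact r)" and Qb: "Q \<in> sets borel"
    using emeasure_prism[OF e A] sets_prism[OF e A] by (simp_all add: QA)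
  have em': "emeasure lebesgue Q = ennreal (1 / fact r)" using em Qb by simp
  then show "Q \<in> lmeasurable" using Qb by (intro fmeasurableI) auto
  show "measure lebesgue Q = 1 / fact r" using em' by (simp add: measure_def)
qed

context
  fixes U u
  assumes ind: "independent U" and Ul: "U \<subseteq> lattice" and yU: "\<And>x. x \<in> U \<Longrightarrow> y \<bullet> x = 1"
    and u: "bij_betw u {..<Suc r} U"
begin

text \<open>Linear part of the affine map that takes the model \<open>Q\<close> to the prism over
  the simplex with vertex set \<open>U\<close>: the edges of the model go to the edges at
  \<open>u r\<close>, and the direction of height is kept. The absolute value of its determinant is
  the normalized volume of the simplex.\<close>

definition F :: "real ^ 'n wo \<Rightarrow> real ^ 'n wo" where
  "F x = K ((\<Sum>i<r. (x $ e i) *\<^sub>R (u i - u r)) + (x $ e r) *\<^sub>R p)"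

lemma uU: "i < Suc r \<Longrightarrow> u i \<in> U" using u by (auto simp: bij_betw_def)

lemma linear_F: "linear F"
proof -
  have "linear (\<lambda>x :: real ^ 'n wo. (\<Sum>i<r. (x $ e i) *\<^sub>R (u i - u r)) + (x $ e r) *\<^sub>R p)"
    by (rule linearI) (simp_all add: algebra_simps sum.distrib scaleR_sum_right sum_subtractf)
  then show ?thesis using linear_compose[OF _ linear_K] by (auto simp: F_def[abs_def] o_def)
qed

lemma F_unit: "i < r \<Longrightarrow> F (unit_vec (e i)) = K (u i - u r)" "F (unit_vec (e r)) = K p"
proof -
  have "(\<Sum>i<r. (unit_vec (e k) $ e i) *\<^sub>R (u i - u r)) = (\<Sum>i<r. if i = k then u i - u r else 0)" if "k < Suc r" for k
    by (rule sum.cong) (use that e_eq in \<open>auto simp: unit_vec_nth\<close>)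
  then show "i < r \<Longrightarrow> F (unit_vec (e i)) = K (u i - u r)" "F (unit_vec (e r)) = K p"
    by (auto simp: F_def unit_vec_nth e_eq)
qed

lemma LF: "L (F x) = (\<Sum>i<r. (x $ e i) *\<^sub>R (u i - u r)) + (x $ e r) *\<^sub>R p"
  by (simp add: F_def LK)

lemma LF_height: "y \<bullet> L (F x) = x $ e r"
  using uU yU by (simp add: LF inner_add_right inner_sum_right inner_diff_right yp)

lemma u_sum: "(\<Sum>i<Suc r. f (u i)) = (\<Sum>x\<in>U. f x)" for f :: "_ \<Rightarrow> 'c::comm_monoid_add"
  by (rule sum.reindex_bij_betw[OF u])

text \<open>The barycentric coordinates other than that of \<open>u r\<close> are the coordinates in
  the model, and the height is carried along unchanged.\<close>

lemma Prism_simplex: "Prism (convex hull U) = (\<lambda>x. K (u r - p) + x) ` F ` Q"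
proof (intro equalityI subsetI)
  have finU: "finite U" using ind independent_imp_finite by blast
  {
    fix x assume x: "x \<in> Prism (convex hull U)"
    then obtain c where c: "\<forall>v\<in>U. 0 \<le> c v" "sum c U = 1" "(\<Sum>v\<in>U. c v *\<^sub>R v) = p + (\<Sum>i<r. (x $ e i) *\<^sub>R b i)"
      using finU by (auto simp: Prism_def convex_hull_finite)
    define e' where "e' = inv_into {..<Suc r} e"
    have e': "e' (e i) = i" if "i < Suc r" for i
      using e that by (auto simp: e'_def bij_betw_def)
    define q where "q = (\<chi> j. if j = e r then x $ e r else c (u (e' j)))"
    have qi: "q $ e i = c (u i)" if "i < r" for i using that e_eq[of i r] e'[of i] by (simp add: q_def)
    have qr: "q $ e r = x $ e r" by (simp add: q_def)
    have s1: "(\<Sum>i<r. c (u i)) + c (u r) = 1" using u_sum[of c] c(2) by simp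
    have s2: "(\<Sum>i<r. c (u i) *\<^sub>R u i) + c (u r) *\<^sub>R u r = L x - (x $ e r) *\<^sub>R p + p"
      using u_sum[of "\<lambda>v. c v *\<^sub>R v"] c(3) by (simp add: p_plus)
    have "c (u r) \<ge> 0" using c(1) uU[of r] by simp
    then have "(\<Sum>i<r. c (u i)) \<le> 1" using s1 by simp
    then have "q \<in> Q" using x c(1) uU qi qr by (auto simp: Q_def Prism_def)
    moreover have "x = K (u r - p) + F q"
    proof (rule L_inj)
      have "L (K (u r - p) + F q) = u r - p + ((\<Sum>i<r. c (u i) *\<^sub>R (u i - u r)) + (x $ e r) *\<^sub>R p)"
        by (simp add: linear_add[OF linear_L] LK LF qi qr)
      also have "(\<Sum>i<r. c (u i) *\<^sub>R (u i - u r)) = (\<Sum>i<r. c (u i) *\<^sub>R u i) - (\<Sum>i<r. c (u i)) *\<^sub>R u r"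
        by (simp add: scaleR_diff_right sum_subtractf scaleR_sum_left)
      also have "(\<Sum>i<r. c (u i)) = 1 - c (u r)" using s1 by simp
      also have "(\<Sum>i<r. c (u i) *\<^sub>R u i) = L x - (x $ e r) *\<^sub>R p + p - c (u r) *\<^sub>R u r"
        using s2 by (simp add: algebra_simps)
      finally show "L x = L (K (u r - p) + F q)" by (simp add: algebra_simps)
    qed
    ultimately show "x \<in> (\<lambda>x. K (u r - p) + x) ` F ` Q" by blast
  next
    fix x assume "x \<in> (\<lambda>x. K (u r - p) + x) ` F ` Q"
    then obtain q where q: "q \<in> Q" and x: "x = K (u r - p) + F q" by blast
    have Lx: "L x = u r - p + L (F q)" by (simp add: x linear_add[OF linear_L] LK)
    have "y \<bullet> L x = q $ e r" by (simp add: Lx inner_add_right inner_diff_right LF_height yp yU uU)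
    then have xr: "x $ e r = q $ e r" by (simp add: L_height)
    have "p + (\<Sum>i<r. (x $ e i) *\<^sub>R b i) = u r + (\<Sum>i<r. (q $ e i) *\<^sub>R (u i - u r))"
      by (simp add: p_plus Lx LF xr)
    also have "\<dots> = (\<Sum>i<r. (q $ e i) *\<^sub>R u i) + (1 - (\<Sum>i<r. q $ e i)) *\<^sub>R u r"
      by (simp add: algebra_simps sum_subtractf scaleR_sum_left)
    also have "\<dots> = (\<Sum>i<Suc r. (if i < r then q $ e i else 1 - (\<Sum>i<r. q $ e i)) *\<^sub>R u i)"
      by simp
    also have "\<dots> \<in> convex hull U"
      using q uU by (intro convex_sum) (auto simp: Q_def hull_inc)
    finally show "x \<in> Prism (convex hull U)" using q xr by (simp add: Prism_def Q_def)
  }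
qed

lemma inj_F: "inj F"
proof (rule linear_injective_0[OF linear_F, THEN iffD2], intro allI impI)
  fix x assume "F x = 0"
  then have z: "L (F x) = 0" using linear_0[OF linear_L] by simp
  then have xr: "x $ e r = 0" using LF_height[of x] by simp
  have s: "(\<Sum>i<r. (x $ e i) *\<^sub>R (u i - u r)) = 0" using z xr by (simp add: LF)
  have xi: "x $ e k = 0" if k: "k < r" for k
  proof -
    have inj: "u i = u k \<longleftrightarrow> i = k" if "i < Suc r" for i
      using u that k by (auto simp: bij_betw_def inj_on_eq_iff)
    have "dual_vec U (u k) \<bullet> (u i - u r) = (if i = k then 1 else 0)" if "i < r" for i
      using dual_vec[OF ind uU, of i "u k"] dual_vec[OF ind uU, of r "u k"] inj[of i] inj[of r] that k
      by (simp add: inner_diff_right)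
    then have "dual_vec U (u k) \<bullet> (\<Sum>i<r. (x $ e i) *\<^sub>R (u i - u r)) = (\<Sum>i<r. if i = k then x $ e i else 0)"
      unfolding inner_sum_right by (intro sum.cong) auto
    then show ?thesis using s k by simp
  qed
  have "\<forall>k<Suc r. x $ e k = 0" using xi xr by (simp add: less_Suc_eq)
  then show "x = 0" using e_all[of "\<lambda>j. x $ j = 0"] by (simp add: vec_eq_iff)
qed

lemma F_unit_lattice: "F (unit_vec j) \<in> lattice"
proof -
  obtain k where k: "k < Suc r" "j = e k" by (rule e_cases)
  have p: "p \<in> lattice" using basis by (auto simp: lattice_basis_def)
  have "K x \<in> lattice" if "x \<in> lattice" for x using K_lattice that by blast
  moreover have "u k - u r \<in> lattice" using Ul uU[OF k(1)] uU[of r] by (intro lattice_diff) auto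
  moreover have "k = r \<or> k < r" using k(1) by auto
  ultimately show ?thesis using k(2) F_unit p by auto
qed

lemma F_range: "L ` F ` range unit_vec = insert p ((\<lambda>i. u i - u r) ` {..<r})"
  using F_unit LK by (simp add: image_image range_unit_vec)

text \<open>Both properties say that \<open>p\<close> together with the edges at \<open>u r\<close>
  is a lattice basis. The points \<open>p\<close> and \<open>u r\<close> can be traded for each
  other, as they have equal height and so differ by an integral combination of edges.\<close>

lemma F_lattice_iff: "F \<in> lattice_transformations \<longleftrightarrow> lattice_basis U"
proof
  let ?W = "insert p ((\<lambda>i. u i - u r) ` {..<r})"
  have finU: "finite U" using ind independent_imp_finite by blast
  have cU: "card U = CARD('n)" using bij_betw_same_card[OF u] card by simp
  {
    assume F: "F \<in> lattice_transformations"
    have "lattice_basis (L ` F ` range unit_vec)"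
      by (intro lattice_basis_map[OF linear_L _ _ L_lattice] lattice_basis_image[OF F] lattice_basis_unit_vec
        inj_on_subset[OF bij_is_inj[OF bij_L]]) simp
    then have W: "lattice_basis ?W" by (simp only: F_range)
    have "p \<in> lattice" using W by (auto simp: lattice_basis_def)
    then have "p - u r \<in> lattice" using Ul uU by (intro lattice_diff) auto
    moreover have "F ` lattice = lattice" using F unfolding lattice_transformations_eq by blast
    ultimately obtain q where q: "q \<in> lattice" "p - u r = L (F q)" using L_lattice by (metis imageE)
    have "y \<bullet> (p - u r) = 0" by (simp add: inner_diff_right yp yU uU)
    then have "q $ e r = 0" using LF_height[of q] q(2) by simp
    then have p: "p = u r + (\<Sum>i<r. (q $ e i) *\<^sub>R (u i - u r))"
      using q(2) by (simp add: LF algebra_simps)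
    have ui: "u i \<in> int_span U" if "i < Suc r" for i using int_span_base[OF finU uU[OF that]] .
    have di: "(q $ e i) *\<^sub>R (u i - u r) \<in> int_span U" if "i < r" for i
    proof -
      obtain k :: int where "q $ e i = of_int k" using q(1) by (auto simp: lattice_def elim: Ints_cases)
      then show ?thesis using ui that by (auto intro!: int_span_scale int_span_diff)
    qed
    have "p \<in> int_span U" unfolding p using ui di by (intro int_span_add int_span_sum) auto
    then have "?W \<subseteq> int_span U" using ui by (auto intro!: int_span_diff)
    then show "lattice_basis U" by (intro lattice_basis_int_spanI[OF finU _ Ul W]) (simp add: cU)
  }
  {
    assume B: "lattice_basis U"
    have p: "p \<in> lattice" using basis by (auto simp: lattice_basis_def)
    have W: "lattice_basis ?W"
    proof (rule lattice_basis_int_spanI[OF _ _ _ B])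
      show fin: "finite ?W" by simp
      have "card ((\<lambda>i. u i - u r) ` {..<r}) \<le> r" using card_image_le[of "{..<r}"] by simp
      then show "card ?W \<le> CARD('n)" using card by (simp add: card_insert_if)
      show "?W \<subseteq> lattice" using p Ul uU by (auto intro!: lattice_diff)
      have "u r - p \<in> lattice" using p Ul uU by (intro lattice_diff) auto
      then obtain k :: "_ \<Rightarrow> int" where k: "u r - p = (\<Sum>v\<in>U. of_int (k v) *\<^sub>R v)"
        using lattice_basis_expand[OF B] by blast
      have "y \<bullet> (u r - p) = (\<Sum>v\<in>U. of_int (k v))" unfolding k by (simp add: inner_sum_right yU)
      then have k0: "(\<Sum>v\<in>U. real_of_int (k v)) = 0" by (simp add: inner_diff_right yp yU uU)
      then have "u r - p = (\<Sum>v\<in>U. of_int (k v) *\<^sub>R v) - (\<Sum>v\<in>U. of_int (k v)) *\<^sub>R u r" using k by simp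
      also have "\<dots> = (\<Sum>v\<in>U. of_int (k v) *\<^sub>R (v - u r))"
        by (simp add: scaleR_diff_right sum_subtractf scaleR_sum_left)
      also have "\<dots> = (\<Sum>i<r. of_int (k (u i)) *\<^sub>R (u i - u r))"
        by (subst u_sum[symmetric]) simp
      finally have ur: "u r = p + (\<Sum>i<r. of_int (k (u i)) *\<^sub>R (u i - u r))" by (simp add: algebra_simps)
      have di: "u i - u r \<in> int_span ?W" if "i < r" for i using that by (intro int_span_base[OF fin]) auto
      have "p + (\<Sum>i<r. of_int (k (u i)) *\<^sub>R (u i - u r)) \<in> int_span ?W"
        by (rule int_span_add[OF int_span_base[OF fin] int_span_sum[OF int_span_scale[OF di]]]) auto
      then have urW: "u r \<in> int_span ?W" by (simp only: ur[symmetric])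
      have "u i \<in> int_span ?W" if "i < Suc r" for i
      proof (cases "i = r")
        case False
        then have "(u i - u r) + u r \<in> int_span ?W" using that di urW by (intro int_span_add) auto
        then show ?thesis by simp
      qed (use urW in simp)
      then show "U \<subseteq> int_span ?W" using u by (auto simp: bij_betw_def)
    qed
    have "K ` L ` F ` range unit_vec = F ` range unit_vec" by (rule image_inverse) (rule KL)
    then have "F ` range unit_vec = K ` ?W" by (simp only: F_range)
    moreover have "lattice_basis (K ` ?W)"
    proof (rule lattice_basis_map[OF linear_K _ W K_lattice])
      have "inj K" using LK by (metis injI)
      then show "inj_on K (span ?W)" by (rule inj_on_subset) simp
    qed
    ultimately show "F \<in> lattice_transformations"
      by (intro lattice_transformationI[OF linear_F lattice_basis_unit_vec]) simp
  }
qed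

end

text \<open>By change of variables the volume is that of \<open>Q\<close> times the absolute value
  of a determinant, which is a non-zero integer and equals 1 or -1 exactly in the unimodular
  case.\<close>

lemma simplex_volume:
  assumes ind: "independent U" and Ul: "U \<subseteq> lattice" and yU: "\<And>x. x \<in> U \<Longrightarrow> y \<bullet> x = 1"
    and cU: "card U = Suc r"
  shows "Prism (convex hull U) \<in> lmeasurable"
    "\<exists>m::nat. m \<ge> 1 \<and> measure lebesgue (Prism (convex hull U)) = m / fact r \<and> (m = 1 \<longleftrightarrow> lattice_basis U)"
proof -
  have finU: "finite U" using ind independent_imp_finite by blast
  obtain u where u: "bij_betw u {..<Suc r} U"
    using ex_bij_betw_nat_finite[OF finU] cU by (auto simp: atLeast0LessThan)
  note ctx = ind Ul yU u
  let ?F = "F u"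
  have lin: "linear ?F" by (rule linear_F[OF ctx])
  have P: "Prism (convex hull U) = (\<lambda>x. K (u r - p) + x) ` ?F ` Q" by (rule Prism_simplex[OF ctx])
  have FQ: "?F ` Q \<in> lmeasurable" by (rule measurable_linear_image[OF lin Q_measure(1)])
  show "Prism (convex hull U) \<in> lmeasurable"
    unfolding P by (rule measurable_translation[OF FQ])
  have "measure lebesgue (Prism (convex hull U)) = measure lebesgue (?F ` Q)"
    unfolding P by (rule measure_translation)
  also have "\<dots> = \<bar>det (matrix ?F)\<bar> * (1 / fact r)"
    using measure_linear_image[OF lin Q_measure(1)] Q_measure(2) by simp
  finally have m: "measure lebesgue (Prism (convex hull U)) = \<bar>det (matrix ?F)\<bar> / fact r" by simp
  have Fl: "\<And>j. ?F (unit_vec j) \<in> lattice" by (rule F_unit_lattice[OF ctx])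
  have "det (matrix ?F) \<in> \<int>" by (intro det_int matrix_int_lattice Fl)
  moreover have "det (matrix ?F) \<noteq> 0" using det_nz_iff_inj[OF lin] inj_F[OF ctx] by simp
  ultimately obtain k :: int where k: "det (matrix ?F) = of_int k" "k \<noteq> 0" by (auto elim!: Ints_cases)
  have "real (nat \<bar>k\<bar>) = \<bar>det (matrix ?F)\<bar>" using k by simp
  moreover have "nat \<bar>k\<bar> \<ge> 1" using k by linarith
  moreover have "nat \<bar>k\<bar> = 1 \<longleftrightarrow> lattice_basis U"
    using det_lattice_transformation[OF lin Fl] F_lattice_iff[OF ctx] k by auto
  ultimately show "\<exists>m::nat. m \<ge> 1 \<and> measure lebesgue (Prism (convex hull U)) = m / fact r \<and> (m = 1 \<longleftrightarrow> lattice_basis U)"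
    using m by (intro exI[of _ "nat \<bar>k\<bar>"]) auto
qed

end

lemma circuit_independent:
  fixes X :: "(real ^ 'n) set"
  assumes X: "finite X" "card X = CARD('n) + 1" "span X = UNIV"
    and IJ: "I \<subseteq> X" "J \<subseteq> X" "I \<inter> J = {}"
    and rel: "(\<Sum>v\<in>I. v) = (\<Sum>v\<in>J. of_nat (c v) *\<^sub>R v)" and v: "v \<in> I"
  shows "independent (X - {v})" "span (X - {v}) = UNIV" "card (X - {v}) = CARD('n)"
    "w \<in> I - {v} \<Longrightarrow> dual_vec (X - {v}) w \<bullet> v = -1"
proof -
  have finI: "finite I" using IJ(1) X(1) finite_subset by blast
  have ve: "v = (\<Sum>j\<in>J. of_nat (c j) *\<^sub>R j) - (\<Sum>i\<in>I - {v}. i)"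
    using rel sum.remove[OF finI v, of "\<lambda>i. i"] by (simp add: eq_diff_eq)
  have "v \<in> span (X - {v})"
    by (subst ve, intro span_diff span_sum span_scale span_base) (use IJ v in auto)
  then have "X \<subseteq> span (X - {v})" using span_base[of _ "X - {v}"] by blast
  then have "span X \<subseteq> span (X - {v})" by (intro span_minimal) auto
  then show s: "span (X - {v}) = UNIV" using X(3) by auto
  show c: "card (X - {v}) = CARD('n)" using X IJ(1) v by auto
  show ind: "independent (X - {v})"
    using s c X(1) by (intro card_le_dim_spanning[of _ UNIV]) auto
  assume w: "w \<in> I - {v}"
  let ?z = "dual_vec (X - {v}) w"
  have z: "?z \<bullet> x = (if x = w then 1 else 0)" if "x \<in> X - {v}" for x by (rule dual_vec[OF ind that])
  have "?z \<bullet> (\<Sum>j\<in>J. of_nat (c j) *\<^sub>R j) = 0"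
  proof -
    have "?z \<bullet> j = 0" if j: "j \<in> J" for j
    proof -
      have "j \<in> X - {v}" "j \<noteq> w" using j IJ w v by blast+
      then show ?thesis using z[of j] by simp
    qed
    then show ?thesis by (simp add: inner_sum_right)
  qed
  moreover have "?z \<bullet> (\<Sum>i\<in>I - {v}. i) = 1"
  proof -
    have "?z \<bullet> (\<Sum>i\<in>I - {v}. i) = (\<Sum>i\<in>I - {v}. if i = w then 1 else 0)"
      unfolding inner_sum_right by (intro sum.cong) (use z IJ in auto)
    then show ?thesis using w finI by simp
  qed
  moreover have "?z \<bullet> v = ?z \<bullet> (\<Sum>j\<in>J. of_nat (c j) *\<^sub>R j) - ?z \<bullet> (\<Sum>i\<in>I - {v}. i)"
    by (subst ve) (rule inner_diff_right)
  ultimately show "?z \<bullet> v = -1" by simp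
qed

text \<open>Subtracting the relation from a convex representation until the first coefficient in \<open>I\<close>
  vanishes moves the point into one of the simplices.\<close>

lemma circuit_triangulation:
  fixes X :: "'a::real_vector set"
  assumes X: "finite X" and IJ: "I \<subseteq> X" "J \<subseteq> X" "I \<inter> J = {}" "I \<noteq> {}"
    and rel: "(\<Sum>v\<in>I. v) = (\<Sum>v\<in>J. of_nat (c v) *\<^sub>R v)" and sc: "(\<Sum>v\<in>J. c v) = card I"
  shows "convex hull X = (\<Union>v\<in>I. convex hull (X - {v}))"
proof (intro equalityI subsetI)
  have fin: "finite I" "finite J" using IJ X finite_subset by blast+
  fix x assume "x \<in> convex hull X"
  then obtain m where m: "\<forall>v\<in>X. 0 \<le> m v" "sum m X = 1" "(\<Sum>v\<in>X. m v *\<^sub>R v) = x"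
    using X by (auto simp: convex_hull_finite)
  define s where "s = Min (m ` I)"
  have "s \<in> m ` I" using fin IJ(4) by (simp add: s_def)
  then obtain v where v: "v \<in> I" "m v = s" by blast
  have s: "s \<le> m i" if "i \<in> I" for i using that fin by (simp add: s_def)
  have s0: "s \<ge> 0" using v m(1) IJ(1) by auto
  define a where "a = (\<lambda>x. (if x \<in> I then 1 else 0) - (if x \<in> J then real (c x) else 0))"
  have sumI: "(\<Sum>x\<in>X. (if x \<in> I then f x else 0)) = sum f I" for f :: "'a \<Rightarrow> 'b::comm_monoid_add"
    using X IJ(1) by (simp add: sum.inter_restrict[symmetric] Int_absorb1)
  have sumJ: "(\<Sum>x\<in>X. (if x \<in> J then f x else 0)) = sum f J" for f :: "'a \<Rightarrow> 'b::comm_monoid_add"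
    using X IJ(2) by (simp add: sum.inter_restrict[symmetric] Int_absorb1)
  have a0: "sum a X = 0"
    using sc by (simp add: a_def sum_subtractf sumI sumJ flip: of_nat_sum)
  have "(\<Sum>x\<in>X. a x *\<^sub>R x) = (\<Sum>x\<in>X. if x \<in> I then x else 0) - (\<Sum>x\<in>X. if x \<in> J then real (c x) *\<^sub>R x else 0)"
    unfolding sum_subtractf[symmetric] a_def by (rule sum.cong) (auto simp: scaleR_diff_left)
  then have a1: "(\<Sum>x\<in>X. a x *\<^sub>R x) = 0" using rel by (simp add: sumI sumJ)
  define k where "k = (\<lambda>x. m x - s * a x)"
  have kv: "k v = 0" using v IJ(3) by (auto simp: k_def a_def)
  have kX: "k i \<ge> 0" if i: "i \<in> X" for i
  proof (cases "i \<in> I")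
    case True
    then have "i \<notin> J" using IJ(3) by auto
    then show ?thesis using s[OF True] True by (simp add: k_def a_def)
  next
    case False
    have "s * real (c i) \<ge> 0" using s0 by simp
    then show ?thesis using m(1) i False by (auto simp: k_def a_def)
  qed
  have vX: "v \<in> X" using v IJ(1) by auto
  have "sum k X = 1" using m(2) a0 by (simp add: k_def sum_subtractf flip: sum_distrib_left)
  then have k1: "sum k (X - {v}) = 1" using sum.remove[OF X vX, of k] kv by simp
  have "(\<Sum>x\<in>X. k x *\<^sub>R x) = (\<Sum>x\<in>X. m x *\<^sub>R x) - s *\<^sub>R (\<Sum>x\<in>X. a x *\<^sub>R x)"
    by (simp add: k_def scaleR_diff_left sum_subtractf scaleR_sum_right)
  then have "(\<Sum>x\<in>X. k x *\<^sub>R x) = x" using m(3) a1 by simp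
  then have "(\<Sum>x\<in>X - {v}. k x *\<^sub>R x) = x" using sum.remove[OF X vX, of "\<lambda>x. k x *\<^sub>R x"] kv by simp
  then have "x \<in> convex hull (X - {v})"
    using kX k1 X by (auto simp: convex_hull_finite intro!: exI[of _ k])
  then show "x \<in> (\<Union>v\<in>I. convex hull (X - {v}))" using v by blast
next
  fix x assume "x \<in> (\<Union>v\<in>I. convex hull (X - {v}))"
  then show "x \<in> convex hull X" using hull_mono[of "X - {_}" X convex] by blast
qed

text \<open>The simplices that omit one point of \<open>I\<close> cover the hull and overlap in null
  sets. Their \<open>card I\<close> normalized volumes are positive integers, so the total is
  \<open>card I\<close> exactly if each of them is 1.\<close>

lemma (in frame_coords) circuit_volume:
  assumes X: "finite X" "X \<subseteq> lattice" "card X = CARD('n) + 1" "span X = UNIV" "\<And>x. x \<in> X \<Longrightarrow> y \<bullet> x = 1"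
    and IJ: "I \<subseteq> X" "J \<subseteq> X" "I \<inter> J = {}" "I \<noteq> {}"
    and rel: "(\<Sum>v\<in>I. v) = (\<Sum>v\<in>J. of_nat (c v) *\<^sub>R v)" and sc: "(\<Sum>v\<in>J. c v) = card I"
  shows "fact r * measure lebesgue (Prism (convex hull X)) = real (card I) \<longleftrightarrow>
    (\<forall>v\<in>I. lattice_basis (X - {v}))"
proof -
  have finI: "finite I" using IJ(1) X(1) finite_subset by blast
  note ci = circuit_independent[OF X(1,3,4) IJ(1-3) rel]
  have sv: "Prism (convex hull (X - {v})) \<in> lmeasurable"
    "\<exists>m::nat. m \<ge> 1 \<and> measure lebesgue (Prism (convex hull (X - {v}))) = m / fact r \<and> (m = 1 \<longleftrightarrow> lattice_basis (X - {v}))"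
    if v: "v \<in> I" for v
  proof -
    have "card (X - {v}) = Suc r" using ci(3)[OF v] card by simp
    note sv = simplex_volume[OF ci(1)[OF v] _ _ this]
    show "Prism (convex hull (X - {v})) \<in> lmeasurable" by (rule sv(1)) (use X in auto)
    show "\<exists>m::nat. m \<ge> 1 \<and> measure lebesgue (Prism (convex hull (X - {v}))) = m / fact r \<and> (m = 1 \<longleftrightarrow> lattice_basis (X - {v}))"
      by (rule sv(2)) (use X in auto)
  qed
  have neg: "negligible (Prism (convex hull (X - {v})) \<inter> Prism (convex hull (X - {w})))"
    if vw: "v \<in> I" "w \<in> I" "v \<noteq> w" for v w
  proof -
    let ?z = "dual_vec (X - {v}) w"
    have w: "w \<in> X - {v}" using vw IJ by auto
    have zx: "?z \<bullet> x = (if x = w then 1 else 0)" if "x \<in> X - {v}" for x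
      by (rule dual_vec[OF ci(1)[OF vw(1)] that])
    have zv: "?z \<bullet> v = -1" using ci(4)[OF vw(1)] vw by auto
    have z0: "?z \<bullet> x = 0" if x: "x \<in> convex hull (X - {v})" "x \<in> convex hull (X - {w})" for x
    proof -
      have "- ?z \<bullet> x \<le> 0" by (rule inner_le_convex_hull[OF _ x(1)]) (use zx in auto)
      moreover have "?z \<bullet> x \<le> 0"
      proof (rule inner_le_convex_hull[OF _ x(2)])
        fix a assume a: "a \<in> X - {w}"
        show "?z \<bullet> a \<le> 0" using zx[of a] zv a by (cases "a = v") auto
      qed
      ultimately show ?thesis by simp
    qed
    \<comment> \<open>The separating functional \<open>?z\<close> read in frame coordinates. The
      overlap satisfies one linear equation, which is not trivial since \<open>?z\<close> would
      otherwise vanish on the basis formed by \<open>p\<close> and \<open>b\<close>.\<close>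
    define a where "a = (\<Sum>i<r. (?z \<bullet> b i) *\<^sub>R unit_vec (e i))"
    have ax: "a \<bullet> x = ?z \<bullet> (\<Sum>i<r. (x $ e i) *\<^sub>R b i)" for x
      by (simp add: a_def inner_sum_left inner_sum_right unit_vec_def inner_axis' mult.commute)
    have ne: "a \<noteq> 0 \<or> - (?z \<bullet> p) \<noteq> 0"
    proof (rule ccontr)
      assume "\<not> ?thesis"
      then have a: "a = 0" "?z \<bullet> p = 0" by auto
      have "?z \<bullet> b k = 0" if k: "k < r" for k
      proof -
        have "(\<Sum>i<r. (unit_vec (e k) $ e i) *\<^sub>R b i) = (\<Sum>i<r. if i = k then b i else 0)"
          by (rule sum.cong) (use k e_eq in \<open>auto simp: unit_vec_nth\<close>)
        then show ?thesis using ax[of "unit_vec (e k)"] a(1) k by simp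
      qed
      then have "?z = 0" using a(2)
        by (intro inner_eq_on_spanning[OF lattice_basisD(4)[OF basis]]) auto
      then show False using zv by simp
    qed
    have "Prism (convex hull (X - {v})) \<inter> Prism (convex hull (X - {w})) \<subseteq> {x. a \<bullet> x = - (?z \<bullet> p)}"
    proof
      fix x assume "x \<in> Prism (convex hull (X - {v})) \<inter> Prism (convex hull (X - {w}))"
      then have "?z \<bullet> (p + (\<Sum>i<r. (x $ e i) *\<^sub>R b i)) = 0" by (intro z0) (auto simp: Prism_def)
      then show "x \<in> {x. a \<bullet> x = - (?z \<bullet> p)}" by (simp add: ax inner_add_right)
    qed
    then show ?thesis using negligible_hyperplane[OF ne] negligible_subset by blast
  qed
  have "Prism (convex hull X) = (\<Union>v\<in>I. Prism (convex hull (X - {v})))"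
    using circuit_triangulation[OF X(1) IJ rel sc] by (auto simp: Prism_def)
  moreover have "measure lebesgue (\<Union>v\<in>I. Prism (convex hull (X - {v}))) =
      (\<Sum>v\<in>I. measure lebesgue (Prism (convex hull (X - {v}))))"
    by (rule measure_negligible_finite_Union_image[OF finI sv(1)]) (use neg in \<open>auto simp: pairwise_def\<close>)
  ultimately have M: "measure lebesgue (Prism (convex hull X)) =
      (\<Sum>v\<in>I. measure lebesgue (Prism (convex hull (X - {v}))))" by simp
  have "\<forall>v\<in>I. \<exists>m::nat. 1 \<le> m \<and> measure lebesgue (Prism (convex hull (X - {v}))) = real m / fact r \<and>
      (m = 1 \<longleftrightarrow> lattice_basis (X - {v}))"
  proof
    fix v assume "v \<in> I"
    from sv(2)[OF this] show "\<exists>m::nat. 1 \<le> m \<and> measure lebesgue (Prism (convex hull (X - {v}))) = real m / fact r \<and>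
      (m = 1 \<longleftrightarrow> lattice_basis (X - {v}))" by simp
  qed
  from bchoice[OF this] obtain m :: "real ^ 'n \<Rightarrow> nat" where m: "\<And>v. v \<in> I \<Longrightarrow> m v \<ge> 1"
    "\<And>v. v \<in> I \<Longrightarrow> measure lebesgue (Prism (convex hull (X - {v}))) = real (m v) / fact r"
    "\<And>v. v \<in> I \<Longrightarrow> m v = 1 \<longleftrightarrow> lattice_basis (X - {v})"
    by blast
  have "fact r * measure lebesgue (Prism (convex hull X)) = (\<Sum>v\<in>I. real (m v))"
    using m(2) by (simp add: M sum_distrib_left)
  also have "\<dots> = real (\<Sum>v\<in>I. m v)" by simp
  finally have vol: "fact r * measure lebesgue (Prism (convex hull X)) = real (\<Sum>v\<in>I. m v)" .
  have "fact r * measure lebesgue (Prism (convex hull X)) = real (card I) \<longleftrightarrow> (\<Sum>v\<in>I. m v) = card I"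
    unfolding vol by (rule of_nat_eq_iff)
  also have "\<dots> \<longleftrightarrow> (\<Sum>v\<in>I. m v - 1) = 0"
    using m(1) sum_subtractf_nat[of I "\<lambda>_. 1" m] sum_mono[of I "\<lambda>_. 1" m] by (auto intro: le_antisym)
  also have "\<dots> \<longleftrightarrow> (\<forall>v\<in>I. m v = 1)" using finI m(1) by (auto simp: le_antisym)
  also have "\<dots> \<longleftrightarrow> (\<forall>v\<in>I. lattice_basis (X - {v}))" using m(3) by auto
  finally show ?thesis .
qed

section \<open>From the chosen lattice frame to the prism\<close>

lemma affine_hull_hyperplane:
  fixes X :: "(real ^ 'n) set"
  assumes "finite X" "span X = UNIV" "\<And>x. x \<in> X \<Longrightarrow> y \<bullet> x = 1"
  shows "affine hull X = {x. y \<bullet> x = 1}"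
proof (intro equalityI subsetI)
  fix x assume "x \<in> affine hull X"
  moreover have "affine hull X \<subseteq> {x. y \<bullet> x = 1}"
    using assms(3) by (intro hull_minimal) (auto simp: affine_hyperplane)
  ultimately show "x \<in> {x. y \<bullet> x = 1}" by blast
next
  fix x assume x: "x \<in> {x. y \<bullet> x = 1}"
  obtain f where f: "x = (\<Sum>v\<in>X. f v *\<^sub>R v)" using assms(1,2) span_finite[of X] by auto
  have "y \<bullet> x = (\<Sum>v\<in>X. f v)" unfolding f by (simp add: inner_sum_right assms(3))
  then have "sum f X = 1" using x by simp
  then show "x \<in> affine hull X" using f by (auto simp: affine_hull_finite[OF assms(1)])
qed

text \<open>The definition selects an arbitrary frame, so a frame has to be exhibited before
  anything is known about the selected one. Since \<open>y\<close> is integral and the facet lies at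
  height 1, \<open>p\<close> and \<open>b\<close> of any frame together form a lattice basis of the
  whole space.\<close>

lemma normalized_volume_circuit:
  fixes X :: "(real ^ 'n) set"
  assumes X: "finite X" "X \<subseteq> lattice" "card X = CARD('n) + 1" "span X = UNIV" "\<And>x. x \<in> X \<Longrightarrow> y \<bullet> x = 1"
    and yl: "y \<in> lattice"
    and IJ: "I \<subseteq> X" "J \<subseteq> X" "I \<inter> J = {}" "I \<noteq> {}"
    and rel: "(\<Sum>v\<in>I. v) = (\<Sum>v\<in>J. of_nat (c v) *\<^sub>R v)" and sc: "(\<Sum>v\<in>J. c v) = card I"
  shows "normalized_volume (convex hull X) = real (card I) \<longleftrightarrow> (\<forall>v\<in>I. lattice_basis (X - {v}))"
proof -
  let ?G = "convex hull X"
  define r where "r = CARD('n) - 1"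
  have card: "CARD('n) = Suc r" by (simp add: r_def)
  have "int (dim (span X)) = aff_dim X + 1" using aff_dim_hyperplane_span X(5) by blast
  then have ad: "nat (aff_dim ?G) = r" using X(4) card by (simp add: aff_dim_convex_hull)
  have ah: "affine hull ?G = {x. y \<bullet> x = 1}"
    using affine_hull_hyperplane[OF X(1,4,5)] by (simp add: affine_hull_convex_hull)
  then have ah': "affine hull X = {x. y \<bullet> x = 1}" by (simp add: affine_hull_convex_hull)
  have "\<exists>p b. lattice_frame ?G p b"
  proof -
    \<comment> \<open>Dropping one point of \<open>I\<close> leaves independent lattice points at
      height 1, whose determinant is non-zero; a lattice basis at height 1 and then a frame come
      from these.\<close>
    obtain v where v: "v \<in> I" using IJ(4) by blast
    note ci = circuit_independent[OF X(1,3,4) IJ(1-3) rel v]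
    obtain g :: "'n \<Rightarrow> real ^ 'n" where g: "bij_betw g UNIV (X - {v})"
      using finite_same_card_bij[of "UNIV :: 'n set" "X - {v}"] ci(3) X(1) by auto
    let ?A = "(\<chi> i j. g j $ i) :: real ^ 'n ^ 'n"
    have Av: "?A *v x = (\<Sum>j\<in>UNIV. x $ j *\<^sub>R g j)" for x
      by (simp add: vec_eq_iff matrix_vector_mult_def mult.commute)
    have "surj ((*v) ?A)"
    proof (rule surjI)
      fix x
      have "x = (\<Sum>b\<in>X - {v}. (dual_vec (X - {v}) b \<bullet> x) *\<^sub>R b)" by (rule dual_vec_expand[OF ci(1,2)])
      also have "\<dots> = (\<Sum>j\<in>UNIV. (dual_vec (X - {v}) (g j) \<bullet> x) *\<^sub>R g j)"
        by (rule sum.reindex_bij_betw[OF g, symmetric])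
      finally show "?A *v (\<chi> j. dual_vec (X - {v}) (g j) \<bullet> x) = x" by (simp add: Av)
    qed
    then have "inj ((*v) ?A)" by (intro linear_surjective_imp_injective) auto
    then have "det (matrix ((*v) ?A)) \<noteq> 0" by (subst det_nz_iff_inj) auto
    then have d: "det ?A \<noteq> 0" by simp
    have gX: "g j \<in> X" for j using g by (auto simp: bij_betw_def)
    obtain U where U: "lattice_basis U" "\<forall>x\<in>U. y \<bullet> x = 1"
      using lattice_basis_in_hyperplane[OF yl _ _ d] gX X(2,5) by blast
    note UD = lattice_basisD[OF U(1)]
    obtain u where u: "bij_betw u {..<Suc r} U"
      using ex_bij_betw_nat_finite[OF UD(3)] UD(5) card by (auto simp: atLeast0LessThan)
    have uU: "u i \<in> U" if "i < Suc r" for i using u that by (auto simp: bij_betw_def)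
    have u_eq: "u i = u j \<longleftrightarrow> i = j" if "i < Suc r" "j < Suc r" for i j
      using u that by (auto simp: bij_betw_def inj_on_eq_iff)
    let ?b = "\<lambda>i. u i - u r"
    have inj: "inj_on ?b {..<r}" using u_eq by (auto simp: inj_on_def)
    have "independent (?b ` {..<r})"
    proof (rule independent_if_scalars_zero)
      show "finite (?b ` {..<r})" by simp
      fix f x assume 0: "(\<Sum>x\<in>?b ` {..<r}. f x *\<^sub>R x) = 0" and "x \<in> ?b ` {..<r}"
      then obtain k where k: "k < r" "x = ?b k" by blast
      have "(\<Sum>i<r. f (?b i) *\<^sub>R ?b i) = 0" using 0 by (simp add: sum.reindex[OF inj])
      then have z: "dual_vec U (u k) \<bullet> (\<Sum>i<r. f (?b i) *\<^sub>R ?b i) = 0" by simp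
      have "dual_vec U (u k) \<bullet> ?b i = (if i = k then 1 else 0)" if "i < r" for i
        using dual_vec[OF UD(2) uU, of i "u k"] dual_vec[OF UD(2) uU, of r "u k"] u_eq[of i k] u_eq[of r k] that k
        by (simp add: inner_diff_right)
      then have "dual_vec U (u k) \<bullet> (\<Sum>i<r. f (?b i) *\<^sub>R ?b i) = (\<Sum>i<r. if i = k then f (?b i) else 0)"
        unfolding inner_sum_right by (intro sum.cong) auto
      then show "f x = 0" using z k by simp
    qed
    moreover have "lattice_points {x. y \<bullet> x = 1} = {u r + (\<Sum>i<r. of_int (c i) *\<^sub>R ?b i) | c :: nat \<Rightarrow> int. True}"
    proof (intro equalityI subsetI)
      fix x assume "x \<in> lattice_points {x. y \<bullet> x = 1}"
      then have x: "x \<in> lattice" "y \<bullet> x = 1" by (auto simp: lattice_points_def)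
      obtain k :: "_ \<Rightarrow> int" where k: "x = (\<Sum>v\<in>U. of_int (k v) *\<^sub>R v)"
        using lattice_basis_expand[OF U(1) x(1)] by blast
      have "y \<bullet> x = (\<Sum>v\<in>U. of_int (k v))" unfolding k using U(2) by (simp add: inner_sum_right)
      then have k0: "(\<Sum>v\<in>U. real_of_int (k v)) = 1" using x(2) by simp
      then have "x - u r = (\<Sum>v\<in>U. of_int (k v) *\<^sub>R v) - (\<Sum>v\<in>U. of_int (k v)) *\<^sub>R u r" using k by simp
      also have "\<dots> = (\<Sum>v\<in>U. of_int (k v) *\<^sub>R (v - u r))"
        by (simp add: scaleR_diff_right sum_subtractf scaleR_sum_left)
      also have "\<dots> = (\<Sum>i<Suc r. of_int (k (u i)) *\<^sub>R (u i - u r))"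
        by (rule sum.reindex_bij_betw[OF u, symmetric])
      also have "\<dots> = (\<Sum>i<r. of_int (k (u i)) *\<^sub>R (u i - u r))" by simp
      finally have "x = u r + (\<Sum>i<r. of_int (k (u i)) *\<^sub>R ?b i)" by (simp add: algebra_simps)
      then show "x \<in> {u r + (\<Sum>i<r. of_int (c i) *\<^sub>R ?b i) | c :: nat \<Rightarrow> int. True}"
        by (intro CollectI exI[of _ "\<lambda>i. k (u i)"]) simp
    next
      fix x assume "x \<in> {u r + (\<Sum>i<r. of_int (c i) *\<^sub>R ?b i) | c :: nat \<Rightarrow> int. True}"
      then obtain c :: "nat \<Rightarrow> int" where x: "x = u r + (\<Sum>i<r. of_int (c i) *\<^sub>R ?b i)" by blast
      have "y \<bullet> ?b i = 0" if "i < r" for i using U(2) uU that by (simp add: inner_diff_right)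
      then have "y \<bullet> x = 1" using U(2) uU[of r] by (simp add: x inner_add_right inner_sum_right)
      moreover have "x \<in> lattice"
        unfolding x using uU UD(1) by (intro lattice_add lattice_sum lattice_scale lattice_diff) auto
      ultimately show "x \<in> lattice_points {x. y \<bullet> x = 1}" by (simp add: lattice_points_def)
    qed
    ultimately have "lattice_frame ?G (u r) ?b"
      using inj by (simp add: lattice_frame_def ad ah' Let_def)
    then show ?thesis by blast
  qed
  then have "\<exists>q. case q of (p, b) \<Rightarrow> lattice_frame ?G p b" by auto
  then have fr': "case (SOME (p, b). lattice_frame ?G p b) of (p, b) \<Rightarrow> lattice_frame ?G p b"
    by (rule someI_ex)
  \<comment> \<open>From here on \<open>p\<close> and \<open>b\<close> are the selected frame, of
    which only the frame property is known.\<close>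
  obtain p b where pb: "(SOME (p, b). lattice_frame ?G p b) = (p, b)" by (cases "SOME (p, b). lattice_frame ?G p b")
  have fr: "lattice_frame ?G p b" using fr' pb by simp
  then have inj: "inj_on b {..<r}" and pts: "lattice_points {x. y \<bullet> x = 1} = {p + (\<Sum>i<r. of_int (c i) *\<^sub>R b i) | c :: nat \<Rightarrow> int. True}"
    by (simp_all add: lattice_frame_def ad ah' Let_def)
  have comb: "p + (\<Sum>i<r. of_int (k i) *\<^sub>R b i) \<in> lattice_points {x. y \<bullet> x = 1}" for k :: "nat \<Rightarrow> int"
    unfolding pts by blast
  have p: "p \<in> lattice" "y \<bullet> p = 1" using comb[of "\<lambda>_. 0"] by (auto simp: lattice_points_def)
  have pb': "p + b i \<in> lattice" "y \<bullet> (p + b i) = 1" if "i < r" for i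
  proof -
    have "(\<Sum>j<r. of_int (if j = i then 1 else 0) *\<^sub>R b j) = (\<Sum>j<r. if j = i then b j else 0)"
      by (rule sum.cong) auto
    then have "(\<Sum>j<r. of_int (if j = i then 1 else 0) *\<^sub>R b j) = b i" using that by simp
    then show "p + b i \<in> lattice" "y \<bullet> (p + b i) = 1"
      using comb[of "\<lambda>j. if j = i then 1 else 0"] by (auto simp: lattice_points_def)
  qed
  have b: "b i \<in> lattice" "y \<bullet> b i = 0" if "i < r" for i
    using lattice_diff[OF pb'(1)[OF that] p(1)] pb'(2)[OF that] p(2) by (simp_all add: inner_add_right)
  let ?W = "insert p (b ` {..<r})"
  have basis: "lattice_basis ?W"
  proof (rule lattice_basis_int_spanI[OF _ _ _ lattice_basis_unit_vec])
    show fin: "finite ?W" by simp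
    have "card (b ` {..<r}) \<le> r" using card_image_le[of "{..<r}"] by simp
    then show "card ?W \<le> CARD('n)" using card by (simp add: card_insert_if)
    show "?W \<subseteq> lattice" using p b by auto
    show "range unit_vec \<subseteq> int_span ?W"
    proof
      fix x :: "real ^ 'n" assume "x \<in> range unit_vec"
      then have x: "x \<in> lattice" by auto
      obtain h :: int where h: "y \<bullet> x = of_int h" using lattice_inner[OF yl x] by (auto elim: Ints_cases)
      \<comment> \<open>Subtracting a multiple of \<open>p\<close> moves a lattice point of height
        \<open>h\<close> to height 1, where the frame describes it.\<close>
      have "x - of_int (h - 1) *\<^sub>R p \<in> lattice" using x p(1) by (intro lattice_diff lattice_scale) auto
      moreover have "y \<bullet> (x - of_int (h - 1) *\<^sub>R p) = 1" using h p by (simp add: inner_diff_right)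
      ultimately have "x - of_int (h - 1) *\<^sub>R p \<in> lattice_points {x. y \<bullet> x = 1}" by (simp add: lattice_points_def)
      then obtain k :: "nat \<Rightarrow> int" where "x - of_int (h - 1) *\<^sub>R p = p + (\<Sum>i<r. of_int (k i) *\<^sub>R b i)"
        unfolding pts by blast
      then have xe: "x = of_int h *\<^sub>R p + (\<Sum>i<r. of_int (k i) *\<^sub>R b i)" by (simp add: algebra_simps)
      show "x \<in> int_span ?W"
        unfolding xe by (intro int_span_add int_span_scale int_span_sum int_span_base[OF fin]) auto
    qed
  qed
  have "card {..<Suc r} = card (UNIV :: 'n wo set)" using card card_wo[where 'a = 'n] by simp
  then obtain e :: "nat \<Rightarrow> 'n wo" where e: "bij_betw e {..<Suc r} UNIV"
    using finite_same_card_bij[of "{..<Suc r}" "UNIV :: 'n wo set"] by auto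
  interpret frame_coords y p b r e
    by standard (use card inj basis p b e in auto)
  have "closed ?G" using X(1) by (simp add: compact_imp_closed finite_imp_compact_convex_hull)
  then have "normalized_volume ?G = fact r * measure lebesgue (Prism ?G)"
    by (simp add: normalized_volume_def ad pb Let_def Prism_measure)
  then show ?thesis using circuit_volume[OF X IJ rel sc] by simp
qed

section \<open>Existence of runs\<close>

lemma card_option: "CARD('n::finite option) = CARD('n) + 1"
  by (simp add: UNIV_option_conv card_image)

lemma reflexive_facetE:
  fixes P :: "(real ^ 'n) set"
  assumes P: "reflexive_polytope P" and G: "G facet_of P"
  obtains y where "facet_normal (vertices P) y" "y \<in> lattice" "G = convex hull (tight (vertices P) y)"
    "vertices G = tight (vertices P) y" "\<And>x. x \<in> G \<Longrightarrow> y \<bullet> x = 1"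
proof -
  note R = reflexive_polytope_vertices[OF P]
  obtain y where y: "facet_normal (vertices P) y" "G = convex hull (tight (vertices P) y)"
    using facet_of_convex_hull_iff[OF R(2), of G] R(1,4) G by auto
  moreover have "vertices G = tight (vertices P) y"
    using tight_vertices_facet[OF R(6,4) y(1)] y(2) by simp
  moreover have "y \<bullet> x = 1" if "x \<in> G" for x
    using inner_eq_convex_hull[of "tight (vertices P) y" y 1 x] tight_inner that y(2) by blast
  ultimately show ?thesis using that R(5) by blast
qed

lemma unimodular_facet_convex_hull:
  fixes B :: "(real ^ 'n) set"
  assumes B: "lattice_basis B"
  shows "unimodular_facet (convex hull B)"
proof -
  note BD = lattice_basisD[OF B]
  have na: "\<not> affine_dependent B" using BD(2) affine_dependent_imp_dependent by blast
  have "(int CARD('n option) - 2) simplex (convex hull B)"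
    unfolding simplex_def using na BD(5) by (intro exI[of _ B]) (simp add: card_option)
  moreover have "affine_lattice_basis B"
    unfolding affine_lattice_basis_def
  proof (intro conjI ballI BD(1) na)
    fix x assume x: "x \<in> lattice_points (affine hull B)"
    then have xl: "x \<in> lattice" by (simp add: lattice_points_def)
    obtain f where f: "sum f B = 1" "(\<Sum>v\<in>B. f v *\<^sub>R v) = x"
      using x BD(3) by (auto simp: lattice_points_def affine_hull_finite)
    obtain c :: "_ \<Rightarrow> int" where c: "x = (\<Sum>b\<in>B. of_int (c b) *\<^sub>R b)"
      using lattice_basis_expand[OF B xl] by blast
    have "f b = of_int (c b)" if "b \<in> B" for b
      using dual_vec_sum[OF BD(2) that, of f] dual_vec_sum[OF BD(2) that, of "\<lambda>b. of_int (c b)"] f(2) c by simp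
    then have "real_of_int (sum c B) = 1" using f(1) by simp
    then have "sum c B = 1" by linarith
    then show "\<exists>c. sum c B = 1 \<and> x = (\<Sum>b\<in>B. real_of_int (c b) *\<^sub>R b)" using c by blast
  qed
  ultimately show ?thesis using independent_vertices[OF BD(2)] by (simp add: unimodular_facet_def)
qed

lemma lattice_points_simplex:
  fixes B :: "(real ^ 'n) set"
  assumes B: "lattice_basis B" and y: "\<And>b. b \<in> B \<Longrightarrow> y \<bullet> b = 1"
  shows "lattice_points (convex hull B) = B"
proof (intro equalityI subsetI)
  note BD = lattice_basisD[OF B]
  fix x assume x: "x \<in> lattice_points (convex hull B)"
  then obtain c where c: "\<forall>b\<in>B. 0 \<le> c b" "(\<Sum>b\<in>B. c b *\<^sub>R b) = x"
    using BD(3) by (auto simp: lattice_points_def convex_hull_finite)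
  have yx: "y \<bullet> x = 1" using inner_eq_convex_hull[OF y] x by (auto simp: lattice_points_def)
  then have "x \<noteq> 0" by auto
  then show "x \<in> B"
    using lattice_cone_point[OF B _ _ _ c(2)[symmetric] y] x c(1) yx by (auto simp: lattice_points_def)
next
  fix x assume "x \<in> B"
  then show "x \<in> lattice_points (convex hull B)"
    using lattice_basisD(1)[OF B] hull_inc[of x B convex] by (auto simp: lattice_points_def)
qed

text \<open>Reflexivity puts the facet at lattice distance 1 from the origin. Any lattice point can
  be shifted into the hyperplane of the facet by an integral multiple of a vertex, and there the
  affine basis applies.\<close>

lemma unimodular_facet_vertices:
  fixes P :: "(real ^ 'n) set"
  assumes P: "reflexive_polytope P" and G: "G facet_of P" and u: "unimodular_facet G"
  shows "lattice_basis (vertices G)"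
proof -
  obtain y where y: "facet_normal (vertices P) y" "y \<in> lattice" "G = convex hull (tight (vertices P) y)"
    "vertices G = tight (vertices P) y" "\<And>x. x \<in> G \<Longrightarrow> y \<bullet> x = 1"
    using reflexive_facetE[OF P G] by blast
  let ?B = "vertices G"
  have yB: "y \<bullet> x = 1" if "x \<in> ?B" for x using that y(4) tight_inner by blast
  have "affine_lattice_basis ?B" using u by (simp add: unimodular_facet_def)
  then have Bl: "?B \<subseteq> lattice" and ex: "\<And>x. x \<in> lattice_points (affine hull ?B) \<Longrightarrow>
      \<exists>c :: real ^ 'n \<Rightarrow> int. (\<Sum>b\<in>?B. c b) = 1 \<and> x = (\<Sum>b\<in>?B. of_int (c b) *\<^sub>R b)"
    by (auto simp: affine_lattice_basis_def)
  obtain C where C: "\<not> affine_dependent C" "int (card C) = int CARD('n option) - 2 + 1" "G = convex hull C"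
    using u by (auto simp: unimodular_facet_def simplex_def)
  have "?B = C" using C(1,3) by (simp add: vertices_def extreme_point_of_convex_hull_affine_independent)
  then have cB: "card ?B = CARD('n)" using C(2) by (simp add: card_option)
  have sB: "span ?B = UNIV" using y(1,4) by (simp add: facet_normal_def)
  have finB: "finite ?B" using cB by (intro card_ge_0_finite) simp
  have ah: "affine hull ?B = {x. y \<bullet> x = 1}" by (rule affine_hull_hyperplane[OF finB sB yB])
  have "?B \<noteq> {}" using cB by auto
  then obtain b0 where b0: "b0 \<in> ?B" by blast
  show ?thesis
  proof (rule lattice_basis_int_spanI[OF finB _ Bl lattice_basis_unit_vec])
    show "card ?B \<le> CARD('n)" using cB by simp
    show "range unit_vec \<subseteq> int_span ?B"
    proof
      fix x :: "real ^ 'n" assume "x \<in> range unit_vec"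
      then have x: "x \<in> lattice" by auto
      obtain h :: int where h: "y \<bullet> x = of_int h" using lattice_inner[OF y(2) x] by (auto elim: Ints_cases)
      let ?w = "x - of_int (h - 1) *\<^sub>R b0"
      have "?w \<in> lattice" using x b0 Bl by (intro lattice_diff lattice_scale) auto
      moreover have "y \<bullet> ?w = 1" using h yB[OF b0] by (simp add: inner_diff_right)
      ultimately have "?w \<in> lattice_points (affine hull ?B)" by (simp add: lattice_points_def ah)
      then obtain c :: "_ \<Rightarrow> int" where "?w = (\<Sum>b\<in>?B. of_int (c b) *\<^sub>R b)" using ex by blast
      then have "?w \<in> int_span ?B" unfolding int_span_def by blast
      then have "?w + of_int (h - 1) *\<^sub>R b0 \<in> int_span ?B"
        using int_span_base[OF finB b0] by (intro int_span_add int_span_scale)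
      then show "x \<in> int_span ?B" by simp
    qed
  qed
qed

lemma reflexive_bounded: "reflexive_polytope P \<Longrightarrow> bounded P"
  using reflexive_polytope_vertices(6) polytope_imp_bounded by blast

text \<open>The volume condition in the circuit relation makes each simplex obtained by omitting a
  point of \<open>I\<close> unimodular, also for input polytopes that are not projections. Without
  it a run could get stuck for lack of a transformation.\<close>

lemma circuit_facet_bases:
  fixes P :: "(real ^ 'n) set"
  assumes P: "reflexive_polytope P" and G: "G facet_of P" and c: "circuit_facet G"
    and rel: "circuit_relation G I J k" and v: "v \<in> I"
  shows "lattice_basis (lattice_points G - {v})" "finite (lattice_points G)" "span (lattice_points G) = UNIV"
proof -
  obtain y where y: "facet_normal (vertices P) y" "y \<in> lattice" "G = convex hull (tight (vertices P) y)"
    "vertices G = tight (vertices P) y" "\<And>x. x \<in> G \<Longrightarrow> y \<bullet> x = 1"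
    using reflexive_facetE[OF P G] by blast
  let ?X = "lattice_points G"
  have GP: "G \<subseteq> P" using G facet_of_imp_subset by blast
  show fin: "finite ?X" using finite_lattice_points bounded_subset[OF reflexive_bounded[OF P] GP] by blast
  have tX: "tight (vertices P) y \<subseteq> ?X"
    using reflexive_polytope_vertices(3)[OF P] hull_inc[of _ "tight (vertices P) y" convex] y(3)
    by (auto simp: lattice_points_def tight_def)
  then show sp: "span ?X = UNIV" using y(1) span_mono[OF tX] by (auto simp: facet_normal_def)
  have hull: "convex hull ?X = G"
  proof
    have "convex G" using y(3) by simp
    then show "convex hull ?X \<subseteq> G" by (intro hull_minimal) (auto simp: lattice_points_def)
    show "G \<subseteq> convex hull ?X" unfolding y(3) using tX y(3) by (intro hull_mono) simp
  qed
  have Xl: "?X \<subseteq> lattice" and XG: "?X \<subseteq> G" by (auto simp: lattice_points_def)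
  have cX: "card ?X = CARD('n) + 1" using c by (simp add: circuit_facet_def card_option)
  have IJ: "I \<subseteq> ?X" "J \<subseteq> ?X" "I \<inter> J = {}" "I \<noteq> {}"
    and eq: "(\<Sum>v\<in>I. v) = (\<Sum>v\<in>J. of_nat (k v) *\<^sub>R v)" "(\<Sum>v\<in>J. k v) = card I" "real (card I) = normalized_volume G"
    using rel unfolding circuit_relation_def by blast+
  have "normalized_volume (convex hull ?X) = real (card I) \<longleftrightarrow> (\<forall>v\<in>I. lattice_basis (?X - {v}))"
    by (rule normalized_volume_circuit[OF fin Xl cX sp _ y(2) IJ eq(1,2)]) (use XG y(5) in blast)
  then show "lattice_basis (?X - {v})" using eq(3) hull v by simp
qed

lemma base_simplex_basis:
  fixes P :: "(real ^ 'n) set"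
  assumes P: "reflexive_polytope P" and C: "C \<in> base_simplices P"
  shows "lattice_basis (vertices C)"
proof -
  consider "C facet_of P" "unimodular_facet C" |
    G I J c v where "C = convex hull (lattice_points G - {v})" "G facet_of P" "circuit_facet G"
      "circuit_relation G I J c" "v \<in> I"
    using C by (auto simp: base_simplices_def)
  then show ?thesis
  proof cases
    case 1
    then show ?thesis using unimodular_facet_vertices[OF P] by blast
  next
    case 2
    note B = circuit_facet_bases(1)[OF P 2(2-5)]
    show ?thesis using independent_vertices[OF lattice_basisD(2)[OF B]] B 2(1) by simp
  qed
qed

lemma lattice_basis_to_unit_vec:
  fixes B :: "(real ^ 'n) set"
  assumes B: "lattice_basis B"
  shows "\<exists>f\<in>lattice_transformations. f ` B = range unit_vec"
proof -
  obtain g :: "real ^ 'n \<Rightarrow> 'n" where g: "bij_betw g B UNIV"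
    using lattice_basisD(3,5)[OF B] finite_same_card_bij[of B "UNIV :: 'n set"] by auto
  have im: "(unit_vec \<circ> g) ` B = range unit_vec"
    using bij_betw_imp_surj_on[OF g] by (metis image_comp)
  obtain f where f: "f \<in> lattice_transformations" "\<forall>b\<in>B. f b = (unit_vec \<circ> g) b"
    using lattice_basis_linear_extend[OF B, of "unit_vec \<circ> g"] lattice_basis_unit_vec im by auto
  then have "f ` B = (unit_vec \<circ> g) ` B" by auto
  then show ?thesis using f(1) im by auto
qed

lemma admissible_transformations_exists:
  fixes Ps :: "(real ^ 'n) set list"
  assumes "\<forall>P\<in>set Ps. reflexive_polytope P"
  shows "\<exists>T. admissible_transformations Ps T"
proof -
  define T where "T = (\<lambda>(P :: (real ^ 'n) set) C. SOME f :: real ^ 'n \<Rightarrow> real ^ 'n.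
     f \<in> lattice_transformations \<and> f ` vertices C = range unit_vec)"
  have "T P C \<in> lattice_transformations \<and> T P C ` vertices C = range unit_vec"
    if P: "P \<in> set Ps" and C: "C \<in> base_simplices P" for P C
  proof -
    have "reflexive_polytope P" using assms P by blast
    then have "\<exists>f. f \<in> lattice_transformations \<and> f ` vertices C = range unit_vec"
      using lattice_basis_to_unit_vec[OF base_simplex_basis[OF _ C]] by blast
    then show ?thesis unfolding T_def by (rule someI_ex)
  qed
  then have "admissible_transformations Ps T" unfolding admissible_transformations_def by blast
  then show ?thesis by blast
qed

section \<open>Finiteness of the output\<close>

lemma finite_base_simplices:
  fixes P :: "(real ^ 'n) set"
  assumes P: "reflexive_polytope P"
  shows "finite (base_simplices P)"
proof -
  have "base_simplices P \<subseteq> {G. G facet_of P} \<union> (\<lambda>S. convex hull S) ` Pow (lattice_points P)"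
    using facet_of_imp_subset by (fastforce simp: base_simplices_def lattice_points_def)
  moreover have "finite {G. G facet_of P}"
    using finite_polytope_facets reflexive_polytope_vertices(6)[OF P] by blast
  moreover have "finite (lattice_points P)" using finite_lattice_points reflexive_bounded[OF P] by blast
  ultimately show ?thesis by (auto intro: finite_subset)
qed

text \<open>There are infinitely many height functions, as their values away from the lattice points
  are arbitrary. Finiteness concerns the outputs: each is the hull of a subset of the finite set
  \<open>Z (P, C)\<close> of all points that can occur.\<close>

lemma finite_constructed_polytopes:
  fixes Ps :: "(real ^ 'n) set list"
  assumes Ps: "\<forall>P\<in>set Ps. reflexive_polytope P" and T: "admissible_transformations Ps T"
  shows "finite (constructed_polytopes Ps T)"
proof -
  define Z where "Z = (\<lambda>(P, C). let A = (\<lambda>(w, j). lift_point (\<lambda>_. j) w) `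
      (lattice_points (T P C ` P) \<times> {-1..int CARD('n option)}) in
      A \<union> (\<lambda>x. x - unit_vec None) ` A \<union> {- unit_vec None})"
  let ?I = "{(P, C). P \<in> set Ps \<and> admissible_polytope P \<and> C \<in> base_simplices P}"
  have "constructed_polytopes Ps T \<subseteq> (\<Union>i\<in>?I. (\<lambda>S. convex hull S) ` Pow (Z i))"
  proof
    fix R assume "R \<in> constructed_polytopes Ps T"
    then obtain P C k D where R: "R = convex hull (lifted_points (T P C ` P) k D)"
      and I: "(P, C) \<in> ?I" and k: "admissible_heights (T P C ` P) k"
      and D: "admissible_double_points (T P C ` P) k D"
      by (auto simp: constructed_polytopes_def)
    let ?A = "(\<lambda>(w, j). lift_point (\<lambda>_. j) w) ` (lattice_points (T P C ` P) \<times> {-1..int CARD('n option)})"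
    have kr: "k w \<in> {-1..int CARD('n option)}" if "w \<in> lattice_points (T P C ` P)" for w
    proof (cases "w \<in> insert 0 (range unit_vec)")
      case True
      then show ?thesis using k by (auto simp: admissible_heights_def Let_def)
    next
      case False
      then have "0 \<le> k w \<and> k w \<le> int CARD('n option) - 1"
        using k that unfolding admissible_heights_def Let_def by blast
      then show ?thesis by simp
    qed
    have A: "lift_point k w \<in> ?A" if "w \<in> lattice_points (T P C ` P)" for w
    proof -
      have "lift_point k w = (\<lambda>(w, j). lift_point (\<lambda>_. j) w) (w, k w)" by (simp add: lift_point_def)
      then show ?thesis by (rule image_eqI[OF _ SigmaI[OF that kr[OF that]]])
    qed
    have DL: "D \<subseteq> lattice_points (T P C ` P)" using D unfolding admissible_double_points_def by (rule conjunct1)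
    have ZA: "Z (P, C) = ?A \<union> (\<lambda>x. x - unit_vec None) ` ?A \<union> {- unit_vec None}"
      unfolding Z_def Let_def by simp
    have "lift_point k ` lattice_points (T P C ` P) \<subseteq> ?A" using A by (rule image_subsetI)
    moreover have "{lift_point k w - unit_vec None | w. w \<in> D - {0}} \<subseteq> (\<lambda>x. x - unit_vec None) ` ?A"
    proof
      fix x assume "x \<in> {lift_point k w - unit_vec None | w. w \<in> D - {0}}"
      then obtain w where w: "x = lift_point k w - unit_vec None" "w \<in> D" by blast
      show "x \<in> (\<lambda>x. x - unit_vec None) ` ?A"
        unfolding w(1) using A DL w(2) by (intro imageI) blast
    qed
    moreover have "(if 0 \<in> D then {- unit_vec None} else {}) \<subseteq> {- unit_vec None}" by simp
    ultimately have "lifted_points (T P C ` P) k D \<subseteq> Z (P, C)"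
      unfolding lifted_points_def ZA by (intro Un_mono)
    then have "R \<in> (\<lambda>S. convex hull S) ` Pow (Z (P, C))" unfolding R by (intro imageI PowI)
    then show "R \<in> (\<Union>i\<in>?I. (\<lambda>S. convex hull S) ` Pow (Z i))" by (rule UN_I[OF I])
  qed
  moreover have "finite ?I"
  proof -
    have "?I \<subseteq> (SIGMA P:set Ps. base_simplices P)" by auto
    then show ?thesis by (rule finite_subset) (use finite_base_simplices Ps in auto)
  qed
  moreover have "finite (Z i)" if i: "i \<in> ?I" for i
  proof -
    obtain P C where PC: "i = (P, C)" "P \<in> set Ps" "admissible_polytope P" "C \<in> base_simplices P" using i by blast
    then have "T P C \<in> lattice_transformations" using T by (auto simp: admissible_transformations_def)
    then have "linear (T P C)" unfolding lattice_transformations_eq by blast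
    then have "bounded (T P C ` P)"
      using reflexive_bounded Ps PC(2) bounded_linear_image linear_conv_bounded_linear by blast
    then have "finite (lattice_points (T P C ` P))" by (rule finite_lattice_points)
    then show ?thesis by (simp add: Z_def PC(1) Let_def)
  qed
  ultimately show ?thesis by (auto intro: finite_subset)
qed

lemma algorithm_run_exists:
  fixes Ps :: "(real ^ 'n) set list"
  assumes Ps: "\<forall>P\<in>set Ps. reflexive_polytope P"
  shows "\<exists>L. algorithm_run Ps L"
proof -
  obtain e :: "nat \<Rightarrow> 'n option" where e: "bij_betw e {..<CARD('n option)} UNIV"
    using finite_same_card_bij[of "{..<CARD('n option)}" "UNIV :: 'n option set"] by auto
  obtain T where T: "admissible_transformations Ps T" using admissible_transformations_exists[OF Ps] by blast
  let ?S = "{fano_simplex} \<union> (if even CARD('n option) then {hexagon_sum e} else {}) \<union> constructed_polytopes Ps T"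
  have "finite ?S" using finite_constructed_polytopes[OF Ps T] by simp
  from finite_list[OF this] obtain L where L: "set L = ?S" by (rule exE)
  show ?thesis unfolding algorithm_run_def by (intro exI conjI) (rule e, rule T, rule L)
qed

lemma algorithm_run_fano:
  fixes Ps :: "(real ^ 'n) set list"
  assumes "algorithm_run Ps L" "F \<in> set L"
  shows "fano_polytope F"
proof -
  obtain e T where e: "bij_betw e {..<CARD('n option)} (UNIV :: 'n option set)"
    and "F \<in> {fano_simplex} \<union> (if even CARD('n option) then {hexagon_sum e} else {}) \<union> constructed_polytopes Ps T"
    using assms unfolding algorithm_run_def by blast
  then consider "F = fano_simplex" | "even CARD('n option)" "F = hexagon_sum e" | "F \<in> constructed_polytopes Ps T"
    by (auto split: if_splits)
  then show ?thesis
  proof cases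
    case 1
    then show ?thesis by (simp add: fano_polytope_fano_simplex)
  next
    case 2
    then show ?thesis using fano_set_polytope[OF fano_set_hexagon_points[OF e]] by (simp add: hexagon_sum_eq)
  next
    case 3
    then show ?thesis by (auto simp: constructed_polytopes_def)
  qed
qed

section \<open>Projection along a vertex\<close>

text \<open>The quotient map is left arbitrary, because it is composed later with lattice
  transformations that carry the projection to an input polytope and then to standard
  position.\<close>

locale fano_projection =
  fixes V :: "(real ^ 'm) set" and v :: "real ^ 'm" and \<pi> :: "real ^ 'm \<Rightarrow> real ^ 'n"
  assumes V: "fano_set V" and vV: "v \<in> V" and lin: "linear \<pi>" and lat: "\<pi> ` lattice = lattice"
    and ker: "\<And>x. \<pi> x = 0 \<longleftrightarrow> (\<exists>c. x = c *\<^sub>R v)" and cardm: "CARD('m) = CARD('n) + 1"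
begin

lemmas VD = fano_setD[OF V]

definition "W = \<pi> ` V"

definition "pull = adjoint \<pi>"

lemma pull: "pull y \<bullet> x = y \<bullet> \<pi> x"
  using adjoint_works[OF lin, of x y] by (simp add: pull_def inner_commute)

lemma \<pi>v [simp]: "\<pi> v = 0"
  using ker[of v] by (metis scaleR_one)

lemma v0: "v \<noteq> 0" using vV VD(3) by auto

lemma vl: "v \<in> lattice" using vV VD(2) by auto

lemma \<pi>l: "x \<in> lattice \<Longrightarrow> \<pi> x \<in> lattice" using lat by blast

lemma ker_eq: "\<pi> x = \<pi> x' \<Longrightarrow> \<exists>c. x - x' = c *\<^sub>R v"
  using ker[of "x - x'"] by (simp add: linear_diff[OF lin])

lemma surj: "surj \<pi>"
proof -
  have "range unit_vec \<subseteq> range \<pi>" using lat lattice_unit_vec by (metis image_mono image_subsetI top_greatest subset_trans)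
  moreover have "subspace (range \<pi>)" using linear_subspace_image[OF lin subspace_UNIV] .
  ultimately have "span (range unit_vec) \<subseteq> range \<pi>" by (intro span_minimal)
  then show ?thesis using span_unit_vec by blast
qed

lemma hull_W: "convex hull W = \<pi> ` (convex hull V)"
  unfolding W_def by (rule convex_hull_linear_image[OF lin, symmetric])

lemma finW: "finite W" using VD(1) by (simp add: W_def)

lemma Wl: "W \<subseteq> lattice" using VD(2) \<pi>l by (auto simp: W_def)

lemma intW: "0 \<in> interior (convex hull W)"
proof -
  have "open (\<pi> ` interior (convex hull V))"
    by (rule open_surjective_linear_image[OF open_interior lin surj])
  then have "\<pi> ` interior (convex hull V) \<subseteq> interior (\<pi> ` (convex hull V))"
    by (intro interior_maximal image_mono interior_subset)
  moreover have "0 \<in> \<pi> ` interior (convex hull V)" using VD(4) linear_0[OF lin] by (metis imageI)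
  ultimately show ?thesis by (auto simp: hull_W)
qed

lemma tight_W: "tight W y = \<pi> ` tight V (pull y)"
  unfolding W_def pull_def by (rule tight_image[OF lin])

lemma spanning:
  assumes "span (\<pi> ` A) = UNIV" "v \<in> span A"
  shows "span A = UNIV"
proof -
  have "x \<in> span A" for x
  proof -
    have "\<pi> x \<in> \<pi> ` span A" using assms(1) linear_span_image[OF lin] by simp
    then obtain a where a: "a \<in> span A" "\<pi> x = \<pi> a" by blast
    obtain c where c: "x - a = c *\<^sub>R v" using ker_eq[OF a(2)] by blast
    have "a + c *\<^sub>R v \<in> span A" using a(1) assms(2) by (intro span_add span_scale)
    then show ?thesis using c by (metis add.commute diff_add_cancel)
  qed
  then show ?thesis by blast
qed

lemma projected_basis:
  assumes B: "lattice_basis (insert v A)" and vA: "v \<notin> A"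
  shows "lattice_basis (\<pi> ` A)" "inj_on \<pi> A" "card A = CARD('n)"
proof -
  note BD = lattice_basisD[OF B]
  have finA: "finite A" using BD(3) by simp
  show cA: "card A = CARD('n)" using BD(5) vA finA cardm by simp
  show b: "lattice_basis (\<pi> ` A)"
  proof (rule lattice_basis_int_spanI[OF _ _ _ lattice_basis_unit_vec])
    show fin: "finite (\<pi> ` A)" using finA by simp
    show "card (\<pi> ` A) \<le> CARD('n)" using card_image_le[OF finA] cA by simp
    show "\<pi> ` A \<subseteq> lattice" using BD(1) \<pi>l by auto
    show "range unit_vec \<subseteq> int_span (\<pi> ` A)"
    proof
      fix x :: "real ^ 'n" assume "x \<in> range unit_vec"
      then have "x \<in> lattice" by auto
      then obtain x' where x': "x' \<in> lattice" "x = \<pi> x'" using lat by blast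
      obtain c :: "_ \<Rightarrow> int" where c: "x' = (\<Sum>b\<in>insert v A. of_int (c b) *\<^sub>R b)"
        using lattice_basis_expand[OF B x'(1)] by blast
      have xe: "x = (\<Sum>b\<in>A. of_int (c b) *\<^sub>R \<pi> b)"
        using vA finA by (simp add: x'(2) c linear_add[OF lin] linear_sum[OF lin] linear_scale[OF lin])
      show "x \<in> int_span (\<pi> ` A)"
        unfolding xe by (intro int_span_sum int_span_scale int_span_base[OF fin] imageI)
    qed
  qed
  then show "inj_on \<pi> A" using lattice_basisD(5)[OF b] cA finA by (intro eq_card_imp_inj_on) auto
qed

text \<open>If \<open>v\<close> lies in the span of the tight points, these span the space and form
  a facet parallel to \<open>v\<close>. Otherwise some \<open>z\<close> vanishes on them and is 1 at
  \<open>v\<close>, and tilting along \<open>z\<close> reaches a facet on which \<open>v\<close> has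
  height \<open>t\<close>. This is a positive integer not exceeding 1, so \<open>v\<close> is on the
  facet, and counting leaves no further vertex.\<close>

lemma facet_lift:
  assumes y: "facet_normal W y"
  defines "A \<equiv> tight V (pull y)"
  shows "v \<notin> A" "(lattice_basis (insert v A) \<and> (\<exists>u. facet_normal V u \<and> tight V u = insert v A)) \<or>
     facet_normal V (pull y)"
proof -
  have pv: "pull y \<bullet> v = 0" by (simp add: pull)
  show vA: "v \<notin> A" using pv by (auto simp: A_def tight_def)
  have le: "pull y \<bullet> x \<le> 1" if "x \<in> V" for x
    using facet_normal_le[OF y, of "\<pi> x"] that by (simp add: pull W_def)
  have sp: "span (\<pi> ` A) = UNIV" using y tight_W by (simp add: facet_normal_def A_def)
  show "(lattice_basis (insert v A) \<and> (\<exists>u. facet_normal V u \<and> tight V u = insert v A)) \<or> facet_normal V (pull y)"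
  proof (cases "v \<in> span A")
    case True
    then show ?thesis using spanning[OF sp True] le by (auto simp: facet_normal_def A_def)
  next
    case False
    obtain A0 where A0: "A0 \<subseteq> A" "independent A0" "A \<subseteq> span A0"
      by (rule basis_exists[of A])
    have "span A0 = span A"
    proof
      show "span A0 \<subseteq> span A" by (rule span_mono[OF A0(1)])
      show "span A \<subseteq> span A0" by (rule span_minimal[OF A0(3) subspace_span])
    qed
    then have ind: "independent (insert v A0)" using False A0(2) by (intro independent_insertI) auto
    define z where "z = dual_vec (insert v A0) v"
    have vA0: "v \<notin> A0" using vA A0 by auto
    have zv: "z \<bullet> v = 1" using dual_vec[OF ind, of v v] by (simp add: z_def)
    have "z \<bullet> a = 0" if "a \<in> A0" for a using dual_vec[OF ind, of a v] that vA0 by (auto simp: z_def)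
    then have zs: "z \<bullet> a = 0" if "a \<in> span A0" for a
      using linear_eq_0_on_span[of "\<lambda>x. z \<bullet> x" A0 a] that
      by (simp add: bounded_linear.linear bounded_linear_inner_right)
    have zA: "z \<bullet> a = 0" if "a \<in> A" for a using zs A0(3) that by blast
    have z0: "z \<noteq> 0" using zv by auto
    have "\<exists>t>0. (\<forall>w\<in>V. (pull y + t *\<^sub>R z) \<bullet> w \<le> 1) \<and> (\<exists>n\<in>V. z \<bullet> n > 0 \<and> (pull y + t *\<^sub>R z) \<bullet> n = 1)"
      by (rule tilt[OF VD(1,4) le z0]) (use zA in \<open>auto simp: A_def\<close>)
    then obtain t n where t: "t > 0" "\<And>w. w \<in> V \<Longrightarrow> (pull y + t *\<^sub>R z) \<bullet> w \<le> 1"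
      and n: "n \<in> V" "z \<bullet> n > 0" "(pull y + t *\<^sub>R z) \<bullet> n = 1" by blast
    let ?u = "pull y + t *\<^sub>R z"
    have AT: "A \<subseteq> tight V ?u"
      using zA by (auto simp: A_def tight_def inner_add_left)
    have nT: "n \<in> tight V ?u" using n by (simp add: tight_def)
    \<comment> \<open>Modulo \<open>v\<close> the new vertex \<open>n\<close> is a combination of
      the old tight points; since \<open>z\<close> distinguishes it from them, \<open>v\<close>
      itself becomes a combination of tight points.\<close>
    have "\<pi> n \<in> \<pi> ` span A" using sp linear_span_image[OF lin] by simp
    then obtain a where a: "a \<in> span A" "\<pi> n = \<pi> a" by blast
    obtain c where c: "n - a = c *\<^sub>R v" using ker_eq[OF a(2)] by blast
    have "z \<bullet> a = 0" using zs a(1) \<open>span A0 = span A\<close> by simp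
    then have "c = z \<bullet> n" using arg_cong[OF c, of "\<lambda>x. z \<bullet> x"] zv by (simp add: inner_diff_right)
    then have c0: "c \<noteq> 0" using n(2) by simp
    have "n - a \<in> span (tight V ?u)"
      using a(1) span_mono[OF AT] span_base[OF nT] by (intro span_diff) auto
    then have "(1 / c) *\<^sub>R (c *\<^sub>R v) \<in> span (tight V ?u)" unfolding c by (rule span_scale)
    then have vs: "v \<in> span (tight V ?u)" using c0 by simp
    have "span (\<pi> ` tight V ?u) = UNIV" using sp span_mono[OF image_mono[OF AT, of \<pi>]] by blast
    then have fu: "facet_normal V ?u" using spanning[OF _ vs] t(2) by (simp add: facet_normal_def)
    note B = VD(5)[OF fu]
    note BD = lattice_basisD[OF B]
    have uv: "?u \<bullet> v = t" using pv zv by (simp add: inner_add_left)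
    have "t \<in> \<int>" using facet_normal_int[OF V fu vl] uv by simp
    moreover have "t \<le> 1" using facet_normal_le[OF fu vV] uv by simp
    ultimately have "t = 1" using t(1) Ints_less_imp_le[OF Ints_0, of t] by simp
    then have vT: "v \<in> tight V ?u" using uv vV by (simp add: tight_def)
    have "finite A" using AT BD(3) finite_subset by blast
    moreover have "card A \<ge> CARD('n)"
    proof -
      have "DIM(real ^ 'n) \<le> card (\<pi> ` A)"
        using dim_le_card[of UNIV "\<pi> ` A"] sp \<open>finite A\<close> by simp
      also have "\<dots> \<le> card A" using \<open>finite A\<close> by (rule card_image_le)
      finally show ?thesis by simp
    qed
    ultimately have "insert v A = tight V ?u"
      using AT vT vA BD(3,5) cardm by (intro card_seteq) auto
    then show ?thesis using B fu by metis
  qed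
qed

text \<open>In both cases of \<open>facet_lift\<close> the functional \<open>pull y\<close> takes
  only the values 0 and 1 on a lattice basis, so it is integral. This is the reflexivity of the
  projection.\<close>

lemma facet_normal_lattice:
  assumes y: "facet_normal W y"
  shows "y \<in> lattice"
proof (rule latticeI_inner)
  fix x :: "real ^ 'n" assume "x \<in> lattice"
  then obtain x' where x': "x' \<in> lattice" "x = \<pi> x'" using lat by blast
  have t: "pull y \<bullet> b = 1" if "b \<in> tight V (pull y)" for b using that tight_inner by blast
  have "pull y \<bullet> x' \<in> \<int>"
    using facet_lift(2)[OF y]
  proof
    assume "lattice_basis (insert v (tight V (pull y))) \<and> (\<exists>u. facet_normal V u \<and> tight V u = insert v (tight V (pull y)))"
    then have "lattice_basis (insert v (tight V (pull y)))" by blast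
    then show ?thesis by (rule lattice_basis_funct_int[OF _ _ x'(1)]) (use t in \<open>auto simp: pull\<close>)
  next
    assume "facet_normal V (pull y)"
    then show ?thesis using facet_normal_int[OF V _ x'(1)] by blast
  qed
  then show "y \<bullet> x \<in> \<int>" by (simp add: pull x'(2))
qed

lemma reflexive: "reflexive_polytope (convex hull W)"
  by (rule reflexive_convex_hullI[OF finW intW Wl facet_normal_lattice])

lemma facet_iff: "G facet_of (convex hull W) \<longleftrightarrow> (\<exists>y. facet_normal W y \<and> G = convex hull (tight W y))"
  by (rule facet_of_convex_hull_iff[OF finW intW])

lemma tight_W_inner: "x \<in> convex hull (tight W y) \<Longrightarrow> y \<bullet> x = 1"
  using inner_eq_convex_hull[of "tight W y" y 1 x] tight_inner by blast

text \<open>As a vertex at height 0, \<open>v\<close> has coordinate -1 at some \<open>b\<close>.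
  Comparing the coordinates at \<open>b\<close> in \<open>a - a' = m *\<^sub>R v\<close> leaves only
  1 and -1 for \<open>m\<close>.\<close>

lemma fiber:
  assumes u: "facet_normal V u" and a: "a \<in> tight V u" "a' \<in> tight V u" and uv: "u \<bullet> v = 0"
    and eq: "\<pi> a = \<pi> a'" "a \<noteq> a'"
  shows "a - a' = v \<or> a' - a = v"
proof -
  interpret A: fano_facet V u by standard (fact V, fact u)
  obtain m where m: "a - a' = m *\<^sub>R v" using ker_eq[OF eq(1)] by blast
  have c: "m * (A.z b \<bullet> v) = (if a = b then 1 else 0) - (if a' = b then 1 else 0)" if "b \<in> A.B" for b
    using arg_cong[OF m, of "\<lambda>x. A.z b \<bullet> x"] A.zb[OF a(1), of b] A.zb[OF a(2), of b]
    by (simp add: inner_diff_right)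
  have m0: "m \<noteq> 0" using m eq(2) by auto
  have "v \<in> A.N0" using vV uv by simp
  then obtain b where b: "b \<in> A.B" "A.z b \<bullet> v < 0" using A.neg_coord by blast
  have "A.z b \<bullet> v = -1" using height_zero_neighbour(1)[OF V u b(1) vV uv b(2)] .
  then have "- m = (if a = b then 1 else 0) - (if a' = b then 1 else 0)" using c[OF b(1)] by simp
  then have "m = 1 \<or> m = -1" using m0 by (auto split: if_splits)
  then show ?thesis using m by (metis minus_diff_eq scaleR_minus1_left scaleR_one minus_minus)
qed

text \<open>The sets \<open>I\<close> and \<open>J\<close> of the circuit relation, lifted to a facet with normal \<open>u\<close> that is
  parallel to \<open>v\<close>.\<close>

definition "circI u = {a \<in> tight V u. dual_vec (tight V u) a \<bullet> v < 0}"
definition "circJ u = {a \<in> tight V u. dual_vec (tight V u) a \<bullet> v > 0}"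

context
  fixes u
  assumes u: "facet_normal V u" and uv: "u \<bullet> v = 0"
begin

interpretation A: fano_facet V u by standard (fact V, fact u)

lemma circ_coord: "a \<in> circI u \<Longrightarrow> A.z a \<bullet> v = -1" "a \<in> A.B \<Longrightarrow> A.z a \<bullet> v \<in> \<int>"
  "a \<in> circI u \<Longrightarrow> lattice_basis (insert v (A.B - {a}))" "v \<notin> A.B"
proof -
  show "a \<in> circI u \<Longrightarrow> A.z a \<bullet> v = -1"
    using height_zero_neighbour(1)[OF V u _ vV uv] by (auto simp: circI_def)
  show "a \<in> A.B \<Longrightarrow> A.z a \<bullet> v \<in> \<int>" using A.zint vV by blast
  assume "a \<in> circI u"
  then have a: "a \<in> A.B" "A.z a \<bullet> v < 0" by (auto simp: circI_def)
  show "lattice_basis (insert v (A.B - {a}))"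
    using height_zero_neighbour(2,3)[OF V u a(1) vV uv a(2)] VD(5) by metis
next
  show "v \<notin> A.B" using uv by (auto simp: tight_def)
qed

lemma circ_sets: "circI u \<subseteq> A.B" "circJ u \<subseteq> A.B" "circI u \<inter> circJ u = {}" "finite (circI u)" "finite (circJ u)"
  "circI u \<noteq> {}"
  using A.BD(3) A.neg_coord[of v] vV uv by (auto simp: circI_def circJ_def)

lemma circ_split: "(\<Sum>a\<in>A.B. f a) = (\<Sum>a\<in>circJ u. f a) + (\<Sum>a\<in>circI u. f a)"
  if "\<And>a. a \<in> A.B \<Longrightarrow> A.z a \<bullet> v = 0 \<Longrightarrow> f a = 0" for f :: "real ^ 'm \<Rightarrow> 'b::comm_monoid_add"
proof -
  have "(\<Sum>a\<in>A.B. f a) = (\<Sum>a\<in>circJ u \<union> circI u. f a)"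
  proof (rule sum.mono_neutral_right[OF A.BD(3)])
    show "\<forall>a\<in>A.B - (circJ u \<union> circI u). f a = 0"
    proof
      fix a assume a: "a \<in> A.B - (circJ u \<union> circI u)"
      then have "\<not> A.z a \<bullet> v < 0" "\<not> A.z a \<bullet> v > 0" by (auto simp: circI_def circJ_def)
      then show "f a = 0" using that a by (meson DiffD1 linorder_neqE_linordered_idom)
    qed
  qed (use circ_sets(1,2) in auto)
  also have "\<dots> = (\<Sum>a\<in>circJ u. f a) + (\<Sum>a\<in>circI u. f a)"
    using circ_sets by (intro sum.union_disjoint) auto
  finally show ?thesis .
qed

text \<open>The coordinates of \<open>v\<close> add up to its height 0, and the negative ones are
  all -1.\<close>

lemma circ_sum: "(\<Sum>a\<in>circJ u. A.z a \<bullet> v) = real (card (circI u))" "circJ u \<noteq> {}"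
proof -
  have "(\<Sum>a\<in>A.B. A.z a \<bullet> v) = 0" using A.height_sum[of v] uv by simp
  then have "(\<Sum>a\<in>circJ u. A.z a \<bullet> v) + (\<Sum>a\<in>circI u. A.z a \<bullet> v) = 0"
    using circ_split[of "\<lambda>a. A.z a \<bullet> v"] by simp
  moreover have "(\<Sum>a\<in>circI u. A.z a \<bullet> v) = - real (card (circI u))"
    using circ_coord(1) by simp
  ultimately show s: "(\<Sum>a\<in>circJ u. A.z a \<bullet> v) = real (card (circI u))" by simp
  show "circJ u \<noteq> {}"
  proof
    assume "circJ u = {}"
    then have "real (card (circI u)) = 0" using s by simp
    then show False using circ_sets(4,6) by simp
  qed
qed

text \<open>The expansion of \<open>v\<close> in the basis given by the facet, with the negative
  terms moved to the left. Projecting removes \<open>v\<close> and leaves the relation of type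
  \<open>(\<star>)\<close>.\<close>

lemma circ_relation: "v + (\<Sum>a\<in>circI u. a) = (\<Sum>a\<in>circJ u. (A.z a \<bullet> v) *\<^sub>R a)"
proof -
  have "v = (\<Sum>a\<in>A.B. (A.z a \<bullet> v) *\<^sub>R a)" by (rule A.expand)
  also have "\<dots> = (\<Sum>a\<in>circJ u. (A.z a \<bullet> v) *\<^sub>R a) + (\<Sum>a\<in>circI u. (A.z a \<bullet> v) *\<^sub>R a)"
    by (rule circ_split) simp
  also have "(\<Sum>a\<in>circI u. (A.z a \<bullet> v) *\<^sub>R a) = - (\<Sum>a\<in>circI u. a)"
    using circ_coord(1) by (simp add: sum_negf)
  finally show ?thesis by (simp add: algebra_simps)
qed

text \<open>The positive coordinates are integers with sum 1, so there is only one. Two vertices of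
  the facet then have the same image, and the projected facet is just a simplex.\<close>

lemma circ_singleton:
  assumes "card (circI u) = 1"
  shows "\<exists>i j. circI u = {i} \<and> j \<in> A.B \<and> j \<noteq> i \<and> v = j - i \<and> \<pi> i = \<pi> j"
proof -
  obtain i where i: "circI u = {i}" using assms card_1_singletonE by blast
  have s: "(\<Sum>a\<in>circJ u. A.z a \<bullet> v) = 1" using circ_sum(1) assms by simp
  have ge: "A.z a \<bullet> v \<ge> 1" if a: "a \<in> circJ u" for a
  proof -
    have "a \<in> A.B" "0 < A.z a \<bullet> v" using a by (auto simp: circJ_def)
    then show ?thesis using Ints_less_imp_le[OF Ints_0 circ_coord(2)] by simp
  qed
  obtain j where j: "j \<in> circJ u" using circ_sum(2) by blast
  have r: "A.z j \<bullet> v + (\<Sum>a\<in>circJ u - {j}. A.z a \<bullet> v) = 1"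
    using s sum.remove[OF circ_sets(5) j, of "\<lambda>a. A.z a \<bullet> v"] by simp
  have n: "(\<Sum>a\<in>circJ u - {j}. A.z a \<bullet> v) \<ge> real (card (circJ u - {j}))"
    using sum_mono[of "circJ u - {j}" "\<lambda>_. 1" "\<lambda>a. A.z a \<bullet> v"] ge by simp
  have "real (card (circJ u - {j})) \<le> real 0" using r n ge[OF j] by simp
  then have "card (circJ u - {j}) = 0" by (simp only: of_nat_le_iff le_zero_eq)
  then have "circJ u - {j} = {}" by (rule iffD1[OF card_0_eq[OF finite_Diff[OF circ_sets(5)]]])
  then have J: "circJ u = {j}" using j by blast
  then have "A.z j \<bullet> v = 1" using s by simp
  then have "v + i = j" using J circ_relation i \<open>A.z j \<bullet> v = 1\<close> by simp
  then have vji: "v = j - i" by (simp add: eq_diff_eq)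
  have "\<pi> v + \<pi> i = \<pi> j" using \<open>v + i = j\<close> linear_add[OF lin, of v i] by simp
  then have "\<pi> i = \<pi> j" by simp
  moreover have "j \<in> A.B" using j circ_sets(2) by blast
  moreover have "j \<noteq> i" using vji v0 by auto
  ultimately show ?thesis using i vji by blast
qed

text \<open>Two vertices of the facet with the same image differ by \<open>v\<close> up to sign, and
  a difference of two basis elements has a single negative coordinate.\<close>

lemma circ_inj:
  assumes "card (circI u) \<noteq> 1"
  shows "inj_on \<pi> A.B"
proof (rule inj_onI, rule ccontr)
  fix a a' assume a: "a \<in> A.B" "a' \<in> A.B" "\<pi> a = \<pi> a'" "a \<noteq> a'"
  have *: "False" if b: "b \<in> A.B" "b' \<in> A.B" "b - b' = v" "b \<noteq> b'" for b b'
  proof -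
    have zx: "A.z x \<bullet> v = (if b = x then 1 else 0) - (if b' = x then 1 else 0)" for x
      using A.zb[OF b(1), of x] A.zb[OF b(2), of x] by (simp add: b(3)[symmetric] inner_diff_right)
    then have "circI u = {b'}" using b by (auto simp: circI_def split: if_splits)
    then show False using assms by simp
  qed
  then show False using fiber[OF u a(1,2) uv a(3,4)] a by metis
qed

end

text \<open>The preimage of a facet of the projection is either a face of codimension two, or a facet
  parallel to \<open>v\<close>; in the latter case the coordinates of \<open>v\<close> give the circuit relation, which is
  degenerate if \<open>v\<close> is a difference of two vertices.\<close>

lemma facet_cases:
  assumes y: "facet_normal W y"
  defines "A \<equiv> tight V (pull y)" and "G \<equiv> convex hull (tight W y)"
  shows "(lattice_basis (\<pi> ` A) \<and> unimodular_facet G \<and> lattice_points G = \<pi> ` A \<and> \<not> circuit_facet G) \<or>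
    (facet_normal V (pull y) \<and> inj_on \<pi> A \<and> circuit_facet G \<and> lattice_points G = \<pi> ` A \<and>
     (\<exists>c. circuit_relation G (\<pi> ` circI (pull y)) (\<pi> ` circJ (pull y)) c))"
proof -
  have GA: "G = convex hull (\<pi> ` A)" by (simp add: G_def A_def tight_W)
  have yA: "y \<bullet> x = 1" if "x \<in> \<pi> ` A" for x using that tight_inner[of x W y] by (auto simp: tight_W A_def)
  have uni: "?thesis" if b: "lattice_basis (\<pi> ` A)"
  proof -
    have l: "lattice_points G = \<pi> ` A" unfolding GA by (rule lattice_points_simplex[OF b yA])
    \<comment> \<open>A unimodular facet has \<open>CARD('n)\<close> lattice points, one too few for
      a circuit.\<close>
    then have "\<not> circuit_facet G" using lattice_basisD(5)[OF b] by (simp add: circuit_facet_def card_option)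
    then show ?thesis using b l unimodular_facet_convex_hull[OF b] by (simp add: GA)
  qed
  have vA: "v \<notin> A" unfolding A_def by (rule facet_lift(1)[OF y])
  show ?thesis
  proof (cases "facet_normal V (pull y)")
    case False
    then have "lattice_basis (insert v A)" using facet_lift(2)[OF y] by (simp add: A_def)
    then show ?thesis using uni projected_basis(1)[OF _ vA] by blast
  next
    case u: True
    have uv: "pull y \<bullet> v = 0" by (simp add: pull)
    interpret A: fano_facet V "pull y" by standard (fact V, fact u)
    note cs = circ_sets[OF u uv]
    let ?I = "circI (pull y)" and ?J = "circJ (pull y)"
    have simp: "lattice_basis (\<pi> ` (A - {i}))" if i: "i \<in> ?I" for i
      using circ_coord(3)[OF u uv i] vA by (intro projected_basis(1)) (auto simp: A_def)
    show ?thesis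
    proof (cases "card ?I = 1")
      case True
      obtain i j where ij: "?I = {i}" "j \<in> A" "j \<noteq> i" "\<pi> i = \<pi> j"
        using circ_singleton[OF u uv True] by (auto simp: A_def)
      have "i \<in> A" using ij(1) cs(1) by (auto simp: A_def)
      then have "\<pi> ` A = \<pi> ` (A - {i})" using ij by auto
      then show ?thesis using uni simp[of i] ij(1) by simp
    next
      case False
      have inj: "inj_on \<pi> A" unfolding A_def by (rule circ_inj[OF u uv False])
      have IA: "?I \<subseteq> A" "?J \<subseteq> A" using cs by (auto simp: A_def)
      have injIJ: "inj_on \<pi> ?I" "inj_on \<pi> ?J" using inj IA inj_on_subset by blast+
      have finA: "finite A" using A.BD(3) by (simp add: A_def)
      have cX: "card (\<pi> ` A) = CARD('n) + 1" using A.BD(5) card_image[OF inj] cardm by (simp add: A_def)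
      have Xl: "\<pi> ` A \<subseteq> lattice" using A.BD(1) \<pi>l by (auto simp: A_def)
      have sX: "span (\<pi> ` A) = UNIV" using y tight_W by (simp add: facet_normal_def A_def)
      have IJ: "\<pi> ` ?I \<subseteq> \<pi> ` A" "\<pi> ` ?J \<subseteq> \<pi> ` A" "\<pi> ` ?I \<inter> \<pi> ` ?J = {}" "\<pi> ` ?I \<noteq> {}" "\<pi> ` ?J \<noteq> {}"
        using IA cs inj_on_image_Int[OF inj IA] circ_sum(2)[OF u uv] by auto
      \<comment> \<open>The positive coordinates of \<open>v\<close>, converted to natural numbers
        and indexed by projected points, as a circuit relation requires.\<close>
      define c where "c = (\<lambda>w. nat \<lfloor>A.z (inv_into A \<pi> w) \<bullet> v\<rfloor>)"
      have cJ: "real (c (\<pi> a)) = A.z a \<bullet> v" if a: "a \<in> ?J" for a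
      proof -
        have "inv_into A \<pi> (\<pi> a) = a" using inj IA(2) a by (intro inv_into_f_f) auto
        moreover have "A.z a \<bullet> v > 0" using a by (simp add: circJ_def)
        moreover have "A.z a \<bullet> v \<in> \<int>" using circ_coord(2)[OF u uv] a cs(2) by blast
        ultimately show ?thesis by (simp add: c_def)
      qed
      have "\<pi> (v + (\<Sum>a\<in>?I. a)) = \<pi> (\<Sum>a\<in>?J. (A.z a \<bullet> v) *\<^sub>R a)" using circ_relation[OF u uv] by simp
      then have "(\<Sum>a\<in>?I. \<pi> a) = (\<Sum>a\<in>?J. (A.z a \<bullet> v) *\<^sub>R \<pi> a)"
        by (simp add: linear_add[OF lin] linear_sum[OF lin] linear_scale[OF lin])
      also have "\<dots> = (\<Sum>a\<in>?J. of_nat (c (\<pi> a)) *\<^sub>R \<pi> a)" by (rule sum.cong) (auto simp: cJ)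
      finally have rel: "(\<Sum>w\<in>\<pi> ` ?I. w) = (\<Sum>w\<in>\<pi> ` ?J. of_nat (c w) *\<^sub>R w)"
        by (simp add: sum.reindex[OF injIJ(1)] sum.reindex[OF injIJ(2)])
      have "real (\<Sum>w\<in>\<pi> ` ?J. c w) = (\<Sum>a\<in>?J. real (c (\<pi> a)))" by (simp add: sum.reindex[OF injIJ(2)])
      also have "\<dots> = (\<Sum>a\<in>?J. A.z a \<bullet> v)" by (rule sum.cong) (auto simp: cJ)
      also have "\<dots> = real (card (\<pi> ` ?I))" using circ_sum(1)[OF u uv] card_image[OF injIJ(1)] by simp
      finally have sc: "(\<Sum>w\<in>\<pi> ` ?J. c w) = card (\<pi> ` ?I)" by linarith
      have simp': "lattice_basis (\<pi> ` A - {w})" if w: "w \<in> \<pi> ` ?I" for w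
      proof -
        obtain i where i: "i \<in> ?I" "w = \<pi> i" using w by blast
        have "\<pi> ` (A - {i}) = \<pi> ` A - {w}" using inj_on_image_set_diff[OF inj, of A "{i}"] i IA by auto
        then show ?thesis using simp[OF i(1)] by simp
      qed
      have vol: "normalized_volume G = real (card (\<pi> ` ?I))"
        unfolding GA
        using normalized_volume_circuit[OF _ Xl cX sX yA facet_normal_lattice[OF y] IJ(1-4) rel sc] finA simp'
        by simp
      \<comment> \<open>The simplices of the triangulation are unimodular and so contain no lattice
        points except their vertices.\<close>
      have lp: "lattice_points G = \<pi> ` A"
      proof (intro equalityI subsetI)
        fix x assume x: "x \<in> lattice_points G"
        then have "x \<in> (\<Union>w\<in>\<pi> ` ?I. convex hull (\<pi> ` A - {w}))"
          using circuit_triangulation[OF _ IJ(1-4) rel sc] finA by (simp add: lattice_points_def GA)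
        then obtain w where w: "w \<in> \<pi> ` ?I" "x \<in> convex hull (\<pi> ` A - {w})" by blast
        have "lattice_points (convex hull (\<pi> ` A - {w})) = \<pi> ` A - {w}"
          by (rule lattice_points_simplex[OF simp'[OF w(1)] yA]) auto
        then show "x \<in> \<pi> ` A" using x w(2) by (auto simp: lattice_points_def)
      next
        fix x assume x: "x \<in> \<pi> ` A"
        then show "x \<in> lattice_points G" using Xl hull_inc[OF x, of convex] by (auto simp: lattice_points_def GA)
      qed
      have cpos: "\<forall>w\<in>\<pi> ` ?J. 0 < c w"
      proof
        fix w assume "w \<in> \<pi> ` ?J"
        then obtain a where a: "a \<in> ?J" "w = \<pi> a" by blast
        have "A.z a \<bullet> v > 0" using a by (simp add: circJ_def)
        then show "0 < c w" using cJ[OF a(1)] a(2) by (metis of_nat_0_less_iff)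
      qed
      have "circuit_relation G (\<pi> ` ?I) (\<pi> ` ?J) c"
        unfolding circuit_relation_def lp using IJ cpos rel sc vol by simp
      moreover from this have "circuit_facet G"
        unfolding circuit_facet_def using lp cX by (auto simp: card_option)
      ultimately show ?thesis using u inj lp by blast
    qed
  qed
qed

end

section \<open>Fibers over lattice points and double points\<close>

context fano_projection begin

text \<open>On the facet whose cone contains \<open>s\<close> the height of \<open>s\<close> is a
  positive integer and at most 1, so \<open>s\<close> lies on the facet, whose lattice points are
  known. The bounds on heights are assumed directly because \<open>s\<close> will also be a sum of
  two double points.\<close>

lemma lattice_cone_facet:
  assumes s: "s \<in> lattice" "s \<noteq> 0" and le: "\<And>y. facet_normal W y \<Longrightarrow> y \<bullet> s \<le> 1"
  shows "\<exists>y. facet_normal W y \<and> s \<in> \<pi> ` tight V (pull y)"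
proof -
  obtain y c where y: "facet_normal W y" and c: "\<forall>b\<in>tight W y. c b \<ge> 0" "s = (\<Sum>b\<in>tight W y. c b *\<^sub>R b)"
    using in_cone_of_facet[OF finW intW s(2)] by blast
  have fin: "finite (tight W y)" using finite_subset[OF tight_subset finW] .
  have ys: "y \<bullet> s = sum c (tight W y)" unfolding c(2) by (simp add: inner_sum_right tight_inner)
  have "sum c (tight W y) \<noteq> 0"
  proof
    assume "sum c (tight W y) = 0"
    then have "\<forall>b\<in>tight W y. c b = 0" using c(1) fin by (subst (asm) sum_nonneg_eq_0_iff) auto
    then have "s = 0" unfolding c(2) by (intro sum.neutral) auto
    then show False using s(2) by simp
  qed
  moreover have "sum c (tight W y) \<ge> 0" using c(1) by (simp add: sum_nonneg)
  ultimately have "y \<bullet> s > 0" using ys by simp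
  then have "y \<bullet> s \<ge> 1"
    using Ints_less_imp_le[OF Ints_0 lattice_inner[OF facet_normal_lattice[OF y] s(1)]] by simp
  then have "sum c (tight W y) = 1" using le[OF y] ys by simp
  then have "s \<in> convex hull (tight W y)" using c fin by (auto simp: convex_hull_finite)
  then have "s \<in> lattice_points (convex hull (tight W y))" using s(1) by (simp add: lattice_points_def)
  then show ?thesis using y facet_cases[OF y] by auto
qed

lemma lattice_point_facet:
  assumes "w \<in> lattice_points (convex hull W)" "w \<noteq> 0"
  shows "\<exists>y. facet_normal W y \<and> w \<in> \<pi> ` tight V (pull y)"
proof (rule lattice_cone_facet)
  show "w \<in> lattice" "w \<noteq> 0" using assms by (auto simp: lattice_points_def)
  show "y \<bullet> w \<le> 1" if "facet_normal W y" for y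
    using inner_le_convex_hull[of W y 1 w] facet_normal_le[OF that] assms(1) by (auto simp: lattice_points_def)
qed

lemma lattice_points_W: "lattice_points (convex hull W) = W"
proof (intro equalityI subsetI)
  fix w assume w: "w \<in> lattice_points (convex hull W)"
  show "w \<in> W"
  proof (cases "w = 0")
    case True
    then show ?thesis using vV \<pi>v unfolding W_def by (metis imageI)
  next
    case False
    then obtain y where "w \<in> \<pi> ` tight V (pull y)" using lattice_point_facet[OF w] by blast
    then show ?thesis using tight_subset unfolding W_def by blast
  qed
next
  fix w assume "w \<in> W"
  then show "w \<in> lattice_points (convex hull W)" using Wl hull_inc[of w W convex] by (auto simp: lattice_points_def)
qed

lemma mem_tight_pull: "x \<in> V \<Longrightarrow> y \<bullet> \<pi> x = 1 \<Longrightarrow> x \<in> tight V (pull y)"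
  by (simp add: tight_def pull)

lemma fiber_cases:
  assumes y: "facet_normal W y" and a: "a \<in> V" "b \<in> V" "\<pi> a = \<pi> b" "y \<bullet> \<pi> a = 1" "a \<noteq> b"
  shows "facet_normal V (pull y)" "a - b = v \<or> b - a = v"
proof -
  let ?A = "tight V (pull y)"
  have A: "a \<in> ?A" "b \<in> ?A" using a by (auto intro: mem_tight_pull)
  have "\<not> inj_on \<pi> ?A" using A a by (auto simp: inj_on_def)
  then have "\<not> lattice_basis (insert v ?A)" using projected_basis(2)[OF _ facet_lift(1)[OF y]] by blast
  then show u: "facet_normal V (pull y)" using facet_lift(2)[OF y] by blast
  show "a - b = v \<or> b - a = v" by (rule fiber[OF u A _ a(3,5)]) (simp add: pull)
qed

text \<open>Any two vertices over \<open>w\<close> differ by \<open>v\<close> up to sign, so a third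
  one is impossible: some two of them would differ by \<open>2 v\<close>.\<close>

lemma fiber_top:
  assumes w: "w \<in> lattice_points (convex hull W)" "w \<noteq> 0"
  shows "\<exists>x\<in>V. \<pi> x = w \<and> (\<forall>x'\<in>V. \<pi> x' = w \<longrightarrow> x' = x \<or> x' = x - v)"
proof -
  obtain y a where y: "facet_normal W y" and a: "a \<in> tight V (pull y)" "w = \<pi> a"
    using lattice_point_facet[OF w] by blast
  have aV: "a \<in> V" using a(1) tight_subset by blast
  have yw: "y \<bullet> w = 1" using tight_inner[OF a(1)] a(2) by (simp add: pull)
  have pair: "x - x' = v \<or> x' - x = v" if "x \<in> V" "x' \<in> V" "\<pi> x = w" "\<pi> x' = w" "x \<noteq> x'" for x x'
    using fiber_cases(2)[OF y that(1,2)] that yw by simp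
  have top: "c = x \<or> c = x'" if x: "x \<in> V" "x' \<in> V" "\<pi> x = w" "\<pi> x' = w" "x - x' = v" and c: "c \<in> V" "\<pi> c = w" for x x' c
  proof (rule ccontr)
    assume n: "\<not> (c = x \<or> c = x')"
    have xx: "x' = x - v" using x(5) by (simp add: algebra_simps)
    have "c - x = v \<or> x - c = v" using pair[OF c(1) x(1) c(2) x(3)] n by blast
    moreover have "x - c \<noteq> v" using n xx by auto
    ultimately have cx: "c = x + v" by (auto simp: diff_eq_eq add.commute)
    have "c - x' = v \<or> x' - c = v" using pair[OF c(1) x(2) c(2) x(4)] n by blast
    moreover have "c - x' = 2 *\<^sub>R v" "x' - c = - (2 *\<^sub>R v)" unfolding cx xx by (simp_all add: scaleR_2)
    ultimately have "2 *\<^sub>R v - v = 0 \<or> 2 *\<^sub>R v + v = 0" by (auto simp: add_eq_0_iff)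
    then show False using v0 scaleR_left_diff_distrib[of 2 1 v] scaleR_left_distrib[of 2 1 v] by auto
  qed
  show ?thesis
  proof (cases "\<exists>b\<in>V. \<pi> b = w \<and> b \<noteq> a")
    case False
    then show ?thesis using aV a(2) by blast
  next
    case True
    then obtain b where b: "b \<in> V" "\<pi> b = w" "b \<noteq> a" by blast
    have "a - b = v \<or> b - a = v"
      by (rule pair[OF aV b(1) a(2)[symmetric] b(2)]) (use b(3) in auto)
    have res: ?thesis if x: "x \<in> V" "x' \<in> V" "\<pi> x = w" "\<pi> x' = w" "x - x' = v" for x x'
    proof -
      have "x' = x - v" using x(5) by (simp add: algebra_simps)
      then show ?thesis using top[OF x] x(1,3) by blast
    qed
    from \<open>a - b = v \<or> b - a = v\<close> show ?thesis
      using res[OF aV b(1) a(2)[symmetric] b(2)] res[OF b(1) aV b(2) a(2)[symmetric]] by blast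
  qed
qed

lemma fiber_zero:
  assumes "x \<in> V" "\<pi> x = 0"
  shows "x = v \<or> x = - v"
proof -
  obtain c where c: "x = c *\<^sub>R v" using ker assms(2) by blast
  obtain u where u: "facet_normal V u" "v \<in> tight V u" using fano_vertex_facet[OF V vV] by blast
  have "u \<bullet> x = c" using tight_inner[OF u(2)] c by simp
  then have "c \<in> \<int>" using facet_normal_int[OF V u(1), of x] assms(1) VD(2) by auto
  then have "\<bar>c\<bar> = 1" using fano_set_primitive[OF V assms(1) vl c] by blast
  then have "c = 1 \<or> c = -1" by linarith
  then show ?thesis using c by auto
qed

text \<open>Both \<open>x\<close> and \<open>x - v\<close> are vertices of the lifted facet, so
  \<open>v\<close> has coordinate 1 at \<open>x\<close>. Computed from \<open>x'\<close> and
  \<open>x' - v\<close>, this coordinate is 1 only if \<open>x' = x\<close>. Hence a facet contains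
  at most one non-zero double point, and a circuit facet none.\<close>

lemma double_facet:
  assumes y: "facet_normal W y"
    and x: "x \<in> V" "x - v \<in> V" "y \<bullet> \<pi> x = 1" and x': "x' \<in> V" "x' - v \<in> V" "y \<bullet> \<pi> x' = 1"
  shows "x = x'" "facet_normal V (pull y)" "\<not> inj_on \<pi> (tight V (pull y))"
proof -
  let ?A = "tight V (pull y)"
  have e: "\<pi> (x - v) = \<pi> x" "\<pi> (x' - v) = \<pi> x'" by (simp_all add: linear_diff[OF lin])
  have A: "x \<in> ?A" "x - v \<in> ?A" "x' \<in> ?A" "x' - v \<in> ?A" using x x' e by (auto intro: mem_tight_pull)
  have ne: "x \<noteq> x - v" using v0 by simp
  show u: "facet_normal V (pull y)" using fiber_cases(1)[OF y x(1,2) _ x(3) ne] e by simp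
  show "\<not> inj_on \<pi> ?A" using A(1,2) e(1) ne by (metis inj_onD)
  interpret A: fano_facet V "pull y" by standard (fact V, fact u)
  have "A.z x \<bullet> v = 1"
    using A.zb[OF A(1), of x] A.zb[OF A(2), of x] ne by (simp add: inner_diff_right)
  moreover have "A.z x \<bullet> v = A.z x \<bullet> x' - A.z x \<bullet> (x' - v)" by (simp add: inner_diff_right)
  ultimately have "(if x' = x then 1 else 0) - (if x' - v = x then 1 else 0) = (1::real)"
    using A.zb[OF A(3), of x] A.zb[OF A(4), of x] by simp
  then show "x = x'" by (auto split: if_splits)
qed

lemma coord_ge:
  assumes u: "facet_normal V u" and b: "b \<in> tight V u" and s: "s \<in> V" "u \<bullet> s = 0"
  shows "dual_vec (tight V u) b \<bullet> s \<ge> -1"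
  using height_zero_neighbour(1)[OF V u b s] by force

text \<open>Write \<open>s = a - x + m v\<close>. The coordinates of \<open>s\<close> at
  \<open>x\<close> and at \<open>x - v\<close> are \<open>m - 1\<close> and \<open>- m\<close>.
  Coordinates of vertices at height 0 are at least -1, which for \<open>s - v\<close> at
  \<open>x\<close> and for \<open>s\<close> at \<open>x - v\<close> gives \<open>m = 1\<close>. Then
  \<open>s\<close> and \<open>v\<close> both replace \<open>x - v\<close>, so they coincide.\<close>

lemma double_opposite_aux:
  assumes y: "facet_normal W y" and a: "a \<in> tight V (pull y)" "\<pi> a = \<pi> x + \<pi> s"
    and x: "x \<in> V" "x - v \<in> V" and s: "s \<in> V" "s - v \<in> V"
    and 0: "\<pi> s \<noteq> 0" and yx: "y \<bullet> \<pi> x = 1" and ys: "y \<bullet> \<pi> s = 0"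
  shows False
proof -
  note u = double_facet(2)[OF y x yx x yx]
  interpret A: fano_facet V "pull y" by standard (fact V, fact u)
  have e: "\<pi> (x - v) = \<pi> x" "\<pi> (s - v) = \<pi> s" by (simp_all add: linear_diff[OF lin])
  have A: "x \<in> A.B" "x - v \<in> A.B" using x e yx by (auto intro: mem_tight_pull)
  have h: "pull y \<bullet> s = 0" "pull y \<bullet> (s - v) = 0" using ys e by (simp_all add: pull)
  have ax: "a \<noteq> x" "a \<noteq> x - v" using a(2) 0 e by auto
  have ne: "x \<noteq> x - v" using v0 by simp
  have "\<pi> (s + x) = \<pi> a" using a(2) by (simp add: linear_add[OF lin] add.commute)
  then obtain m where m: "s + x - a = m *\<^sub>R v" using ker_eq by blast
  have se: "s = a - x + m *\<^sub>R v" using m by (simp add: algebra_simps)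
  have zv: "A.z x \<bullet> v = 1" "A.z (x - v) \<bullet> v = -1"
    using A.zb[OF A(1), of x] A.zb[OF A(2), of x] A.zb[OF A(1), of "x - v"] A.zb[OF A(2), of "x - v"] ne
    by (simp_all add: inner_diff_right)
  have za: "A.z x \<bullet> a = 0" "A.z (x - v) \<bullet> a = 0" using A.zb[OF a(1)] ax by simp_all
  have zx: "A.z x \<bullet> x = 1" "A.z (x - v) \<bullet> x = 0" using A.zb[OF A(1)] ne by simp_all
  have zs: "A.z x \<bullet> s = m - 1" "A.z (x - v) \<bullet> s = - m"
    unfolding se by (simp_all add: inner_add_right inner_diff_right za zx zv)
  have "A.z x \<bullet> (s - v) \<ge> -1" by (rule coord_ge[OF u A(1) s(2) h(2)])
  moreover have "A.z (x - v) \<bullet> s \<ge> -1" by (rule coord_ge[OF u A(2) s(1) h(1)])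
  ultimately have "m = 1" using zs zv by (simp add: inner_diff_right)
  then have "s = v"
    using zs zv vV s(1) h(1) by (intro A.unique[OF _ _ A(2)]) (auto simp: pull)
  then show False using 0 by simp
qed

text \<open>On a facet through \<open>t\<close> the heights of \<open>x\<close> and \<open>s\<close>
  are at most 1 and add up to \<open>m\<close>. If \<open>m\<close> were at least 2, both would be
  vertices of this facet other than \<open>t\<close>, with coordinate 0 at \<open>t\<close>.\<close>

lemma opposite_multiple_aux:
  assumes x: "x \<in> V" and s: "s \<in> V" and t: "t \<in> V" and e: "x + s = m *\<^sub>R t" and ne: "x \<noteq> t" "s \<noteq> t"
  shows "m < 2"
proof -
  obtain u where u: "facet_normal V u" "t \<in> tight V u" using fano_vertex_facet[OF V t] by blast
  interpret A: fano_facet V u by standard (fact V, fact u(1))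
  have um: "u \<bullet> x + u \<bullet> s = m" using arg_cong[OF e, of "\<lambda>x. u \<bullet> x"] A.ub[OF u(2)] by (simp add: inner_add_right)
  have le: "u \<bullet> x \<le> 1" "u \<bullet> s \<le> 1" using facet_normal_le[OF u(1)] x s by auto
  show ?thesis
  proof (rule ccontr)
    assume m2: "\<not> m < 2"
    then have "u \<bullet> x = 1" "u \<bullet> s = 1" using um le by linarith+
    then have B: "x \<in> A.B" "s \<in> A.B" using x s by (auto simp: tight_def)
    have "A.z t \<bullet> (x + s) = 0" using A.zb[OF B(1), of t] A.zb[OF B(2), of t] ne by (simp add: inner_add_right)
    moreover have "A.z t \<bullet> (m *\<^sub>R t) = m" using A.zb[OF u(2), of t] by simp
    ultimately show False using e m2 by simp
  qed
qed

text \<open>No facet contains two non-zero double points, so their sum has height at most 1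
  everywhere; a non-zero sum would lie on a facet, which \<open>double_opposite_aux\<close>
  excludes. Thus \<open>x + s = m v\<close>. The upper points give \<open>m < 2\<close>, and the
  lower points, compared with \<open>- v\<close>, give \<open>2 - m < 2\<close>.\<close>

lemma double_opposite:
  assumes x: "x \<in> V" "x - v \<in> V" and s: "s \<in> V" "s - v \<in> V"
    and 0: "\<pi> x \<noteq> 0" "\<pi> s \<noteq> 0" and ne: "\<pi> x \<noteq> \<pi> s"
  shows "x + s = v"
proof (cases "\<pi> x + \<pi> s = 0")
  case False
  have vals: "y \<bullet> (\<pi> x + \<pi> s) \<le> 1" if y: "facet_normal W y" for y
  proof -
    have w: "\<pi> x \<in> W" "\<pi> s \<in> W" using x s by (auto simp: W_def)
    have le: "y \<bullet> \<pi> x \<le> 1" "y \<bullet> \<pi> s \<le> 1" using facet_normal_le[OF y] w by auto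
    have int: "y \<bullet> \<pi> x \<in> \<int>" "y \<bullet> \<pi> s \<in> \<int>" using lattice_inner[OF facet_normal_lattice[OF y]] w Wl by auto
    have "\<not> (y \<bullet> \<pi> x = 1 \<and> y \<bullet> \<pi> s = 1)" using double_facet(1)[OF y x _ s] ne by auto
    then have "y \<bullet> \<pi> x \<le> 0 \<or> y \<bullet> \<pi> s \<le> 0"
      using Ints_less_imp_le[OF int(1) Ints_1] Ints_less_imp_le[OF int(2) Ints_1] le by force
    then show ?thesis using le by (auto simp: inner_add_right)
  qed
  have "\<pi> x + \<pi> s \<in> lattice" using x s VD(2) \<pi>l by (intro lattice_add) auto
  then obtain y a where y: "facet_normal W y" and a: "a \<in> tight V (pull y)" "\<pi> x + \<pi> s = \<pi> a"
    using lattice_cone_facet[OF _ False vals] by blast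
  have sum1: "y \<bullet> \<pi> x + y \<bullet> \<pi> s = 1"
    using tight_inner[OF a(1)] a(2) by (simp add: pull flip: inner_add_right)
  have w: "\<pi> x \<in> W" "\<pi> s \<in> W" using x s by (auto simp: W_def)
  have le: "y \<bullet> \<pi> x \<le> 1" "y \<bullet> \<pi> s \<le> 1" using facet_normal_le[OF y] w by auto
  have int: "y \<bullet> \<pi> x \<in> \<int>" using lattice_inner[OF facet_normal_lattice[OF y]] w Wl by auto
  have "y \<bullet> \<pi> x = 1 \<or> y \<bullet> \<pi> x \<le> 0" using Ints_less_imp_le[OF int Ints_1] le by force
  then have "(y \<bullet> \<pi> x = 1 \<and> y \<bullet> \<pi> s = 0) \<or> (y \<bullet> \<pi> s = 1 \<and> y \<bullet> \<pi> x = 0)" using sum1 le by linarith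
  then have False
  proof
    assume "y \<bullet> \<pi> x = 1 \<and> y \<bullet> \<pi> s = 0"
    then show False using double_opposite_aux[OF y a(1) _ x s 0(2)] a(2) by simp
  next
    assume "y \<bullet> \<pi> s = 1 \<and> y \<bullet> \<pi> x = 0"
    then show False using double_opposite_aux[OF y a(1) _ s x 0(1)] a(2) by (simp add: add.commute)
  qed
  then show ?thesis by simp
next
  case True
  then have "\<pi> (x + s) = 0" by (simp add: linear_add[OF lin])
  then obtain m where m: "x + s = m *\<^sub>R v" using ker by blast
  have nv: "x \<noteq> v" "s \<noteq> v" "x - v \<noteq> - v" "s - v \<noteq> - v" using 0 VD(3) x s by auto
  have m2: "m < 2" by (rule opposite_multiple_aux[OF x(1) s(1) vV m nv(1,2)])
  have mi: "m \<in> \<int>"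
  proof -
    obtain u where u: "facet_normal V u" "v \<in> tight V u" using fano_vertex_facet[OF V vV] by blast
    have "u \<bullet> (x + s) = m" using m tight_inner[OF u(2)] by simp
    moreover have "x + s \<in> lattice" using x s VD(2) by (intro lattice_add) auto
    ultimately show ?thesis using facet_normal_int[OF V u(1)] by blast
  qed
  have "m > 0"
  proof (rule ccontr)
    assume m0: "\<not> m > 0"
    have e: "(x - v) + (s - v) = (2 - m) *\<^sub>R (- v)" using m by (simp add: algebra_simps scaleR_2)
    \<comment> \<open>For \<open>m \<le> 0\<close> the midpoint of the two lower points is a
      multiple of \<open>- v\<close> by a factor of at least 1, so \<open>- v\<close> lies between
      it and 0. As a non-zero lattice point of the polytope, \<open>- v\<close> is then an element
      of \<open>V\<close>.\<close>
    have "- v \<in> convex hull V"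
    proof -
      have c: "convex (convex hull V)" by simp
      have z: "0 \<in> convex hull V" using VD(4) interior_subset by blast
      have mid: "(1/2) *\<^sub>R (x - v) + (1/2) *\<^sub>R (s - v) \<in> convex hull V"
        using x s by (intro convexD[OF c]) (auto intro: hull_inc)
      have k: "2 / (2 - m) \<ge> 0" "1 - 2 / (2 - m) \<ge> 0" using m0 by (simp_all add: divide_le_eq)
      have "(2 / (2 - m)) *\<^sub>R ((1/2) *\<^sub>R (x - v) + (1/2) *\<^sub>R (s - v)) + (1 - 2 / (2 - m)) *\<^sub>R 0 \<in> convex hull V"
        by (rule convexD[OF c mid z k]) simp
      moreover have "(1/2) *\<^sub>R (x - v) + (1/2) *\<^sub>R (s - v) = ((2 - m) / 2) *\<^sub>R (- v)"
        using e by (metis (no_types, lifting) scaleR_right_distrib scaleR_scaleR times_divide_eq_left mult_1)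
      moreover have "(2 / (2 - m)) * ((2 - m) / 2) = 1" using m0 by simp
      ultimately show ?thesis by (metis (no_types, lifting) add.right_neutral scaleR_one scaleR_scaleR scaleR_zero_right)
    qed
    then obtain u where "- v \<in> tight V u"
      using fano_lattice_point[OF V lattice_minus[OF vl]] v0 by auto
    then have "- v \<in> V" using tight_subset by blast
    then have "2 - m < 2" by (rule opposite_multiple_aux[OF x(2) s(2) _ e nv(3,4)])
    then have "m > 0" by simp
    then show False using m0 by simp
  qed
  then have "m = 1" using m2 mi Ints_less_imp_le[OF Ints_0 mi] Ints_less_imp_le[OF mi, of 2] by simp
  then show ?thesis using m by simp
qed

text \<open>Covers every circuit relation of the facet. Lifted to the vertices, a relation becomes a
  multiple \<open>m v\<close>, so its coefficients are \<open>m\<close> times the coordinates of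
  \<open>v\<close>. As \<open>v\<close> and \<open>- v\<close> are vertices at height 0, these
  coordinates lie between -1 and 1, and a coefficient 1 on \<open>I\<close> forces \<open>m\<close>
  to be 1 or -1.\<close>

lemma circuit_coefficients:
  assumes neg: "- v \<in> V" and y: "facet_normal W y" and G: "G = convex hull (tight W y)"
    and rel: "circuit_relation G I J c" and cf: "circuit_facet G" and w: "w \<in> J"
  shows "c w = 1"
proof -
  let ?A = "tight V (pull y)"
  have fc: "facet_normal V (pull y)" "inj_on \<pi> ?A" "lattice_points G = \<pi> ` ?A"
    using facet_cases[OF y] cf G by auto
  interpret A: fano_facet V "pull y" by standard (fact V, fact fc(1))
  have uv: "pull y \<bullet> v = 0" "pull y \<bullet> (- v) = 0" by (simp_all add: pull)
  have zle: "\<bar>A.z b \<bullet> v\<bar> \<le> 1" if b: "b \<in> A.B" for b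
    using coord_ge[OF fc(1) b vV uv(1)] coord_ge[OF fc(1) b neg uv(2)] by simp
  have IJ: "I \<noteq> {}" "I \<inter> J = {}" "I \<subseteq> \<pi> ` ?A" "J \<subseteq> \<pi> ` ?A" "c w > 0"
    "(\<Sum>v\<in>I. v) = (\<Sum>v\<in>J. of_nat (c v) *\<^sub>R v)"
    using rel w unfolding circuit_relation_def fc(3) by blast+
  let ?i = "inv_into ?A \<pi>"
  have i: "?i w \<in> A.B" "\<pi> (?i w) = w" if "w \<in> \<pi> ` ?A" for w
    using that by (auto simp: inv_into_into f_inv_into_f)
  have fin: "finite I" "finite J" using IJ(3,4) A.BD(3) finite_subset by blast+
  define s where "s = (\<Sum>w\<in>I. ?i w) - (\<Sum>w\<in>J. of_nat (c w) *\<^sub>R ?i w)"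
  have "\<pi> s = (\<Sum>w\<in>I. \<pi> (?i w)) - (\<Sum>w\<in>J. of_nat (c w) *\<^sub>R \<pi> (?i w))"
    by (simp add: s_def linear_diff[OF lin] linear_sum[OF lin] linear_scale[OF lin])
  also have "(\<Sum>w\<in>I. \<pi> (?i w)) = (\<Sum>w\<in>I. w)" using IJ(3) i(2) by (intro sum.cong) auto
  also have "(\<Sum>w\<in>J. of_nat (c w) *\<^sub>R \<pi> (?i w)) = (\<Sum>w\<in>J. of_nat (c w) *\<^sub>R w)"
    using IJ(4) i(2) by (intro sum.cong) auto
  finally have "\<pi> s = 0" using IJ(6) by simp
  then obtain m where m: "s = m *\<^sub>R v" using ker by blast
  have zi: "A.z (?i x) \<bullet> ?i w = (if w = x then 1 else 0)" if "w \<in> \<pi> ` ?A" "x \<in> \<pi> ` ?A" for w x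
  proof -
    have "?i w = ?i x \<longleftrightarrow> w = x" using i that by metis
    then show ?thesis using A.zb[OF i(1)[OF that(1)], of "?i x"] by simp
  qed
  have zs: "m * (A.z (?i x) \<bullet> v) = (if x \<in> I then 1 else 0) - (if x \<in> J then real (c x) else 0)" if x: "x \<in> \<pi> ` ?A" for x
  proof -
    have "A.z (?i x) \<bullet> (\<Sum>w\<in>I. ?i w) = (\<Sum>w\<in>I. if w = x then 1 else 0)"
      unfolding inner_sum_right using IJ(3) zi[OF _ x] by (intro sum.cong) auto
    moreover have "A.z (?i x) \<bullet> (\<Sum>w\<in>J. of_nat (c w) *\<^sub>R ?i w) = (\<Sum>w\<in>J. if w = x then real (c w) else 0)"
      unfolding inner_sum_right using IJ(4) zi[OF _ x] by (intro sum.cong) auto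
    ultimately have "A.z (?i x) \<bullet> s = (if x \<in> I then 1 else 0) - (if x \<in> J then real (c x) else 0)"
      using fin by (simp add: s_def inner_diff_right)
    then show ?thesis using m by simp
  qed
  obtain x where x: "x \<in> I" using IJ(1) by blast
  have xX: "x \<in> \<pi> ` ?A" "x \<notin> J" using x IJ by auto
  have mx: "m * (A.z (?i x) \<bullet> v) = 1" using zs[OF xX(1)] x xX(2) by simp
  have "A.z (?i x) \<bullet> v \<in> \<int>" using A.zint[OF i(1)[OF xX(1)] vV] .
  moreover have "A.z (?i x) \<bullet> v \<noteq> 0" using mx by auto
  ultimately have "\<bar>A.z (?i x) \<bullet> v\<bar> \<ge> 1" by (rule Ints_nonzero_abs_ge1)
  then have "\<bar>A.z (?i x) \<bullet> v\<bar> = 1" using zle[OF i(1)[OF xX(1)]] by simp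
  then have m1: "\<bar>m\<bar> = 1" using arg_cong[OF mx, of abs] by (simp add: abs_mult)
  have wX: "w \<in> \<pi> ` ?A" "w \<notin> I" using w IJ by auto
  have "m * (A.z (?i w) \<bullet> v) = - real (c w)" using zs[OF wX(1)] w wX(2) by simp
  then have "real (c w) = \<bar>m\<bar> * \<bar>A.z (?i w) \<bullet> v\<bar>" by (metis abs_minus_cancel abs_mult abs_of_nat)
  also have "\<dots> \<le> 1" using m1 zle[OF i(1)[OF wX(1)]] by simp
  finally show ?thesis using IJ(5) by simp
qed

text \<open>The facet through \<open>v\<close> projects to a unimodular simplex, which must be found
  inside a facet of the projection. The functional equal to 1 on it pulls back to
  \<open>u - B.z v\<close>. Either this simplex is the whole facet, or the facet lifts to one
  parallel to \<open>v\<close> with one more vertex \<open>n\<close>; then \<open>n\<close> belongs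
  to \<open>circI\<close>, so the simplex arises by omitting a point of \<open>I\<close>.\<close>

lemma base_simplex:
  assumes u: "facet_normal V u" and vB: "v \<in> tight V u"
  shows "convex hull (\<pi> ` (tight V u - {v})) \<in> base_simplices (convex hull W)"
    "vertices (convex hull (\<pi> ` (tight V u - {v}))) = \<pi> ` (tight V u - {v})"
proof -
  interpret B: fano_facet V u by standard (fact V, fact u)
  let ?B = "B.B - {v}"
  have iB: "insert v ?B = B.B" using vB by auto
  have pb: "lattice_basis (\<pi> ` ?B)" "inj_on \<pi> ?B" "card ?B = CARD('n)"
    using projected_basis[of ?B] B.basis iB by auto
  show "vertices (convex hull (\<pi> ` ?B)) = \<pi> ` ?B"
    by (rule independent_vertices[OF lattice_basisD(2)[OF pb(1)]])
  define y where "y = (\<Sum>b\<in>\<pi> ` ?B. dual_vec (\<pi> ` ?B) b)"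
  have yb: "y \<bullet> b = 1" if "b \<in> \<pi> ` ?B" for b
  proof -
    have "y \<bullet> b = (\<Sum>b'\<in>\<pi> ` ?B. if b = b' then 1 else 0)"
      unfolding y_def inner_sum_left
      using dual_vec[OF lattice_basisD(2)[OF pb(1)] that] by (intro sum.cong) auto
    then show ?thesis using that lattice_basisD(3)[OF pb(1)] by simp
  qed
  have py: "pull y = u - B.z v"
  proof (rule inner_eq_on_spanning[OF B.BD(4)])
    fix b assume b: "b \<in> B.B"
    show "pull y \<bullet> b = (u - B.z v) \<bullet> b"
      using yb[of "\<pi> b"] b B.zb[OF b, of v] B.ub[OF b] by (cases "b = v") (auto simp: pull inner_diff_left)
  qed
  obtain t n where t: "t \<ge> 1" "facet_normal V (u - t *\<^sub>R B.z v)" using neighbour[OF V u vB] by blast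
  \<comment> \<open>If the coordinate of \<open>x\<close> at \<open>v\<close> is negative, the bound
    follows from the neighbouring facet, whose parameter \<open>t\<close> is at least 1; otherwise
    it follows from the bound for \<open>u\<close>.\<close>
  have ple: "pull y \<bullet> x \<le> 1" if x: "x \<in> V" for x
  proof -
    have "u \<bullet> x - t * (B.z v \<bullet> x) \<le> 1" using facet_normal_le[OF t(2) x] by (simp add: inner_diff_left)
    moreover have ux: "u \<bullet> x \<le> 1" by (rule facet_normal_le[OF u x])
    moreover have "t * (B.z v \<bullet> x) \<le> B.z v \<bullet> x \<or> B.z v \<bullet> x \<ge> 0"
      using t(1) by (auto simp: mult_le_cancel_right1)
    ultimately have "u \<bullet> x - B.z v \<bullet> x \<le> 1" by linarith
    then show ?thesis by (simp add: py inner_diff_left)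
  qed
  let ?A = "tight V (pull y)"
  have BA: "?B \<subseteq> ?A" using yb B.BV by (intro subsetI mem_tight_pull) auto
  have "\<pi> ` ?B \<subseteq> tight W y" unfolding tight_W using BA by (rule image_mono)
  then have "span (tight W y) = UNIV" using lattice_basisD(4)[OF pb(1)] span_mono by blast
  moreover have "\<And>w. w \<in> W \<Longrightarrow> y \<bullet> w \<le> 1" using ple by (auto simp: W_def pull)
  ultimately have y: "facet_normal W y" by (simp add: facet_normal_def)
  let ?G = "convex hull (tight W y)"
  have GA: "?G = convex hull (\<pi> ` ?A)" by (simp add: tight_W)
  have Gf: "?G facet_of (convex hull W)" using facet_iff y by blast
  have vA: "v \<notin> ?A" by (rule facet_lift(1)[OF y])
  have finA: "finite ?A" using finite_subset[OF tight_subset VD(1)] .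
  have uni: "convex hull (\<pi> ` ?B) \<in> base_simplices (convex hull W)" if e: "\<pi> ` ?A = \<pi> ` ?B"
    using Gf unimodular_facet_convex_hull[OF pb(1)] by (simp add: base_simplices_def GA e)
  show "convex hull (\<pi> ` ?B) \<in> base_simplices (convex hull W)"
  proof (cases "facet_normal V (pull y)")
    case False
    then have "lattice_basis (insert v ?A)" using facet_lift(2)[OF y] by blast
    then have "card ?A = CARD('n)" using projected_basis(3)[OF _ vA] by blast
    then have "?B = ?A" using card_subset_eq[OF finA BA] pb(3) by simp
    then show ?thesis using uni by simp
  next
    case True
    interpret A: fano_facet V "pull y" by standard (fact V, fact True)
    have uv: "pull y \<bullet> v = 0" by (simp add: pull)
    have "card (?A - ?B) = 1" using card_Diff_subset[OF _ BA] pb(3) A.BD(5) B.BD(3) cardm by simp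
    then obtain n where n: "?A - ?B = {n}" using card_1_singletonE by blast
    then have nA: "n \<in> ?A" "n \<notin> ?B" by auto
    have An: "?A - {n} = ?B" using n BA by auto
    have nB: "n \<notin> B.B" using nA vA by auto
    have nV: "n \<in> V" using nA tight_subset by blast
    have un: "u \<bullet> n \<le> 0"
    proof -
      have "u \<bullet> n \<noteq> 1" using nB nV by (auto simp: tight_def)
      then have "u \<bullet> n < 1" using facet_normal_le[OF u nV] by simp
      then show ?thesis using Ints_less_imp_le[OF B.uint[OF nV] Ints_1] by simp
    qed
    have "(\<Sum>a\<in>?A. A.z a \<bullet> v) = 0" using A.height_sum[of v] uv by simp
    then have s0: "A.z n \<bullet> v + (\<Sum>a\<in>?B. A.z a \<bullet> v) = 0"
      using sum.remove[OF finA nA(1), of "\<lambda>a. A.z a \<bullet> v"] An by simp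
    \<comment> \<open>Computes the height of \<open>v\<close> in the basis of the parallel facet,
      where its coordinates add up to 0 and all vertices but \<open>n\<close> have height 1. As
      \<open>u \<bullet> n \<le> 0\<close>, the coordinate of \<open>v\<close> at \<open>n\<close>
      comes out negative.\<close>
    have "u \<bullet> v = u \<bullet> (\<Sum>a\<in>?A. (A.z a \<bullet> v) *\<^sub>R a)" using arg_cong[OF A.expand[of v]] .
    also have "\<dots> = (\<Sum>a\<in>?A. (A.z a \<bullet> v) * (u \<bullet> a))" by (simp only: inner_sum_right inner_scaleR_right)
    also have "\<dots> = (A.z n \<bullet> v) * (u \<bullet> n) + (\<Sum>a\<in>?B. (A.z a \<bullet> v) * (u \<bullet> a))"
      using sum.remove[OF finA nA(1), of "\<lambda>a. (A.z a \<bullet> v) * (u \<bullet> a)"] An by simp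
    also have "(\<Sum>a\<in>?B. (A.z a \<bullet> v) * (u \<bullet> a)) = (\<Sum>a\<in>?B. A.z a \<bullet> v)"
      by (rule sum.cong) (auto simp: B.ub)
    finally have "(A.z n \<bullet> v) * (u \<bullet> n - 1) = 1" using s0 B.ub[OF vB] by (simp add: algebra_simps)
    then have "A.z n \<bullet> v < 0" using un by (smt (verit, best) mult_nonneg_nonpos)
    then have nI: "n \<in> circI (pull y)" using nA by (simp add: circI_def)
    show ?thesis
    proof (cases "card (circI (pull y)) = 1")
      case c1: True
      obtain i j where ij: "circI (pull y) = {i}" "j \<in> ?A" "j \<noteq> i" "\<pi> i = \<pi> j"
        using circ_singleton[OF True uv c1] by blast
      have "n = i" using nI ij(1) by simp
      then have "\<pi> ` ?A = \<pi> ` (?A - {n})" using ij(2-4) nA(1) by auto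
      then show ?thesis using uni An by simp
    next
      case c1: False
      have inj: "inj_on \<pi> ?A" by (rule circ_inj[OF True uv c1])
      have "\<not> lattice_basis (\<pi> ` ?A)"
        using lattice_basisD(5)[of "\<pi> ` ?A"] card_image[OF inj] A.BD(5) cardm by auto
      then have fc: "circuit_facet ?G" "lattice_points ?G = \<pi> ` ?A"
        "\<exists>c. circuit_relation ?G (\<pi> ` circI (pull y)) (\<pi> ` circJ (pull y)) c"
        using facet_cases[OF y] by auto
      have "\<pi> ` ?B = lattice_points ?G - {\<pi> n}"
        using inj_on_image_set_diff[OF inj, of ?A "{n}"] nA(1) fc(2) An by auto
      then have e: "convex hull (\<pi> ` ?B) = convex hull (lattice_points ?G - {\<pi> n})" by simp
      obtain c where c: "circuit_relation ?G (\<pi> ` circI (pull y)) (\<pi> ` circJ (pull y)) c" using fc(3) ..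
      show ?thesis
        unfolding base_simplices_def
        by (rule UnI2, rule CollectI, intro exI conjI) (rule e, rule Gf, rule fc(1), rule c, rule imageI[OF nI])
    qed
  qed
qed

end

section \<open>Existence and composition of projections\<close>

lemma fano_projection_comp:
  fixes \<pi> :: "real ^ 'm \<Rightarrow> real ^ 'n"
  assumes "fano_projection V v \<pi>" and h: "h \<in> lattice_transformations"
  shows "fano_projection V v (\<lambda>x. h (\<pi> x))"
proof -
  interpret fano_projection V v \<pi> by fact
  have hl: "linear h" "bij h" "h ` lattice = lattice" using h unfolding lattice_transformations_eq by auto
  show ?thesis
  proof (rule fano_projection.intro)
    show "linear (\<lambda>x. h (\<pi> x))" using linear_compose[OF lin hl(1)] by (simp add: o_def)
    show "(\<lambda>x. h (\<pi> x)) ` lattice = lattice" using lat hl(3) by (metis image_image)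
    fix x
    have "h (\<pi> x) = 0 \<longleftrightarrow> \<pi> x = 0"
      using bij_is_inj[OF hl(2)] linear_0[OF hl(1)] by (metis injD)
    then show "h (\<pi> x) = 0 \<longleftrightarrow> (\<exists>c. x = c *\<^sub>R v)" using ker by simp
  qed (fact V vV cardm)+
qed

lemma fano_projection_exists:
  fixes V :: "(real ^ 'm) set"
  assumes V: "fano_set V" and u: "facet_normal V u" and v: "v \<in> tight V u" and c: "CARD('m) = CARD('n) + 1"
  shows "\<exists>\<pi> :: real ^ 'm \<Rightarrow> real ^ 'n. fano_projection V v \<pi>"
proof -
  interpret B: fano_facet V u by standard (fact V, fact u)
  let ?B = "B.B - {v}"
  have "card ?B = CARD('n)" using B.BD(3,5) v c by simp
  then obtain g :: "real ^ 'm \<Rightarrow> 'n" where g: "bij_betw g ?B UNIV"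
    using finite_same_card_bij[of ?B "UNIV :: 'n set"] B.BD(3) by auto
  obtain f :: "real ^ 'm \<Rightarrow> real ^ 'n" where f: "linear f" "\<forall>b\<in>B.B. f b = (if b = v then 0 else unit_vec (g b))"
    using linear_independent_extend[OF B.BD(2), of "\<lambda>b. if b = v then 0 else unit_vec (g b)"] by blast
  have fx: "f x = (\<Sum>b\<in>?B. (B.z b \<bullet> x) *\<^sub>R unit_vec (g b))" for x
  proof -
    have "f x = f (\<Sum>b\<in>B.B. (B.z b \<bullet> x) *\<^sub>R b)" by (rule arg_cong[OF B.expand])
    also have "\<dots> = (\<Sum>b\<in>B.B. (B.z b \<bullet> x) *\<^sub>R f b)" by (simp add: linear_sum[OF f(1)] linear_scale[OF f(1)])
    also have "\<dots> = (\<Sum>b\<in>?B. (B.z b \<bullet> x) *\<^sub>R f b)"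
      using sum.remove[OF B.BD(3) v, of "\<lambda>b. (B.z b \<bullet> x) *\<^sub>R f b"] f(2) v by simp
    also have "\<dots> = (\<Sum>b\<in>?B. (B.z b \<bullet> x) *\<^sub>R unit_vec (g b))" by (rule sum.cong) (use f(2) in auto)
    finally show ?thesis .
  qed
  have g_eq: "g b = g b' \<longleftrightarrow> b = b'" if "b \<in> ?B" "b' \<in> ?B" for b b'
    using g that by (auto simp: bij_betw_def inj_on_eq_iff)
  have comp: "f x $ g a = B.z a \<bullet> x" if a: "a \<in> ?B" for a x
  proof -
    have "f x $ g a = (\<Sum>b\<in>?B. (B.z b \<bullet> x) * unit_vec (g b) $ g a)" unfolding fx by simp
    also have "\<dots> = (\<Sum>b\<in>?B. if b = a then B.z b \<bullet> x else 0)"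
      by (rule sum.cong) (use g_eq[OF _ a] g_eq[OF a] in \<open>auto simp: unit_vec_nth\<close>)
    also have "\<dots> = B.z a \<bullet> x" using a B.BD(3) by simp
    finally show ?thesis .
  qed
  have "fano_projection V v f"
  proof (rule fano_projection.intro)
    show "v \<in> V" by (rule B.BV[OF v])
    show "f ` lattice = lattice"
    proof (intro equalityI subsetI)
      fix w assume "w \<in> f ` lattice"
      then obtain x where x: "x \<in> lattice" "w = f x" by blast
      show "w \<in> lattice"
        unfolding x(2) fx using lattice_basis_coord[OF B.basis x(1)] by (intro lattice_sum lattice_scale) auto
    next
      fix w :: "real ^ 'n" assume w: "w \<in> lattice"
      let ?x = "\<Sum>b\<in>?B. (w $ g b) *\<^sub>R b"
      have "f ?x = (\<Sum>b\<in>?B. (w $ g b) *\<^sub>R unit_vec (g b))"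
        using f(2) by (simp add: linear_sum[OF f(1)] linear_scale[OF f(1)])
      also have "\<dots> = (\<Sum>i\<in>UNIV. (w $ i) *\<^sub>R unit_vec i)" by (rule sum.reindex_bij_betw[OF g])
      finally have "w = f ?x" using vec_eq_sum_unit_vec[of w] by simp
      moreover have "?x \<in> lattice" using B.BD(1) w by (intro lattice_sum lattice_scale) (auto simp: lattice_def)
      ultimately show "w \<in> f ` lattice" by blast
    qed
    fix x
    show "f x = 0 \<longleftrightarrow> (\<exists>c. x = c *\<^sub>R v)"
    proof
      assume "f x = 0"
      then have "B.z a \<bullet> x = 0" if "a \<in> ?B" for a using comp[OF that, of x] by simp
      then have "(\<Sum>b\<in>?B. (B.z b \<bullet> x) *\<^sub>R b) = 0" by (intro sum.neutral) auto
      then have "x = (B.z v \<bullet> x) *\<^sub>R v"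
        using B.expand[of x] sum.remove[OF B.BD(3) v, of "\<lambda>b. (B.z b \<bullet> x) *\<^sub>R b"] by simp
      then show "\<exists>c. x = c *\<^sub>R v" by blast
    next
      assume "\<exists>c. x = c *\<^sub>R v"
      then show "f x = 0" using f(2) v by (auto simp: linear_scale[OF f(1)])
    qed
  qed (fact V f(1) c)+
  then show ?thesis by blast
qed

lemma (in fano_projection) admissible:
  assumes "card V \<le> 3 * CARD('m) - 1"
  shows "admissible_polytope (convex hull W)"
proof -
  have "card W \<le> card V" unfolding W_def using VD(1) by (rule card_image_le)
  then have "card (lattice_points (convex hull W)) \<le> card V" by (simp only: lattice_points_W)
  moreover have "CARD('m) = CARD('n option)" using cardm by (simp add: card_option)
  moreover have "unimodular_facet G \<or> circuit_facet G" if G: "G facet_of (convex hull W)" for G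
  proof -
    obtain y where y: "facet_normal W y" "G = convex hull (tight W y)" using facet_iff G by blast
    then show ?thesis using facet_cases[OF y(1)] by blast
  qed
  ultimately show ?thesis using assms unfolding admissible_polytope_def by simp
qed

section \<open>Reconstruction of a Fano polytope from its projection\<close>

text \<open>In the following locale \<open>u\<close> is the functional of the facet that is mapped to the standard
  simplex; its negative gives the heights \<open>k\<close> of the algorithm. Of the vertices over a lattice
  point of the projection, \<open>apex\<close> is the one that is highest with respect to \<open>u\<close>.\<close>

locale algorithm_output = fano_projection V v \<pi>
  for V :: "(real ^ ('n::finite) option) set" and v and \<pi> :: "real ^ 'n option \<Rightarrow> real ^ 'n" +
  fixes u
  assumes u: "facet_normal V u" and vB: "v \<in> tight V u" and special: "u \<bullet> \<Sum>V \<ge> 0"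
    and heights: "\<And>x. x \<in> V \<Longrightarrow> u \<bullet> x \<ge> 1 - real CARD('n option)"
    and cV: "card V \<le> 3 * CARD('n option) - 1"
    and unit: "\<pi> ` (tight V u - {v}) = range unit_vec"
begin

sublocale B: fano_facet V u by standard (fact V, fact u)

abbreviation "P \<equiv> convex hull W"

text \<open>Over 0 the second vertex can only be \<open>- v\<close>, at distance \<open>2 v\<close>
  from the first, whereas other fibers have step \<open>v\<close>. This is why the algorithm treats
  the origin as a separate kind of double point.\<close>

lemma apex_exists: "\<exists>x\<in>V. \<pi> x = w \<and> (\<forall>x'\<in>V. \<pi> x' = w \<longrightarrow> x' = x \<or> x' = (if w = 0 then - v else x - v)) \<and> (w = 0 \<longrightarrow> x = v)"
  if w: "w \<in> W" for w
proof (cases "w = 0")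
  case True
  then show ?thesis using vV fiber_zero by (intro bexI[of _ v]) auto
next
  case False
  then show ?thesis using fiber_top[of w] w by (simp add: lattice_points_W)
qed

definition "apex w = (SOME x. x \<in> V \<and> \<pi> x = w \<and>
  (\<forall>x'\<in>V. \<pi> x' = w \<longrightarrow> x' = x \<or> x' = (if w = 0 then - v else x - v)) \<and> (w = 0 \<longrightarrow> x = v))"

lemma apex:
  assumes "w \<in> W"
  shows "apex w \<in> V" "\<pi> (apex w) = w" "w = 0 \<Longrightarrow> apex w = v"
    "x' \<in> V \<Longrightarrow> \<pi> x' = w \<Longrightarrow> x' = apex w \<or> x' = (if w = 0 then - v else apex w - v)"
proof -
  have "\<exists>x. x \<in> V \<and> \<pi> x = w \<and>
    (\<forall>x'\<in>V. \<pi> x' = w \<longrightarrow> x' = x \<or> x' = (if w = 0 then - v else x - v)) \<and> (w = 0 \<longrightarrow> x = v)"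
    using apex_exists[OF assms] by blast
  from someI_ex[OF this, folded apex_def]
  show "apex w \<in> V" "\<pi> (apex w) = w" "w = 0 \<Longrightarrow> apex w = v"
    "x' \<in> V \<Longrightarrow> \<pi> x' = w \<Longrightarrow> x' = apex w \<or> x' = (if w = 0 then - v else apex w - v)"
    by blast+
qed

lemma W0: "0 \<in> W" using vV \<pi>v unfolding W_def by (metis imageI)

lemma \<pi>W: "x \<in> V \<Longrightarrow> \<pi> x \<in> W" by (simp add: W_def)

lemma uv: "u \<bullet> v = 1" by (rule B.ub[OF vB])

definition "k w = \<lfloor>- (u \<bullet> apex w)\<rfloor>"

lemma k: "w \<in> W \<Longrightarrow> real_of_int (k w) = - (u \<bullet> apex w)"
  using B.uint[OF apex(1)] by (auto simp: k_def of_int_floor)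

definition "D = {w \<in> W. (if w = 0 then - v else apex w - v) \<in> V}"

text \<open>Full coordinates of \<open>x\<close>: those of its projection, and a last one that makes
  all coordinates add up to the height \<open>u \<bullet> x\<close>. In the same way the coordinates
  of \<open>lift_point k w\<close> add up to \<open>- k w\<close>.\<close>

definition "\<Phi> x = (\<chi> i. case i of Some j \<Rightarrow> \<pi> x $ j | None \<Rightarrow> u \<bullet> x - (\<Sum>j\<in>UNIV. \<pi> x $ j))"

lemma linear_\<Phi>: "linear \<Phi>"
proof (rule linearI)
  fix x y :: "real ^ 'n option" and c :: real
  show "\<Phi> (x + y) = \<Phi> x + \<Phi> y"
    by (simp add: vec_eq_iff \<Phi>_def linear_add[OF lin] inner_add_right sum.distrib split: option.split)
  show "\<Phi> (c *\<^sub>R x) = c *\<^sub>R \<Phi> x"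
    by (simp add: vec_eq_iff \<Phi>_def linear_scale[OF lin] sum_distrib_left right_diff_distrib split: option.split)
qed

lemma \<Phi>_v: "\<Phi> v = unit_vec None"
  by (simp add: vec_eq_iff \<Phi>_def unit_vec_nth uv split: option.split)

lemma \<Phi>_basis: "\<Phi> ` B.B = range unit_vec"
proof -
  have b: "\<Phi> b = unit_vec (Some i)" if "b \<in> B.B" "\<pi> b = unit_vec i" for b i
  proof -
    have "(\<Sum>j\<in>UNIV. unit_vec i $ j) = (1::real)" by (simp add: unit_vec_nth)
    then show ?thesis
      using that B.ub[OF that(1)] by (simp add: vec_eq_iff \<Phi>_def unit_vec_nth split: option.split)
  qed
  show ?thesis
  proof (intro equalityI subsetI)
    fix x assume "x \<in> \<Phi> ` B.B"
    then obtain a where a: "a \<in> B.B" "x = \<Phi> a" by blast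
    show "x \<in> range unit_vec"
    proof (cases "a = v")
      case False
      then have "\<pi> a \<in> range unit_vec" using a(1) unit by blast
      then show ?thesis using b a by auto
    qed (use a \<Phi>_v in auto)
  next
    fix x :: "real ^ 'n option" assume "x \<in> range unit_vec"
    then obtain j where j: "x = unit_vec j" by blast
    show "x \<in> \<Phi> ` B.B"
    proof (cases j)
      case None
      then show ?thesis using j \<Phi>_v vB by (metis imageI)
    next
      case (Some i)
      have "unit_vec i \<in> \<pi> ` (B.B - {v})" using unit by simp
      then obtain a where "unit_vec i = \<pi> a" "a \<in> B.B - {v}" by (rule imageE)
      then have "a \<in> B.B" "x = \<Phi> a" using b[of a i] j Some by simp_all
      then show ?thesis by (rule image_eqI[rotated])
    qed
  qed
qed

lemma \<Phi>_transformation: "\<Phi> \<in> lattice_transformations"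
  by (rule lattice_transformationI[OF linear_\<Phi> B.basis]) (simp add: \<Phi>_basis lattice_basis_unit_vec)

lemma lift_apex: "w \<in> W \<Longrightarrow> lift_point k w = \<Phi> (apex w)"
  using k[of w] apex(2)[of w] by (simp add: vec_eq_iff lift_point_def \<Phi>_def split: option.split)

lemma lifted_points_eq: "lifted_points P k D = \<Phi> ` V"
proof (intro equalityI subsetI)
  fix x assume "x \<in> lifted_points P k D"
  then consider "x \<in> lift_point k ` W" | w where "w \<in> D - {0}" "x = lift_point k w - unit_vec None"
    | "0 \<in> D" "x = - unit_vec None"
    by (auto simp: lifted_points_def lattice_points_W split: if_splits)
  then show "x \<in> \<Phi> ` V"
  proof cases
    case 1
    then show ?thesis using lift_apex apex(1) by auto
  next
    case 2
    then have w: "w \<in> W" "apex w - v \<in> V" by (auto simp: D_def)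
    have "x = \<Phi> (apex w - v)"
      using 2(2) lift_apex[OF w(1)] by (simp add: linear_diff[OF linear_\<Phi>] \<Phi>_v)
    then show ?thesis using w(2) by blast
  next
    case 3
    then have "- v \<in> V" by (simp add: D_def)
    moreover have "x = \<Phi> (- v)" using 3(2) by (simp add: linear_neg[OF linear_\<Phi>] \<Phi>_v)
    ultimately show ?thesis by blast
  qed
next
  fix x assume "x \<in> \<Phi> ` V"
  then obtain a where a: "a \<in> V" "x = \<Phi> a" by blast
  let ?w = "\<pi> a"
  have w: "?w \<in> W" using \<pi>W[OF a(1)] .
  have l: "lift_point k ?w \<in> lifted_points P k D" using w by (auto simp: lifted_points_def lattice_points_W)
  show "x \<in> lifted_points P k D"
  proof (cases "a = apex ?w")
    case True
    then show ?thesis using l lift_apex[OF w] a(2) by simp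
  next
    case False
    then have e: "a = (if ?w = 0 then - v else apex ?w - v)" using apex(4)[OF w a(1)] by blast
    then have D: "?w \<in> D" using w a(1) by (simp add: D_def)
    show ?thesis
    proof (cases "?w = 0")
      case True
      then have "a = - v" using e by presburger
      then have "x = - unit_vec None" using a(2) by (simp add: linear_neg[OF linear_\<Phi>] \<Phi>_v)
      then show ?thesis using D True by (simp add: lifted_points_def)
    next
      case w0: False
      then have "a = apex ?w - v" using e by presburger
      then have "x = \<Phi> (apex ?w - v)" using a(2) by simp
      also have "\<dots> = lift_point k ?w - unit_vec None"
        using lift_apex[OF w] by (simp add: linear_diff[OF linear_\<Phi>] \<Phi>_v)
      finally show ?thesis using D w0 by (auto simp: lifted_points_def)
    qed
  qed
qed

text \<open>The facet vertex over a unit vector already has the maximal height 1, so it cannot be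
  the lower point of its fiber.\<close>

lemma unit_W: "unit_vec i \<in> W" "apex (unit_vec i) \<in> B.B"
proof -
  have "unit_vec i \<in> \<pi> ` (B.B - {v})" using unit by simp
  then obtain b where "unit_vec i = \<pi> b" "b \<in> B.B - {v}" by (rule imageE)
  then have b: "b \<in> B.B" "\<pi> b = unit_vec i" by simp_all
  show W: "unit_vec i \<in> W" using \<pi>W[OF B.BV[OF b(1)]] b(2) by simp
  have "unit_vec i \<noteq> (0 :: real ^ 'n)" by (simp add: unit_vec_def axis_eq_0_iff)
  then have "b = apex (unit_vec i) \<or> b = apex (unit_vec i) - v"
    using apex(4)[OF W B.BV[OF b(1)] b(2)] by simp
  moreover have "b \<noteq> apex (unit_vec i) - v"
  proof
    assume e: "b = apex (unit_vec i) - v"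
    then have "u \<bullet> apex (unit_vec i) = u \<bullet> b + 1" using uv by (simp add: inner_diff_right)
    then show False using facet_normal_le[OF u apex(1)[OF W]] B.ub[OF b(1)] by simp
  qed
  ultimately show "apex (unit_vec i) \<in> B.B" using b(1) by auto
qed

lemma outside: assumes "w \<in> W - insert 0 (range unit_vec)" shows "apex w \<in> V - B.B"
proof -
  have w: "w \<in> W" "w \<noteq> 0" "w \<notin> range unit_vec" using assms by auto
  have "apex w \<notin> B.B"
  proof
    assume t: "apex w \<in> B.B"
    then have "apex w = v \<or> \<pi> (apex w) \<in> range unit_vec" using unit by blast
    then show False using apex(2)[OF w(1)] w(2,3) by auto
  qed
  then show ?thesis using apex(1)[OF w(1)] by simp
qed

lemma height_le0: "x \<in> V - B.B \<Longrightarrow> u \<bullet> x \<le> 0"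
  using B.cases_V by (metis (mono_tags, lifting) DiffD1 DiffD2 UnE less_eq_real_def mem_Collect_eq order_refl)

section \<open>Admissibility of the recovered heights and double points\<close>

lemma inj_apex: "inj_on apex W"
  using apex(2) by (metis inj_onI)

lemma admissible_heights: "admissible_heights P k"
proof -
  let ?X = "W - insert 0 (range unit_vec)"
  have "k 0 = -1" using k[OF W0] apex(3)[OF W0] uv by simp
  moreover have "k (unit_vec i) = -1" for i
  proof -
    have "real_of_int (k (unit_vec i)) = real_of_int (-1)" using k[OF unit_W(1)] B.ub[OF unit_W(2)] by simp
    then show ?thesis by (simp only: of_int_eq_iff)
  qed
  moreover have "0 \<le> k w \<and> k w \<le> int CARD('n option) - 1" if w: "w \<in> ?X" for w
  proof -
    have "real_of_int (k w) \<ge> 0" using k[of w] height_le0[OF outside[OF w]] w by simp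
    moreover have "real_of_int (k w) \<le> real_of_int (int CARD('n option) - 1)"
      using k[of w] heights[of "apex w"] outside[OF w] w by simp
    ultimately show ?thesis by (simp only: of_int_le_iff of_int_0_le_iff)
  qed
  moreover have "(\<Sum>w\<in>?X. k w) \<le> int CARD('n option)"
  proof -
    have "real_of_int (\<Sum>w\<in>?X. k w) = (\<Sum>w\<in>?X. - (u \<bullet> apex w))" using k by simp
    also have "\<dots> = (\<Sum>x\<in>apex ` ?X. - (u \<bullet> x))"
      by (rule sum.reindex[symmetric, unfolded o_def]) (use inj_apex inj_on_subset in blast)
    \<comment> \<open>Lower points of fibers are added here; like everything outside the facet they
      have height at most 0, so the sum can only grow.\<close>
    also have "\<dots> \<le> (\<Sum>x\<in>V - B.B. - (u \<bullet> x))"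
      using VD(1) outside height_le0 by (intro sum_mono2) auto
    also have "\<dots> = (\<Sum>x\<in>V. - (u \<bullet> x)) - (\<Sum>x\<in>B.B. - (u \<bullet> x))"
      using VD(1) tight_subset by (intro sum_diff) auto
    also have "(\<Sum>x\<in>V. - (u \<bullet> x)) = - (u \<bullet> \<Sum>V)" by (simp add: inner_sum_right sum_negf)
    also have "(\<Sum>x\<in>B.B. - (u \<bullet> x)) = - real CARD('n option)" using B.ub B.BD(5) by simp
    finally have "real_of_int (\<Sum>w\<in>?X. k w) \<le> real_of_int (int CARD('n option))" using special by simp
    then show ?thesis by (simp only: of_int_le_iff)
  qed
  moreover have "card {w \<in> W. k w = 0} \<le> CARD('n option)"
  proof -
    have "apex ` {w \<in> W. k w = 0} \<subseteq> B.N0" using apex(1) k by force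
    moreover have "inj_on apex {w \<in> W. k w = 0}" using inj_apex by (rule inj_on_subset) auto
    ultimately have "card {w \<in> W. k w = 0} \<le> card B.N0" using B.finN(1) by (intro card_inj_on_le)
    then show ?thesis using B.card_N0 B.BD(5) by simp
  qed
  ultimately show ?thesis unfolding admissible_heights_def Let_def lattice_points_W by blast
qed

lemma D_apex: "w \<in> D - {0} \<Longrightarrow> apex w \<in> V \<and> apex w - v \<in> V \<and> \<pi> (apex w) = w"
  using apex(1,2) by (auto simp: D_def)

lemma facet_D_unique:
  assumes y: "facet_normal W y" and w: "w \<in> D - {0}" "y \<bullet> w = 1" and w': "w' \<in> D - {0}" "y \<bullet> w' = 1"
  shows "w = w'" "\<not> inj_on \<pi> (tight V (pull y))"
  using double_facet[OF y, of "apex w" "apex w'"] D_apex[OF w(1)] D_apex[OF w'(1)] w(2) w'(2) by metis+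

lemma facetE:
  assumes "G facet_of P"
  obtains y where "facet_normal W y" "G = convex hull (tight W y)" "\<And>x. x \<in> G \<Longrightarrow> y \<bullet> x = 1"
proof -
  obtain y where y: "facet_normal W y" "G = convex hull (tight W y)" using assms facet_iff by blast
  have "y \<bullet> x = 1" if "x \<in> G" for x using tight_W_inner that y(2) by blast
  then show ?thesis using that y by blast
qed

lemma D_opposite:
  assumes w: "w \<in> D - {0}" and w': "w' \<in> D - {0}" and ne: "w \<noteq> w'"
  shows "apex w + apex w' = v" "w' = - w"
proof -
  note t = D_apex[OF w] and t' = D_apex[OF w']
  show s: "apex w + apex w' = v"
    using double_opposite[of "apex w" "apex w'"] t t' w w' ne by auto
  have "\<pi> (apex w) + \<pi> (apex w') = 0" using arg_cong[OF s, of \<pi>] by (simp add: linear_add[OF lin])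
  then show "w' = - w" using t t' by (simp add: add_eq_0_iff)
qed

lemma card_D: "card (D - {0}) \<le> 2"
proof (cases "D - {0} = {}")
  case False
  then obtain w where w: "w \<in> D - {0}" by blast
  have "D - {0} \<subseteq> {w, - w}" using D_opposite(2)[OF w] by blast
  then have "card (D - {0}) \<le> card {w, - w}" by (intro card_mono) auto
  also have "\<dots> \<le> 2" by (simp add: card_insert_if)
  finally show ?thesis .
next
  case True
  show ?thesis unfolding True by simp
qed

text \<open>Upper points are indexed by \<open>W\<close> and lower points by \<open>D\<close>, and
  all of them are different elements of \<open>V\<close>.\<close>

lemma card_W_D: "card W + card D \<le> card V"
proof -
  define bot where "bot = (\<lambda>w. if w = 0 then - v else apex w - v)"
  have \<pi>b: "\<pi> (bot w) = w" if "w \<in> W" for w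
    using apex(2)[OF that] by (simp add: bot_def linear_diff[OF lin] linear_neg[OF lin])
  have ne: "apex w \<noteq> bot w" if w: "w \<in> W" for w
  proof (cases "w = 0")
    case True
    have "v \<noteq> - v" using v0 by (simp add: eq_neg_iff_add_eq_0 scaleR_2[symmetric])
    then show ?thesis using True apex(3)[OF w] by (simp add: bot_def)
  qed (use v0 in \<open>simp add: bot_def\<close>)
  have DW: "D \<subseteq> W" by (auto simp: D_def)
  have finD: "finite D" using DW finW finite_subset by blast
  have "inj_on bot D" using \<pi>b DW by (metis inj_onI subsetD)
  moreover have "apex ` W \<inter> bot ` D = {}"
  proof (rule ccontr)
    assume "apex ` W \<inter> bot ` D \<noteq> {}"
    then obtain w w' where w: "w \<in> W" "w' \<in> D" "apex w = bot w'" by auto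
    then have "w = w'" using apex(2)[OF w(1)] \<pi>b[of w'] DW by auto
    then show False using ne[OF w(1)] w(3) by simp
  qed
  ultimately have "card (apex ` W \<union> bot ` D) = card W + card D"
    using card_Un_disjoint[of "apex ` W" "bot ` D"] finW finD inj_apex by (simp add: card_image)
  moreover have "apex ` W \<union> bot ` D \<subseteq> V" using apex(1) by (auto simp: D_def bot_def)
  ultimately show ?thesis using card_mono[OF VD(1)] by metis
qed

lemma admissible_double_points: "admissible_double_points P k D"
  unfolding admissible_double_points_def lattice_points_W
proof (intro conjI ballI allI impI)
  show DW: "D \<subseteq> W" by (auto simp: D_def)
  have finD: "finite D" using DW finW finite_subset by blast
  have "card D \<le> card (insert 0 (D - {0}))" using finD by (intro card_mono) auto
  then have "card D \<le> card (D - {0}) + 1" using finD by (simp add: card_insert_if split: if_splits)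
  then show "card D \<le> 3" using card_D by simp
  show "card W + card D \<le> 3 * CARD('n option) - 1" using card_W_D cV by simp
  show "card (D - {0}) \<le> 2" by (rule card_D)
next
  fix w G assume w: "w \<in> D - {0}" and G: "G facet_of P \<and> circuit_facet G"
  obtain y where y: "facet_normal W y" "G = convex hull (tight W y)" "\<And>x. x \<in> G \<Longrightarrow> y \<bullet> x = 1"
    using G by (metis facetE)
  have "inj_on \<pi> (tight V (pull y))" using facet_cases[OF y(1)] G y(2) by auto
  then show "w \<notin> G" using facet_D_unique(2)[OF y(1) w _ w] y(3) by blast
next
  fix G assume G: "G facet_of P \<and> unimodular_facet G"
  obtain y where y: "facet_normal W y" "G = convex hull (tight W y)" "\<And>x. x \<in> G \<Longrightarrow> y \<bullet> x = 1"
    using G by (metis facetE)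
  have "w = w'" if "w \<in> D \<inter> G" "w' \<in> D \<inter> G" for w w'
  proof -
    have "y \<bullet> w = 1" "y \<bullet> w' = 1" using y(3) that by auto
    moreover from this have "w \<in> D - {0}" "w' \<in> D - {0}" using that by auto
    ultimately show ?thesis using facet_D_unique(1)[OF y(1)] by blast
  qed
  then show "card (D \<inter> G) \<le> 1" by (metis card_le_Suc0_iff_eq One_nat_def card.infinite zero_le_one)
next
  fix G I J c x
  assume 0: "0 \<in> D" and G: "G facet_of P \<and> circuit_facet G \<and> circuit_relation G I J c" and x: "x \<in> J"
  obtain y where y: "facet_normal W y" "G = convex hull (tight W y)"
    using G by (metis facetE)
  have "- v \<in> V" using 0 by (simp add: D_def)
  then show "c x = 1" using circuit_coefficients[OF _ y] G x by blast
next
  fix w w' assume w: "w \<in> D - {0}" and w': "w' \<in> D - {0}" and ne: "w \<noteq> w'"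
  show "w' = - w" by (rule D_opposite(2)[OF w w' ne])
  have W: "w \<in> W" "w' \<in> W" using w w' by (auto simp: D_def)
  show "lift_point k w + lift_point k w' = unit_vec None"
    using D_opposite(1)[OF w w' ne] lift_apex[OF W(1)] lift_apex[OF W(2)] \<Phi>_v
    by (simp flip: linear_add[OF linear_\<Phi>])
qed

lemma output_polytope: "convex hull (lifted_points P k D) = \<Phi> ` (convex hull V)"
  unfolding lifted_points_eq by (rule convex_hull_linear_image[OF linear_\<Phi>, symmetric])

end

text \<open>The input contains the projection only up to isomorphism, and the transformation of the
  run depends on the input polytope and on the simplex in it. The quotient map \<open>p\<close> is
  therefore composed of three maps: dividing out \<open>v\<close>, moving the result onto the input
  polytope \<open>Q\<close>, and the transformation prescribed for \<open>Q\<close> and the image of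
  the facet.\<close>

lemma algorithm_complete:
  fixes Ps :: "(real ^ 'n) set list" and F :: "(real ^ ('n option)) set"
  assumes Ps: "\<forall>Q :: (real ^ 'n) set. reflexive_polytope Q \<longrightarrow> (\<exists>P\<in>set Ps. lattice_isomorphic P Q)"
    and run: "algorithm_run Ps L" and F: "fano_polytope F"
  shows "\<exists>Q\<in>set L. lattice_isomorphic F Q"
proof -
  obtain e T where e: "bij_betw e {..<CARD('n option)} (UNIV :: 'n option set)"
    and T: "admissible_transformations Ps T"
    and L: "set L = {fano_simplex} \<union> (if even CARD('n option) then {hexagon_sum e} else {}) \<union> constructed_polytopes Ps T"
    using run unfolding algorithm_run_def by blast
  define V where "V = vertices F"
  have V: "fano_set V" and FV: "F = convex hull V" using fano_polytope_vertices[OF F] by (simp_all add: V_def)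
  have d2: "CARD('n option) \<ge> 2" by (simp add: card_option)
  consider B where "lattice_basis B" "V = insert (- \<Sum>B) B" | "card V = 3 * CARD('n option)"
    | u where "facet_normal V u" "u \<bullet> \<Sum>V \<ge> 0" "\<forall>x\<in>V. u \<bullet> x \<ge> 1 - real CARD('n option)"
      "card V \<noteq> 3 * CARD('n option)"
    using good_facet[OF V d2] by blast
  then show ?thesis
  proof cases
    case 1
    then show ?thesis using lattice_isomorphic_fano_simplex[OF 1(1)] L FV by auto
  next
    case 2
    \<comment> \<open>With \<open>3 * d\<close> vertices there are \<open>d\<close> of negative
      height, so the sum has height at most 0 on the special facet; by the choice of this facet it
      then vanishes.\<close>
    have "\<Sum>V = 0"
    proof -
      obtain u where u: "facet_normal V u" "u \<bullet> \<Sum>V \<ge> 0" "u \<bullet> \<Sum>V = 0 \<longrightarrow> \<Sum>V = 0"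
        using special_facet[OF V] by blast
      interpret fano_facet V u by standard (fact V, fact u(1))
      have "card N1 = card B" using card_N0 card_N1[OF u(2)] card_V 2 BD(5) by simp
      moreover have "(\<Sum>x\<in>N1. u \<bullet> x) \<le> (\<Sum>x\<in>N1. -1)" using neg_le by (intro sum_mono) auto
      ultimately have "u \<bullet> \<Sum>V \<le> 0" using height_total by simp
      then show ?thesis using u by simp
    qed
    note h = lattice_isomorphic_hexagon_sum[OF V 2 this e]
    then show ?thesis using L FV by auto
  next
    case 3
    note u = 3(1)
    interpret B: fano_facet V u by standard (fact V, fact u)
    have cV: "card V \<le> 3 * CARD('n option) - 1" using B.card_V_le[OF 3(2)] 3(4) by simp
    have "B.B \<noteq> {}" using B.BD(5) by auto
    then obtain v where v: "v \<in> B.B" by blast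
    obtain f :: "real ^ 'n option \<Rightarrow> real ^ 'n" where f: "fano_projection V v f"
      using fano_projection_exists[OF V u v card_option] by blast
    interpret f: fano_projection V v f by fact
    obtain Q where Q: "Q \<in> set Ps" "lattice_isomorphic Q (convex hull f.W)" using Ps f.reflexive by blast
    obtain h where h: "h \<in> lattice_transformations" "h ` (convex hull f.W) = Q"
      using lattice_isomorphic_sym[OF Q(2)] unfolding lattice_isomorphic_def by blast
    interpret p1: fano_projection V v "\<lambda>x. h (f x)" by (rule fano_projection_comp[OF f h(1)])
    have W1: "convex hull p1.W = Q"
      using h(2) by (simp add: p1.hull_W f.hull_W image_image)
    let ?C = "convex hull ((\<lambda>x. h (f x)) ` (B.B - {v}))"
    have C: "?C \<in> base_simplices Q" "vertices ?C = (\<lambda>x. h (f x)) ` (B.B - {v})"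
      using p1.base_simplex[OF u v] W1 by simp_all
    have adm: "admissible_polytope Q" using p1.admissible cV W1 by simp
    have TC: "T Q ?C \<in> lattice_transformations" "T Q ?C ` vertices ?C = range unit_vec"
      using T Q(1) adm C(1) unfolding admissible_transformations_def by blast+
    define p where "p = (\<lambda>x. T Q ?C (h (f x)))"
    have p: "fano_projection V v p"
      unfolding p_def by (rule fano_projection_comp[OF p1.fano_projection_axioms TC(1)])
    interpret algorithm_output V v p u
    proof (intro algorithm_output.intro p algorithm_output_axioms.intro u v 3(2) cV)
      show "u \<bullet> x \<ge> 1 - real CARD('n option)" if "x \<in> V" for x using 3(3) that by blast
      show "p ` (tight V u - {v}) = range unit_vec" using TC(2) C(2) by (simp add: p_def image_image)
    qed
    have h2: "(\<lambda>x. h (f x)) ` (convex hull V) = Q" using W1 p1.hull_W by simp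
    have "P = p ` (convex hull V)" by (rule hull_W)
    also have "\<dots> = T Q ?C ` (\<lambda>x. h (f x)) ` (convex hull V)" unfolding p_def image_image ..
    also have "\<dots> = T Q ?C ` Q" by (rule arg_cong[OF h2])
    finally have PQ: "P = T Q ?C ` Q" .
    have out: "convex hull (lifted_points (T Q ?C ` Q) k D) = \<Phi> ` F"
      using output_polytope by (simp only: PQ FV)
    have "fano_polytope (convex hull (lifted_points (T Q ?C ` Q) k D))"
      unfolding out by (rule fano_polytope_image[OF \<Phi>_transformation F])
    then have "\<Phi> ` F \<in> constructed_polytopes Ps T"
      using Q(1) adm C(1) admissible_heights admissible_double_points out
      unfolding constructed_polytopes_def PQ by blast
    then have "\<Phi> ` F \<in> set L" using L by simp
    moreover have "lattice_isomorphic F (\<Phi> ` F)"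
      unfolding lattice_isomorphic_def using \<Phi>_transformation by blast
    ultimately show ?thesis by blast
  qed
qed

theorem proposition3p2:
  fixes Ps :: "(real ^ 'n) set list"
  assumes "\<forall>P\<in>set Ps. reflexive_polytope P"
    and "\<forall>Q :: (real ^ 'n) set. reflexive_polytope Q \<longrightarrow> (\<exists>P\<in>set Ps. lattice_isomorphic P Q)"
  shows "(\<exists>L. algorithm_run Ps L) \<and>
    (\<forall>L. algorithm_run Ps L \<longrightarrow>
       (\<forall>F\<in>set L. fano_polytope F) \<and>
       (\<forall>F :: (real ^ ('n option)) set. fano_polytope F \<longrightarrow> (\<exists>Q\<in>set L. lattice_isomorphic F Q)))"
  using algorithm_run_exists[OF assms(1)] algorithm_run_fano algorithm_complete[OF assms(2)] by blast

end
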